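(* Let Assumption (N) hold for the discrete coefficient $\alpha_{h,\tau}\in\mathcal V_{h,\tau}^{p,q}$. There exists a constant $C_\alpha>0$, independent of $h$, $\tau$ and $\delta$, such that if $$|k|\,\|\partial_t\alpha_{h,\tau}\|_{L^1(0,T;L^\infty(\Omega))}\le C_\alpha,$$ then every solution $u_{h,\tau}\in\mathcal V_{h,\tau}^{p,q}$ of the linearized problem (LP) satisfies $$|||u_{h,\tau}|||_\delta^2\lesssim \|f\|_{L^1(0,T;L^2(\Omega))}^2+\|(1+ku_0)u_1\|_{L^2(\Omega)}^2+c^2\|\nabla u_0\|_{L^2(\Omega)^d}^2+\bar\delta\|\nabla\partial_t\mu\|_{L^2(Q_T)^d}^2+\|\bar\tau^{-1}\xi\|_{L^1(0,T;L^2(\Omega))}^2 .$$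
   Context: Setting. $\Omega\subset\mathbb R^d$ ($d\in\{1,2,3\}$) is an open bounded polytopic domain with Lipschitz boundary, $T>0$, $Q_T=\Omega\times(0,T)$. Parameters: $k\in\mathbb R$, $c>0$, $\delta\in[0,\bar\delta]$ for a fixed $\bar\delta>0$; data $f\in L^1(0,T;L^2(\Omega))$, $u_0\in H^1_0(\Omega)$, $u_1$ with $(1+ku_0)u_1\in L^2(\Omega)$. $\{\mathcal T_h\}_{h>0}$ is a family of shape-regular conforming simplicial meshes of $\Omega$ with meshsize $h$; $\mathcal T_\tau$ is a partition $0=t_0<t_1<\dots<t_N=T$ with $I_n=(t_{n-1},t_n)$, $\tau_n=t_n-t_{n-1}$, $\tau=\max_n\tau_n$, $Q_n=\Omega\times I_n$, and $\bar\tau$ is the function with $\bar\tau|_{I_n}=\tau_n$. For piecewise smooth $v$ and $n=1,\dots,N-1$, the time jump is $[\![v]\!]_n(x)=v(x,t_n^-)-v(x,t_n^+)$. For integers $p,q\ge1$: $\mathcal V_h^p=\{v\in H^1_0(\Omega):v|_K\in\mathbb P^p(K)\ \forall K\in\mathcal T_h\}$; $\mathcal V_{h,\tau}^{p,q}=\{v\in C^0([0,T];H^1_0(\Omega)):v|_{Q_n}\in\mathbb P^q(I_n;\mathcal V_h^p)\ \forall n\}$; $\mathcal W_{h,\tau}^{p,q-1}=\{w\in L^2(0,T;H^1_0(\Omega)):w|_{Q_n}\in\mathbb P^{q-1}(I_n;\mathcal V_h^p)\ \forall n\}$. $(\cdot,\cdot)_D$ is the $L^2(D)$ inner product; $\Sigma_0=\Omega\times\{0\}$,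 $\Sigma_n=\Omega\times\{t_n\}$, $\Sigma_T=\Omega\times\{T\}$, and $(v,w)_{\Sigma_0}$, $\|v\|_{L^2(\Sigma_t)}$ denote $L^2(\Omega)$ quantities of the traces at the given time (one-sided from inside $(0,T)$). Linearized problem (LP): given $\alpha_{h,\tau}\in\mathcal V_{h,\tau}^{p,q}$, $\mu\in H^1(0,T;H^1_0(\Omega))$, $\xi\in L^2(Q_T)$, find $u_{h,\tau}\in\mathcal V_{h,\tau}^{p,q}$ with $\widetilde B(u_{h,\tau},(w,z))=L_\delta(w,z)$ for all $(w,z)\in\mathcal W_{h,\tau}^{p,q-1}\times\mathcal V_h^p$, where $\widetilde B(u,(w,z))=\sum_{n=1}^N(\partial_t((1+k\alpha_{h,\tau})\partial_tu),w)_{Q_n}-\sum_{n=1}^{N-1}((1+k\alpha_{h,\tau}(\cdot,t_n))[\![\partial_tu]\!]_n,w(\cdot,t_n^+))_\Omega+((1+k\alpha_{h,\tau})\partial_tu,w)_{\Sigma_0}+c^2(\nabla u,\nabla w)_{Q_T}+\delta(\nabla\partial_tu,\nabla w)_{Q_T}+(\nabla u(\cdot,0),\nabla z)_\Omega$, $L_\delta(w,z)=(f,w)_{Q_T}+((1+ku_0)u_1,w(\cdot,0))_\Omega+\delta(\nabla\partial_t\mu,\nabla w)_{Q_T}+\sum_{n=1}^N(\xi,\partial_tw)_{Q_n}+(\nabla u_0,\nabla z)_\Omega$. Assumption (N) (nondegeneracy): there are constants $\underline\alpha,\overline\alpha>0$ independent of $h,\tau,\delta$ with $0<1-|k|\underline\alpha\le1+k\alpha_{h,\tau}(x,t)\le1+|k|\overline\alpha$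 for all $(x,t)\in Q_T$. Energy norm: with $|v|_J^2=\tfrac12(\|v\|_{L^2(\Sigma_T)}^2+\sum_{n=1}^{N-1}\|[\![v]\!]_n\|_{L^2(\Omega)}^2+\|v\|_{L^2(\Sigma_0)}^2)$, $|||u|||_\delta^2=\|\partial_tu\|_{L^\infty(0,T;L^2(\Omega))}^2+c^2\|\nabla u\|_{L^\infty(0,T;L^2(\Omega)^d)}^2+|\partial_tu|_J^2+c^2\|\nabla u\|_{L^2(\Sigma_T)^d}^2+c^2\|\nabla u\|_{L^2(\Sigma_0)^d}^2+\delta\|\nabla\partial_tu\|_{L^2(Q_T)^d}^2$. Convention: $a\lesssim b$ means $a\le Cb$ with $C>0$ independent of $h$, $\tau$ and $\delta$. *)

theory Defs
  imports "HOL-Analysis.Analysis"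
begin

definition lipschitz_boundary :: "'a::euclidean_space set \<Rightarrow> bool" where
  "lipschitz_boundary \<Omega> \<longleftrightarrow>
    (\<forall>x\<in>frontier \<Omega>. \<exists>r>0. \<exists>e g L. norm e = 1 \<and>
        (\<forall>y z. y \<bullet> e = 0 \<longrightarrow> z \<bullet> e = 0 \<longrightarrow> \<bar>g y - g z\<bar> \<le> L * norm (y - z)) \<and>
        \<Omega> \<inter> ball x r = {y \<in> ball x r. y \<bullet> e > g (y - (y \<bullet> e) *\<^sub>R e)})"

definition polytopic_domain :: "'a::euclidean_space set \<Rightarrow> bool" where
  "polytopic_domain \<Omega> \<longleftrightarrow> open \<Omega> \<and> connected \<Omega> \<and> bounded \<Omega> \<and> \<Omega> \<noteq> {} \<and>
     (\<exists>P. finite P \<and> (\<forall>S\<in>P. polytope S) \<and> closure \<Omega> = \<Union>P) \<and> lipschitz_boundary \<Omega>"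

definition conforming_mesh :: "'a::euclidean_space set set \<Rightarrow> 'a set \<Rightarrow> bool" where
  "conforming_mesh M \<Omega> \<longleftrightarrow> finite M \<and> M \<noteq> {} \<and> (\<forall>K\<in>M. int DIM('a) simplex K) \<and>
     \<Union>M = closure \<Omega> \<and> (\<forall>K\<in>M. \<forall>K'\<in>M. (K \<inter> K') face_of K \<and> (K \<inter> K') face_of K')"

definition inradius :: "'a::euclidean_space set \<Rightarrow> real" where
  "inradius K = Sup {r. \<exists>x. ball x r \<subseteq> K}"

definition shape_regular :: "real \<Rightarrow> 'a::euclidean_space set set \<Rightarrow> bool" where
  "shape_regular \<sigma> M \<longleftrightarrow> (\<forall>K\<in>M. diameter K \<le> \<sigma> * inradius K)"

definition time_partition :: "real \<Rightarrow> nat \<Rightarrow> (nat \<Rightarrow> real) \<Rightarrow> bool" where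
  "time_partition T N tt \<longleftrightarrow> N \<ge> 1 \<and> tt 0 = 0 \<and> tt N = T \<and> (\<forall>n<N. tt n < tt (Suc n))"

inductive mpoly_le :: "nat \<Rightarrow> ('a::euclidean_space \<Rightarrow> real) \<Rightarrow> bool" where
  const: "mpoly_le n (\<lambda>x. a)"
| lin: "1 \<le> n \<Longrightarrow> mpoly_le n (\<lambda>x. x \<bullet> v)"
| add: "mpoly_le n f \<Longrightarrow> mpoly_le n g \<Longrightarrow> mpoly_le n (\<lambda>x. f x + g x)"
| mult: "mpoly_le n f \<Longrightarrow> mpoly_le m g \<Longrightarrow> mpoly_le (n + m) (\<lambda>x. f x * g x)"

text \<open>V_h^p: continuous piecewise P^p functions vanishing outside \<Omega> (= H^1_0 conforming).\<close>
definition Vh :: "'a::euclidean_space set set \<Rightarrow> 'a set \<Rightarrow> nat \<Rightarrow> ('a \<Rightarrow> real) \<Rightarrow> bool" where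
  "Vh M \<Omega> p v \<longleftrightarrow> continuous_on UNIV v \<and> (\<forall>x. x \<notin> \<Omega> \<longrightarrow> v x = 0) \<and>
     (\<forall>K\<in>M. \<exists>P. mpoly_le p P \<and> (\<forall>x\<in>K. v x = P x))"

text \<open>An element of P^q(I; V_h^p), given on all times by its polynomial formula.\<close>
definition Ppiece :: "'a::euclidean_space set set \<Rightarrow> 'a set \<Rightarrow> nat \<Rightarrow> nat \<Rightarrow> ('a \<Rightarrow> real \<Rightarrow> real) \<Rightarrow> bool" where
  "Ppiece M \<Omega> p q U \<longleftrightarrow> (\<exists>cf. (\<forall>j\<le>q. Vh M \<Omega> p (cf j)) \<and> (\<forall>x t. U x t = (\<Sum>j\<le>q. t ^ j * cf j x)))"

text \<open>V_{h,tau}^{p,q}, represented by its pieces U n on Q_n (n = 1..N), continuous in time.\<close>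
definition Vht :: "'a::euclidean_space set set \<Rightarrow> 'a set \<Rightarrow> nat \<Rightarrow> nat \<Rightarrow> nat \<Rightarrow> (nat \<Rightarrow> real)
    \<Rightarrow> (nat \<Rightarrow> 'a \<Rightarrow> real \<Rightarrow> real) \<Rightarrow> bool" where
  "Vht M \<Omega> p q N tt U \<longleftrightarrow> (\<forall>n\<in>{1..N}. Ppiece M \<Omega> p q (U n)) \<and>
     (\<forall>n\<in>{1..<N}. \<forall>x. U n x (tt n) = U (Suc n) x (tt n))"

text \<open>W_{h,tau}^{p,q-1}, represented by its pieces (possibly discontinuous in time).\<close>
definition Wht :: "'a::euclidean_space set set \<Rightarrow> 'a set \<Rightarrow> nat \<Rightarrow> nat \<Rightarrow> nat
    \<Rightarrow> (nat \<Rightarrow> 'a \<Rightarrow> real \<Rightarrow> real) \<Rightarrow> bool" where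
  "Wht M \<Omega> p q' N W \<longleftrightarrow> (\<forall>n\<in>{1..N}. Ppiece M \<Omega> p q' (W n))"

definition sgrad :: "('a::euclidean_space \<Rightarrow> real) \<Rightarrow> 'a \<Rightarrow> 'a" where
  "sgrad f x = (if f differentiable (at x)
                then (\<Sum>b\<in>Basis. frechet_derivative f (at x) b *\<^sub>R b) else 0)"

definition dtp :: "('a \<Rightarrow> real \<Rightarrow> real) \<Rightarrow> 'a \<Rightarrow> real \<Rightarrow> real" where
  "dtp U x t = deriv (\<lambda>s. U x s) t"

definition gradx :: "('a::euclidean_space \<Rightarrow> real \<Rightarrow> real) \<Rightarrow> 'a \<Rightarrow> real \<Rightarrow> 'a" where
  "gradx U x t = sgrad (\<lambda>y. U y t) x"

definition Oint :: "'a::euclidean_space set \<Rightarrow> ('a \<Rightarrow> real) \<Rightarrow> real" where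
  "Oint \<Omega> F = (LINT x:\<Omega>|lebesgue. F x)"

definition Qint :: "'a::euclidean_space set \<Rightarrow> real \<Rightarrow> real \<Rightarrow> ('a \<Rightarrow> real \<Rightarrow> real) \<Rightarrow> real" where
  "Qint \<Omega> a b F = (LINT z:(\<Omega> \<times> {a..b})|lebesgue. F (fst z) (snd z))"

fun Diter :: "'a list \<Rightarrow> ('a::euclidean_space \<Rightarrow> real) \<Rightarrow> 'a \<Rightarrow> real" where
  "Diter [] f = f"
| "Diter (v # vs) f = (\<lambda>x. frechet_derivative (Diter vs f) (at x) v)"

definition Cinf :: "('a::euclidean_space \<Rightarrow> real) \<Rightarrow> bool" where
  "Cinf f \<longleftrightarrow> (\<forall>vs x. Diter vs f differentiable (at x))"

text \<open>u \<in> H^1_0(\<Omega>) with (weak) gradient G: H^1-limit of C_c^\<infinity>(\<Omega>) functions.\<close>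
definition H10 :: "'a::euclidean_space set \<Rightarrow> ('a \<Rightarrow> real) \<Rightarrow> ('a \<Rightarrow> 'a) \<Rightarrow> bool" where
  "H10 \<Omega> u G \<longleftrightarrow> set_borel_measurable lebesgue \<Omega> u \<and> set_borel_measurable lebesgue \<Omega> G \<and>
     set_integrable lebesgue \<Omega> (\<lambda>x. (u x)\<^sup>2) \<and> set_integrable lebesgue \<Omega> (\<lambda>x. (norm (G x))\<^sup>2) \<and>
     (\<exists>\<phi>. (\<forall>n. Cinf (\<phi> n) \<and> compact (closure {x. \<phi> n x \<noteq> 0}) \<and> closure {x. \<phi> n x \<noteq> 0} \<subseteq> \<Omega>) \<and>
        (\<lambda>n. Oint \<Omega> (\<lambda>x. (\<phi> n x - u x)\<^sup>2)) \<longlonglongrightarrow> 0 \<and>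
        (\<lambda>n. Oint \<Omega> (\<lambda>x. (norm (sgrad (\<phi> n) x - G x))\<^sup>2)) \<longlonglongrightarrow> 0)"

text \<open>\<mu> \<in> H^1(0,T;H^1_0(\<Omega>)) with weak derivatives Mx = \<nabla>\<mu>, Mt = \<partial>_t\<mu>, G = \<nabla>\<partial>_t\<mu>:
  limit in that norm on Q_T of smooth functions with compact spatial support in \<Omega>.\<close>
definition H1H10 :: "'a::euclidean_space set \<Rightarrow> real \<Rightarrow> ('a \<Rightarrow> real \<Rightarrow> real) \<Rightarrow> ('a \<Rightarrow> real \<Rightarrow> 'a)
    \<Rightarrow> ('a \<Rightarrow> real \<Rightarrow> real) \<Rightarrow> ('a \<Rightarrow> real \<Rightarrow> 'a) \<Rightarrow> bool" where
  "H1H10 \<Omega> T \<mu> Mx Mt G \<longleftrightarrow>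
     (let Q = \<Omega> \<times> {0<..<T} in
      set_borel_measurable lebesgue Q (\<lambda>z. \<mu> (fst z) (snd z)) \<and>
      set_borel_measurable lebesgue Q (\<lambda>z. Mx (fst z) (snd z)) \<and>
      set_borel_measurable lebesgue Q (\<lambda>z. Mt (fst z) (snd z)) \<and>
      set_borel_measurable lebesgue Q (\<lambda>z. G (fst z) (snd z)) \<and>
      set_integrable lebesgue Q (\<lambda>z. (\<mu> (fst z) (snd z))\<^sup>2) \<and>
      set_integrable lebesgue Q (\<lambda>z. (norm (Mx (fst z) (snd z)))\<^sup>2) \<and>
      set_integrable lebesgue Q (\<lambda>z. (Mt (fst z) (snd z))\<^sup>2) \<and>
      set_integrable lebesgue Q (\<lambda>z. (norm (G (fst z) (snd z)))\<^sup>2) \<and>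
      (\<exists>\<psi>. (\<forall>n. Cinf (\<lambda>z. \<psi> n (fst z) (snd z)) \<and>
              (\<exists>K. compact K \<and> K \<subseteq> \<Omega> \<and> (\<forall>x t. x \<notin> K \<longrightarrow> \<psi> n x t = 0))) \<and>
        (\<lambda>n. Qint \<Omega> 0 T (\<lambda>x t. (\<psi> n x t - \<mu> x t)\<^sup>2)) \<longlonglongrightarrow> 0 \<and>
        (\<lambda>n. Qint \<Omega> 0 T (\<lambda>x t. (norm (gradx (\<psi> n) x t - Mx x t))\<^sup>2)) \<longlonglongrightarrow> 0 \<and>
        (\<lambda>n. Qint \<Omega> 0 T (\<lambda>x t. (dtp (\<psi> n) x t - Mt x t)\<^sup>2)) \<longlonglongrightarrow> 0 \<and>
        (\<lambda>n. Qint \<Omega> 0 T (\<lambda>x t. (norm (gradx (dtp (\<psi> n)) x t - G x t))\<^sup>2)) \<longlonglongrightarrow> 0))"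

definition L1L2 :: "'a::euclidean_space set \<Rightarrow> real \<Rightarrow> ('a \<Rightarrow> real \<Rightarrow> real) \<Rightarrow> bool" where
  "L1L2 \<Omega> T f \<longleftrightarrow> set_borel_measurable lebesgue (\<Omega> \<times> {0<..<T}) (\<lambda>z. f (fst z) (snd z)) \<and>
     (AE t in lebesgue. t \<in> {0<..<T} \<longrightarrow> set_integrable lebesgue \<Omega> (\<lambda>x. (f x t)\<^sup>2)) \<and>
     set_integrable lebesgue {0<..<T} (\<lambda>t. sqrt (Oint \<Omega> (\<lambda>x. (f x t)\<^sup>2)))"

definition L1L2_norm :: "'a::euclidean_space set \<Rightarrow> real \<Rightarrow> ('a \<Rightarrow> real \<Rightarrow> real) \<Rightarrow> real" where
  "L1L2_norm \<Omega> T f = (LINT t:{0<..<T}|lebesgue. sqrt (Oint \<Omega> (\<lambda>x. (f x t)\<^sup>2)))"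

text \<open>Bilinear form \<tilde>B(u,(w,z)); A = pieces of \<alpha>_{h,tau}, U = pieces of u, W = pieces of w.\<close>
definition Bform :: "'a::euclidean_space set \<Rightarrow> real \<Rightarrow> real \<Rightarrow> real \<Rightarrow> nat \<Rightarrow> (nat \<Rightarrow> real)
   \<Rightarrow> (nat \<Rightarrow> 'a \<Rightarrow> real \<Rightarrow> real) \<Rightarrow> (nat \<Rightarrow> 'a \<Rightarrow> real \<Rightarrow> real) \<Rightarrow> (nat \<Rightarrow> 'a \<Rightarrow> real \<Rightarrow> real)
   \<Rightarrow> ('a \<Rightarrow> real) \<Rightarrow> real" where
  "Bform \<Omega> k c \<delta> N tt A U W z =
      (\<Sum>n=1..N. Qint \<Omega> (tt (n - 1)) (tt n)
          (\<lambda>x t. dtp (\<lambda>y s. (1 + k * A n y s) * dtp (U n) y s) x t * W n x t))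
    - (\<Sum>n\<in>{1..<N}. Oint \<Omega> (\<lambda>x. (1 + k * A n x (tt n)) *
          (dtp (U n) x (tt n) - dtp (U (Suc n)) x (tt n)) * W (Suc n) x (tt n)))
    + Oint \<Omega> (\<lambda>x. (1 + k * A 1 x 0) * dtp (U 1) x 0 * W 1 x 0)
    + c\<^sup>2 * (\<Sum>n=1..N. Qint \<Omega> (tt (n - 1)) (tt n) (\<lambda>x t. gradx (U n) x t \<bullet> gradx (W n) x t))
    + \<delta> * (\<Sum>n=1..N. Qint \<Omega> (tt (n - 1)) (tt n) (\<lambda>x t. gradx (dtp (U n)) x t \<bullet> gradx (W n) x t))
    + Oint \<Omega> (\<lambda>x. sgrad (\<lambda>y. U 1 y 0) x \<bullet> sgrad z x)"

text \<open>Right-hand side L_\<delta>(w,z); g = (1+ku_0)u_1, G = \<nabla>\<partial>_t\<mu>, G0 = \<nabla>u_0.\<close>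
definition Lform :: "'a::euclidean_space set \<Rightarrow> real \<Rightarrow> nat \<Rightarrow> (nat \<Rightarrow> real)
   \<Rightarrow> ('a \<Rightarrow> real \<Rightarrow> real) \<Rightarrow> ('a \<Rightarrow> real) \<Rightarrow> ('a \<Rightarrow> real \<Rightarrow> 'a) \<Rightarrow> ('a \<Rightarrow> real \<Rightarrow> real) \<Rightarrow> ('a \<Rightarrow> 'a)
   \<Rightarrow> (nat \<Rightarrow> 'a \<Rightarrow> real \<Rightarrow> real) \<Rightarrow> ('a \<Rightarrow> real) \<Rightarrow> real" where
  "Lform \<Omega> \<delta> N tt f g G \<xi> G0 W z =
      (\<Sum>n=1..N. Qint \<Omega> (tt (n - 1)) (tt n) (\<lambda>x t. f x t * W n x t))
    + Oint \<Omega> (\<lambda>x. g x * W 1 x 0)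
    + \<delta> * (\<Sum>n=1..N. Qint \<Omega> (tt (n - 1)) (tt n) (\<lambda>x t. G x t \<bullet> gradx (W n) x t))
    + (\<Sum>n=1..N. Qint \<Omega> (tt (n - 1)) (tt n) (\<lambda>x t. \<xi> x t * dtp (W n) x t))
    + Oint \<Omega> (\<lambda>x. G0 x \<bullet> sgrad z x)"

definition assumption_N :: "'a::euclidean_space set \<Rightarrow> real \<Rightarrow> real \<Rightarrow> real \<Rightarrow> real \<Rightarrow> nat \<Rightarrow> (nat \<Rightarrow> real)
    \<Rightarrow> (nat \<Rightarrow> 'a \<Rightarrow> real \<Rightarrow> real) \<Rightarrow> bool" where
  "assumption_N \<Omega> T k alo ahi N tt A \<longleftrightarrow> 0 < 1 - \<bar>k\<bar> * alo \<and>
     (\<forall>n\<in>{1..N}. \<forall>x\<in>\<Omega>. \<forall>t\<in>{tt (n - 1)..tt n}. 0 < t \<and> t < T \<longrightarrow>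
        1 - \<bar>k\<bar> * alo \<le> 1 + k * A n x t \<and> 1 + k * A n x t \<le> 1 + \<bar>k\<bar> * ahi)"

definition L1Linf_dt :: "'a::euclidean_space set \<Rightarrow> nat \<Rightarrow> (nat \<Rightarrow> real) \<Rightarrow> (nat \<Rightarrow> 'a \<Rightarrow> real \<Rightarrow> real) \<Rightarrow> real" where
  "L1Linf_dt \<Omega> N tt A = (\<Sum>n=1..N. LINT t:{tt (n - 1)..tt n}|lebesgue. (SUP x\<in>\<Omega>. \<bar>dtp (A n) x t\<bar>))"

definition energy_sq :: "'a::euclidean_space set \<Rightarrow> real \<Rightarrow> real \<Rightarrow> nat \<Rightarrow> (nat \<Rightarrow> real)
    \<Rightarrow> (nat \<Rightarrow> 'a \<Rightarrow> real \<Rightarrow> real) \<Rightarrow> real" where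
  "energy_sq \<Omega> c \<delta> N tt U =
      (SUP (n, t)\<in>(SIGMA n:{1..N}. {tt (n - 1)..tt n}). Oint \<Omega> (\<lambda>x. (dtp (U n) x t)\<^sup>2))
    + c\<^sup>2 * (SUP (n, t)\<in>(SIGMA n:{1..N}. {tt (n - 1)..tt n}). Oint \<Omega> (\<lambda>x. (norm (gradx (U n) x t))\<^sup>2))
    + (1 / 2) * (Oint \<Omega> (\<lambda>x. (dtp (U N) x (tt N))\<^sup>2)
        + (\<Sum>n\<in>{1..<N}. Oint \<Omega> (\<lambda>x. (dtp (U n) x (tt n) - dtp (U (Suc n)) x (tt n))\<^sup>2))
        + Oint \<Omega> (\<lambda>x. (dtp (U 1) x 0)\<^sup>2))
    + c\<^sup>2 * Oint \<Omega> (\<lambda>x. (norm (gradx (U N) x (tt N)))\<^sup>2)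
    + c\<^sup>2 * Oint \<Omega> (\<lambda>x. (norm (gradx (U 1) x 0))\<^sup>2)
    + \<delta> * (\<Sum>n=1..N. Qint \<Omega> (tt (n - 1)) (tt n) (\<lambda>x t. (norm (gradx (dtp (U n)) x t))\<^sup>2))"

end

theory Submission
  imports Defs "HOL-Computational_Algebra.Polynomial"
begin

text \<open>
  Everything is localized to a single time slab by test functions that vanish on all other slabs.
  Testing with \<open>\<partial>\<^sub>tu\<close> gives the energy identity at the time nodes, with control of the jumps and of the damping.
  It does not control the interior of a slab. For that we test with the \<open>L\<^sup>2\<close>-projection in time of
  \<open>\<phi> \<partial>\<^sub>tu\<close> onto polynomials of degree \<open>q - 1\<close>, where \<open>\<phi>\<close> decreases linearly from 1 to 0 on the slab.
  Because \<open>\<phi>' < 0\<close>, the momentum term with the coefficient frozen at the left node yields the mean over the slab of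
  \<open>\<parallel>\<partial>\<^sub>tu\<parallel>\<^sup>2\<close>, and the stiffness term yields the mean of \<open>\<parallel>\<Pi>\<nabla>u\<parallel>\<^sup>2\<close>; up to nodal
  values these dominate the suprema, by equivalence of norms on polynomials of bounded degree. Freezing the coefficient
  costs \<open>|k|\<parallel>\<partial>\<^sub>t\<alpha>\<parallel>\<close> times the supremum of \<open>\<parallel>\<partial>\<^sub>tu\<parallel>\<^sup>2\<close>, which is absorbed
  when that norm is small. All identities in time hold pointwise in space and are then integrated over the domain.
\<close>

section \<open>Monic orthogonal polynomials on the unit interval\<close>

text \<open>The test space has degree \<open>q - 1\<close> in time, one less than \<open>u\<close>,
  whereas \<phi> \<partial>_t u has degree \<open>q\<close>; hence the projection. It is invisible
  against factors of degree below \<open>q\<close>, such as the second time derivative, but not once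
  that derivative is multiplied by a coefficient varying in time: this is why the coefficient is
  frozen. The gradient of \<open>u\<close> has degree \<open>q\<close>, so only its projection is
  seen; the missing leading coefficient is recovered from the value at the left node, because the
  orthogonal polynomial of degree \<open>q\<close> does not vanish there. Constants come from the
  reference interval in time. A factor 1/\<tau>_n from a time derivative cancels against the slab
  length; it survives only on \<xi>, which is paired with the derivative of the test function. The
  two tests are coupled. The nodal inequality contains slab suprema, through the coefficient and the
  sources that are only L^1 in time; the interior inequality contains nodal quantities. The loop
  closes at the slab with the largest mean: smallness handles its linear occurrence, Young's
  inequality its square root.\<close>

definition tpoly :: "nat \<Rightarrow> (nat \<Rightarrow> 'b::real_vector) \<Rightarrow> real \<Rightarrow> 'b" where
  "tpoly q c s = (\<Sum>j<q. s ^ j *\<^sub>R c j)"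

lemma tpoly_Suc: "tpoly (Suc q) c s = tpoly q c s + s ^ q *\<^sub>R c q"
  by (simp add: tpoly_def)

lemma continuous_on_tpoly [continuous_intros]:
  fixes c :: "nat \<Rightarrow> 'b::real_normed_vector"
  shows "continuous_on S g \<Longrightarrow> continuous_on S (\<lambda>s. tpoly q c (g s))"
  unfolding tpoly_def by (intro continuous_intros)

lemma poly_eq_sum_lessThan:
  fixes p :: "real poly"
  assumes "\<forall>i\<ge>q. coeff p i = 0"
  shows "poly p s = (\<Sum>i<q. coeff p i * s ^ i)"
proof -
  have "(\<Sum>i\<le>degree p. coeff p i * s ^ i) = (\<Sum>i\<in>{..<q} \<union> {..degree p}. coeff p i * s ^ i)"
    by (rule sum.mono_neutral_left) (auto simp: coeff_eq_0)
  also have "\<dots> = (\<Sum>i<q. coeff p i * s ^ i)"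
    using assms by (intro sum.mono_neutral_right) auto
  finally show ?thesis by (simp add: poly_altdef)
qed

text \<open>Gram-Schmidt, one degree at a time. The induction hypothesis for
  \<open>monom 1 m\<close> yields a monic \<open>L\<close> of degree \<open>m\<close> orthogonal to
  all lower degrees; the hypothesis for \<open>g\<close> yields \<open>p\<close>, which is then
  corrected by the component of \<open>g\<close> along \<open>L\<close>. Both uses require
  \<open>g\<close> to be arbitrary in the induction.\<close>

lemma poly_integral_projection:
  "\<exists>p. (\<forall>i\<ge>m. coeff p i = 0) \<and>
     (\<forall>r. (\<forall>i\<ge>m. coeff r i = 0) \<longrightarrow> integral {0..1::real} (poly ((g - p) * r)) = 0)"
proof (induction m arbitrary: g)
  case 0
  have "poly r = (\<lambda>_. 0)" if "\<forall>i. coeff r i = 0" for r :: "real poly"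
  proof -
    have "r = 0" by (rule poly_eqI) (simp add: that)
    then show ?thesis by auto
  qed
  then have "poly ((g - 0) * r) = (\<lambda>_. 0)" if "\<forall>i\<ge>0. coeff r i = 0" for r
    using that by auto
  then show ?case by (intro exI[of _ 0]) simp
next
  case (Suc m)
  define I where "I p = integral {0..1::real} (poly p)" for p
  have int: "poly p integrable_on {0..1}" for p :: "real poly"
    by (intro integrable_continuous_interval continuous_intros)
  have Iadd: "I (p + r) = I p + I r" for p r
  proof -
    have "poly (p + r) = (\<lambda>x. poly p x + poly r x)" by auto
    then show ?thesis unfolding I_def using int[of p] int[of r] by (simp add: integral_add)
  qed
  have Ism: "I (smult a p) = a * I p" for p a
  proof -
    have "poly (smult a p) = (\<lambda>x. a * poly p x)" by auto
    then show ?thesis unfolding I_def by simp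
  qed
  obtain q where q0: "\<forall>i\<ge>m. coeff q i = 0"
    and q: "\<And>r. (\<forall>i\<ge>m. coeff r i = 0) \<Longrightarrow> I ((monom 1 m - q) * r) = 0"
    using Suc[of "monom 1 m"] unfolding I_def by blast
  obtain p where p0: "\<forall>i\<ge>m. coeff p i = 0"
    and p: "\<And>r. (\<forall>i\<ge>m. coeff r i = 0) \<Longrightarrow> I ((g - p) * r) = 0"
    using Suc[of g] unfolding I_def by blast
  define L where "L = monom 1 m - q"
  have Lm: "coeff L m = 1" using q0 by (simp add: L_def)
  have Li: "coeff L i = 0" if "i > m" for i using q0 that by (simp add: L_def)
  have L0: "L \<noteq> 0" using Lm by auto
  \<comment> \<open>A nonzero polynomial has finitely many roots and cannot vanish on the whole
    interval, so the division defining \<open>a\<close> is legitimate.\<close>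
  have "I (L * L) \<noteq> 0"
  proof
    assume 0: "I (L * L) = 0"
    have "continuous_on {0..1} (poly (L * L))" by (intro continuous_intros)
    from integral_eq_0_iff[OF this] have "\<forall>x\<in>{0..1}. poly (L * L) x = 0"
      using 0 by (simp add: I_def)
    then have "{0..1} \<subseteq> {x. poly L x = 0}" by auto
    with poly_roots_finite[OF L0] have "finite {0..1::real}" by (rule finite_subset[rotated])
    then show False using infinite_Icc[of 0 "1::real"] by simp
  qed
  define a where "a = I (g * L) / I (L * L)"
  have IpL: "I ((g - p) * L) = I (g * L)"
  proof -
    have "I (L * p) = 0" using q[of p] p0 by (simp add: L_def)
    moreover have "(g - p) * L = g * L + smult (-1) (L * p)" by (simp add: algebra_simps)
    ultimately show ?thesis by (simp only: Iadd Ism)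
  qed
  show ?case
  proof (intro exI[of _ "p + smult a L"] conjI allI impI)
    fix i assume "Suc m \<le> i"
    then show "coeff (p + smult a L) i = 0" using p0 Li by simp
  next
    fix r :: "real poly" assume r: "\<forall>i\<ge>Suc m. coeff r i = 0"
    define r' where "r' = r - smult (coeff r m) L"
    have r': "\<forall>i\<ge>m. coeff r' i = 0"
    proof (intro allI impI)
      fix i assume "i \<ge> m"
      then show "coeff r' i = 0" using r Lm Li by (cases "i = m") (auto simp: r'_def)
    qed
    \<comment> \<open>Removing the leading coefficient of \<open>r\<close> leaves \<open>r'\<close>
      of degree below \<open>m\<close>, where both orthogonality relations apply; the part along
      \<open>L\<close> vanishes by the choice of \<open>a\<close>.\<close>
    have e: "(g - (p + smult a L)) * r = (g - p) * r' + smult (- a) (L * r')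
        + smult (coeff r m) ((g - p) * L + smult (- a) (L * L))"
      by (simp add: r'_def ring_distribs smult_diff_right mult.commute)
    have "I ((g - (p + smult a L)) * r) = 0"
      unfolding e Iadd Ism IpL using p[OF r'] q[OF r'] \<open>I (L * L) \<noteq> 0\<close>
      by (simp add: L_def[symmetric] a_def)
    then show "integral {0..1} (poly ((g - (p + smult a L)) * r)) = 0" by (simp add: I_def)
  qed
qed

lemma ex_monic_orthogonal:
  "\<exists>l::nat \<Rightarrow> real. \<forall>j<q. integral {0..1} (\<lambda>s. (s ^ q + (\<Sum>i<q. l i * s ^ i)) * s ^ j) = 0"
proof -
  obtain p :: "real poly" where p0: "\<forall>i\<ge>q. coeff p i = 0"
    and p: "\<And>r. (\<forall>i\<ge>q. coeff r i = 0) \<Longrightarrow> integral {0..1} (poly ((monom 1 q - p) * r)) = 0"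
    using poly_integral_projection[of q "monom 1 q"] by blast
  have pe: "poly p s = (\<Sum>i<q. coeff p i * s ^ i)" for s
    using p0 by (rule poly_eq_sum_lessThan)
  show ?thesis
  proof (intro exI[of _ "\<lambda>i. - coeff p i"] allI impI)
    fix j assume "j < q"
    then have "integral {0..1} (poly ((monom 1 q - p) * monom 1 j)) = 0"
      by (intro p) auto
    moreover have "poly ((monom 1 q - p) * monom 1 j)
        = (\<lambda>s. (s ^ q + (\<Sum>i<q. - coeff p i * s ^ i)) * s ^ j)"
      by (auto simp: poly_monom pe sum_negf)
    ultimately show "integral {0..1} (\<lambda>s. (s ^ q + (\<Sum>i<q. - coeff p i * s ^ i)) * s ^ j) = 0" by simp
  qed
qed

text \<open>The lower coefficients of the monic shifted Legendre polynomial. They are chosen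
  nonconstructively: everything later is derived from monicity and orthogonality.\<close>

definition lcoef :: "nat \<Rightarrow> nat \<Rightarrow> real" where
  "lcoef q = (SOME l. \<forall>j<q. integral {0..1} (\<lambda>s. (s ^ q + (\<Sum>i<q. l i * s ^ i)) * s ^ j) = 0)"

definition leg :: "nat \<Rightarrow> real \<Rightarrow> real" where
  "leg q s = s ^ q + (\<Sum>i<q. lcoef q i * s ^ i)"

lemma continuous_on_leg [continuous_intros]:
  "continuous_on S g \<Longrightarrow> continuous_on S (\<lambda>s. leg q (g s))"
  unfolding leg_def by (intro continuous_intros)

lemma leg_orth_monom: "j < q \<Longrightarrow> integral {0..1} (\<lambda>s. leg q s * s ^ j) = 0"
  unfolding leg_def lcoef_def using someI_ex[OF ex_monic_orthogonal[of q]] by blast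

text \<open>Pairing with a fixed vector \<open>e\<close> reduces vector-valued polynomials to the
  scalar relation; the same statement then serves time derivatives and spatial gradients.\<close>

lemma leg_orth:
  fixes c :: "nat \<Rightarrow> 'b::euclidean_space"
  assumes "m \<le> q"
  shows "((\<lambda>s. leg q s * (e \<bullet> tpoly m c s)) has_integral 0) {0..1}"
proof -
  have "((\<lambda>s. \<Sum>j<m. (e \<bullet> c j) * (leg q s * s ^ j)) has_integral (\<Sum>j<m. (e \<bullet> c j) * 0)) {0..1}"
  proof (intro has_integral_sum has_integral_mult_right finite_lessThan)
    fix j assume "j \<in> {..<m}"
    moreover have "(\<lambda>s. leg q s * s ^ j) integrable_on {0..1}"
      by (intro integrable_continuous_interval continuous_intros)
    ultimately show "((\<lambda>s. leg q s * s ^ j) has_integral 0) {0..1}"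
      using leg_orth_monom[of j q] assms by (metis has_integral_integral lessThan_iff order_less_le_trans)
  qed
  moreover have "(\<lambda>s. \<Sum>j<m. (e \<bullet> c j) * (leg q s * s ^ j)) = (\<lambda>s. leg q s * (e \<bullet> tpoly m c s))"
    by (auto simp: tpoly_def inner_sum_right sum_distrib_left mult_ac)
  ultimately show ?thesis by simp
qed

lemma leg_poly: "\<exists>p. coeff p q = 1 \<and> (\<forall>i>q. coeff p i = 0) \<and> poly p = leg q"
proof (intro exI[of _ "monom 1 q + (\<Sum>i<q. monom (lcoef q i) i)"] conjI allI impI)
  show "coeff (monom 1 q + (\<Sum>i<q. monom (lcoef q i) i)) q = 1"
    by (auto simp: coeff_sum)
  show "coeff (monom 1 q + (\<Sum>i<q. monom (lcoef q i) i)) i = 0" if "i > q" for i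
    using that by (auto simp: coeff_sum)
qed (auto simp: leg_def poly_sum poly_monom)

lemma poly_zero_on_interval:
  fixes p :: "real poly"
  assumes "\<And>s. s \<in> {0<..<1} \<Longrightarrow> poly p s = 0"
  shows "p = 0"
proof (rule ccontr)
  assume "p \<noteq> 0"
  then have "finite {x. poly p x = 0}" by (rule poly_roots_finite)
  moreover have "{0<..<1} \<subseteq> {x. poly p x = 0}" using assms by auto
  ultimately have "finite {0<..<1::real}" by (rule finite_subset[rotated])
  then show False using infinite_Ioo[of 0 "1::real"] by simp
qed

lemma leg_square_pos: "integral {0..1} (\<lambda>s. (leg q s)\<^sup>2) > 0"
proof -
  obtain p where p: "coeff p q = 1" "poly p = leg q" using leg_poly[of q] by blast
  have "integral {0..1} (\<lambda>s. (leg q s)\<^sup>2) \<noteq> 0"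
  proof
    assume "integral {0..1} (\<lambda>s. (leg q s)\<^sup>2) = 0"
    then have "\<And>s. s \<in> {0..1} \<Longrightarrow> (leg q s)\<^sup>2 = 0"
      using integral_eq_0_iff[of 0 1 "\<lambda>s. (leg q s)\<^sup>2"]
      by (simp add: continuous_on_leg continuous_on_power)
    then have "p = 0" by (intro poly_zero_on_interval) (auto simp: p)
    with p show False by simp
  qed
  moreover have "integral {0..1} (\<lambda>s. (leg q s)\<^sup>2) \<ge> 0"
    by (intro integral_nonneg integrable_continuous_interval continuous_intros) auto
  ultimately show ?thesis by simp
qed

text \<open>A root of \<^term>\<open>leg q\<close> at 0 would make it \<open>s\<close> times a polynomial \<open>M\<close> of lower degree,
  and then orthogonality to \<open>M\<close> forces \<open>\<integral> s M\<^sup>2 = 0\<close>.\<close>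
lemma leg_0_nonzero:
  assumes "q \<ge> 1"
  shows "leg q 0 \<noteq> 0"
proof
  assume z: "leg q 0 = 0"
  obtain p where p: "coeff p q = 1" "poly p = leg q" "\<And>i. i > q \<Longrightarrow> coeff p i = 0"
    using leg_poly[of q] by blast
  have "poly p 0 = 0" using z p by simp
  then obtain M where M: "p = pCons 0 M" by (cases p) auto
  have Mi: "coeff M i = 0" if "i \<ge> q" for i using p(3)[of "Suc i"] that M by simp
  have Ms: "poly M s = tpoly q (coeff M) s" for s
    using poly_eq_sum_lessThan[of q M s] Mi by (simp add: tpoly_def mult_ac)
  have LM: "leg q s = s * poly M s" for s using p(2) M by (metis add_0 poly_pCons)
  have "integral {0..1} (\<lambda>s. s * (poly M s)\<^sup>2) = 0"
    using leg_orth[of q q "1::real" "coeff M"] by (auto simp: Ms[symmetric] LM power2_eq_square mult_ac dest: integral_unique)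
  then have "s * (poly M s)\<^sup>2 = 0" if "s \<in> {0..1}" for s
    using integral_eq_0_iff[of 0 1 "\<lambda>s. s * (poly M s)\<^sup>2"] that
    by (simp add: continuous_on_poly continuous_on_power continuous_on_mult)
  then have "poly M s = 0" if "s \<in> {0<..<1}" for s
    using that by (metis atLeastAtMost_iff greaterThanLessThan_iff less_eq_real_def mult_eq_0_iff
        order_less_irrefl power_eq_0_iff)
  then have "M = 0" by (rule poly_zero_on_interval)
  then show False using p M assms by simp
qed

text \<open>Division with remainder by \<open>leg m\<close>. By orthogonality the remainder is the
  L^2-projection onto degree below \<open>m\<close>.\<close>

lemma tpoly_leg_decomp:
  "tpoly (Suc m) d s = leg m s *\<^sub>R d m + tpoly m (\<lambda>j. d j - lcoef m j *\<^sub>R d m) s"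
  by (simp add: tpoly_def leg_def scaleR_diff_right sum_subtractf scaleR_add_left scaleR_sum_left mult_ac)

text \<open>Equivalence of norms by induction on the degree. Splitting off the leading term with
  \<open>leg m\<close> is orthogonal, so squared norms add: the leading coefficient is bounded
  through the norm of \<open>leg m\<close>, the coefficients of the remainder by the induction
  hypothesis.\<close>

lemma tpoly_coeff_bound:
  "\<exists>K>0. \<forall>d::nat \<Rightarrow> 'b::euclidean_space. \<forall>j<m. (norm (d j))\<^sup>2 \<le> K * integral {0..1} (\<lambda>s. (norm (tpoly m d s))\<^sup>2)"
proof (induction m)
  case 0
  then show ?case by (intro exI[of _ 1]) auto
next
  case (Suc m)
  then obtain K where K: "K > 0" and Kb: "\<And>(d::nat \<Rightarrow> 'b) j. j < m \<Longrightarrow> (norm (d j))\<^sup>2 \<le> K * integral {0..1} (\<lambda>s. (norm (tpoly m d s))\<^sup>2)"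
    by blast
  define g where "g = integral {0..1} (\<lambda>s. (leg m s)\<^sup>2)"
  have g: "g > 0" unfolding g_def by (rule leg_square_pos)
  define l where "l = (\<Sum>j<m. (lcoef m j)\<^sup>2)"
  have l: "(lcoef m j)\<^sup>2 \<le> l" if "j < m" for j
    unfolding l_def using that by (intro member_le_sum) auto
  have l0: "l \<ge> 0" unfolding l_def by (intro sum_nonneg) auto
  show ?case
  proof (intro exI[of _ "2 * K + 2 * l / g + 1 / g"] conjI allI impI)
    show "0 < 2 * K + 2 * l / g + 1 / g" using K g l0 by (auto intro!: add_nonneg_pos)
    fix d :: "nat \<Rightarrow> 'b" and j assume j: "j < Suc m"
    define r where "r = (\<lambda>j. d j - lcoef m j *\<^sub>R d m)"
    define I where "I = integral {0..1} (\<lambda>s. (norm (tpoly (Suc m) d s))\<^sup>2)"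
    define Ir where "Ir = integral {0..1} (\<lambda>s. (norm (tpoly m r s))\<^sup>2)"
    have "((\<lambda>s. (norm (d m))\<^sup>2 * (leg m s)\<^sup>2 + 2 * (leg m s * (d m \<bullet> tpoly m r s)) + (norm (tpoly m r s))\<^sup>2)
       has_integral ((norm (d m))\<^sup>2 * g + 2 * 0 + Ir)) {0..1}"
      unfolding g_def Ir_def
      by (intro has_integral_add has_integral_mult_right leg_orth order_refl integrable_integral
          integrable_continuous_interval continuous_intros)
    moreover have "(norm (tpoly (Suc m) d s))\<^sup>2 =
        (norm (d m))\<^sup>2 * (leg m s)\<^sup>2 + 2 * (leg m s * (d m \<bullet> tpoly m r s)) + (norm (tpoly m r s))\<^sup>2" for s
      unfolding tpoly_leg_decomp r_def[symmetric] power2_norm_eq_inner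
      by (simp add: inner_add_left inner_add_right inner_commute power2_eq_square)
    ultimately have I: "I = (norm (d m))\<^sup>2 * g + Ir"
      unfolding I_def by (simp add: integral_unique)
    have Ir0: "Ir \<ge> 0" unfolding Ir_def
      by (intro integral_nonneg integrable_continuous_interval continuous_intros) auto
    have dm: "(norm (d m))\<^sup>2 \<le> I / g" using I Ir0 g by (simp add: field_simps)
    have I0: "I \<ge> 0" using I Ir0 g by simp
    have IrI: "Ir \<le> I" using I g by simp
    show "(norm (d j))\<^sup>2 \<le> (2 * K + 2 * l / g + 1 / g) * I"
    proof (cases "j = m")
      case True
      have "I / g \<le> (2 * K + 2 * l / g + 1 / g) * I" using K g l0 I0 by (simp add: field_simps)
      with dm True show ?thesis by simp
    next
      case False
      then have j: "j < m" using j by simp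
      have "d j = r j + lcoef m j *\<^sub>R d m" by (simp add: r_def)
      then have "norm (d j) \<le> norm (r j) + \<bar>lcoef m j\<bar> * norm (d m)"
        by (metis norm_scaleR norm_triangle_ineq)
      then have "(norm (d j))\<^sup>2 \<le> (norm (r j) + \<bar>lcoef m j\<bar> * norm (d m))\<^sup>2"
        by (intro power_mono) auto
      also have "\<dots> \<le> 2 * (norm (r j))\<^sup>2 + 2 * ((lcoef m j)\<^sup>2 * (norm (d m))\<^sup>2)"
        using sum_squares_bound[of "norm (r j)" "\<bar>lcoef m j\<bar> * norm (d m)"]
        unfolding power2_sum power_mult_distrib power2_abs by linarith
      also have "\<dots> \<le> 2 * (K * I) + 2 * (l * (I / g))"
      proof -
        have "(norm (r j))\<^sup>2 \<le> K * Ir" unfolding Ir_def by (rule Kb[OF j])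
        also have "\<dots> \<le> K * I" using K IrI by simp
        finally show ?thesis using dm l[OF j] l0 by (intro add_mono mult_left_mono mult_mono) auto
      qed
      also have "\<dots> \<le> (2 * K + 2 * l / g + 1 / g) * I"
        using g I0 by (simp add: field_simps)
      finally show ?thesis .
    qed
  qed
qed

section \<open>Test function on the reference interval\<close>

text \<open>Counting convention: \<open>tpoly m\<close> has \<open>m\<close> coefficients, hence
  degree below \<open>m\<close>. Thus \<open>u\<close> is a \<open>tpoly (Suc q)\<close>, its time
  derivative a \<open>tpoly q\<close>, and the second derivative a
  \<open>tpoly (q - 1)\<close>.\<close>

definition dcoef :: "(nat \<Rightarrow> 'b::real_vector) \<Rightarrow> nat \<Rightarrow> 'b" where
  "dcoef c j = real (Suc j) *\<^sub>R c (Suc j)"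

text \<open>For \<open>v = tpoly q d\<close> these are the coefficients of the \<open>L\<^sup>2(0,1)\<close>-projection of \<open>(1 - s) v\<close> onto
  degree below \<open>q\<close>: the term \<open>- s\<^sup>q d(q - 1)\<close> is traded for its remainder modulo \<open>leg q\<close>.\<close>
definition tcoef :: "nat \<Rightarrow> (nat \<Rightarrow> 'b::real_vector) \<Rightarrow> nat \<Rightarrow> 'b" where
  "tcoef q d j = d j - (if j = 0 then 0 else d (j - 1)) + lcoef q j *\<^sub>R d (q - 1)"

lemma tpoly_shift: "tpoly (Suc m) (\<lambda>j. if j = 0 then 0 else y (j - 1)) s = s *\<^sub>R tpoly m y s"
  unfolding tpoly_def by (subst sum.lessThan_Suc_shift) (simp add: scaleR_sum_right)

lemma tpoly_pad: "tpoly (Suc m) (\<lambda>j. if j < m then y j else 0) s = tpoly m y s"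
  by (simp add: tpoly_def)

lemma tpoly_add: "tpoly m (\<lambda>j. c j + d j) s = tpoly m c s + tpoly m d s"
  by (simp add: tpoly_def scaleR_add_right sum.distrib)

lemma tpoly_diff: "tpoly m (\<lambda>j. c j - d j) s = tpoly m c s - tpoly m d s"
  by (simp add: tpoly_def scaleR_diff_right sum_subtractf)

lemma tpoly_scaleR: "tpoly m (\<lambda>j. r *\<^sub>R c j) s = r *\<^sub>R tpoly m c s"
  by (simp add: tpoly_def scaleR_sum_right mult_ac)

lemma one_minus_tpoly:
  "(1 - s) *\<^sub>R tpoly m y s = tpoly (Suc m) (\<lambda>j. (if j < m then y j else 0) - (if j = 0 then 0 else y (j - 1))) s"
  unfolding tpoly_diff tpoly_pad tpoly_shift by (simp add: scaleR_diff_left)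

lemma tpoly_tcoef:
  assumes "q \<ge> 1"
  shows "tpoly q (tcoef q d) s = (1 - s) *\<^sub>R tpoly q d s + leg q s *\<^sub>R d (q - 1)"
proof -
  obtain m where q: "q = Suc m" using assms by (cases q) auto
  have "tpoly q (tcoef q d) s = tpoly q d s - s *\<^sub>R tpoly m d s + (\<Sum>i<q. lcoef q i * s ^ i) *\<^sub>R d m"
    unfolding tcoef_def[abs_def] tpoly_add tpoly_diff q tpoly_shift
    by (simp add: tpoly_def scaleR_sum_left mult_ac del: sum.lessThan_Suc)
  \<comment> \<open>The power of degree \<open>q\<close> produced by the factor \<open>s\<close> is
    what joins the lower coefficients \<open>lcoef q\<close> to form \<open>leg q\<close>.\<close>
  also have "s *\<^sub>R tpoly m d s = s *\<^sub>R tpoly q d s - s ^ q *\<^sub>R d m"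
    by (simp add: q tpoly_Suc scaleR_add_right)
  finally show ?thesis by (simp add: q leg_def algebra_simps)
qed

lemma tcoef_scaleR: "tcoef q (\<lambda>j. r *\<^sub>R d j) j = r *\<^sub>R tcoef q d j"
  by (simp add: tcoef_def algebra_simps)

lemma tpoly_has_vector_derivative:
  fixes c :: "nat \<Rightarrow> 'b::real_normed_vector"
  shows "(tpoly (Suc q) c has_vector_derivative tpoly q (dcoef c) s) (at s within S)"
proof -
  have "((\<lambda>s. \<Sum>j<Suc q. s ^ j *\<^sub>R c j) has_vector_derivative (\<Sum>j<Suc q. (real j * s ^ (j - 1)) *\<^sub>R c j)) (at s within S)"
    by (auto intro!: derivative_eq_intros has_vector_derivative_sum)
  also have "(\<Sum>j<Suc q. (real j * s ^ (j - 1)) *\<^sub>R c j) = tpoly q (dcoef c) s"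
    unfolding tpoly_def by (subst sum.lessThan_Suc_shift) (simp add: dcoef_def mult_ac)
  finally show ?thesis by (simp add: tpoly_def[abs_def])
qed

text \<open>The weight has slope -1 and vanishes at 1. Differentiating
  \<open>(1 - s) * (P s \<bullet> P s)\<close> therefore leaves the unweighted integral of the
  square and only the boundary value at 0.\<close>

lemma weighted_square_has_integral:
  fixes P :: "real \<Rightarrow> 'b::euclidean_space"
  assumes "\<And>s. s \<in> {0..1} \<Longrightarrow> (P has_vector_derivative P' s) (at s within {0..1})"
  shows "((\<lambda>s. (1 - s) * (P' s \<bullet> P s)) has_integral (1/2) * (integral {0..1} (\<lambda>s. (norm (P s))\<^sup>2) - (norm (P 0))\<^sup>2)) {0..1}"
proof -
  have cP: "continuous_on {0..1} P"
    using assms by (rule continuous_on_vector_derivative)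
  have "((\<lambda>s. 2 * ((1 - s) * (P' s \<bullet> P s)) - (norm (P s))\<^sup>2) has_integral
      ((1 - 1) * (P 1 \<bullet> P 1) - (1 - 0) * (P 0 \<bullet> P 0))) {0..1}"
  proof (rule fundamental_theorem_of_calculus)
    fix s :: real assume s: "s \<in> {0..1}"
    note [derivative_intros] = bounded_bilinear.has_vector_derivative[OF bounded_bilinear_inner]
    show "((\<lambda>s. (1 - s) * (P s \<bullet> P s)) has_vector_derivative
        2 * ((1 - s) * (P' s \<bullet> P s)) - (norm (P s))\<^sup>2) (at s within {0..1})"
      using assms[OF s]
      by (auto intro!: derivative_eq_intros simp: power2_norm_eq_inner inner_commute algebra_simps)
  qed simp
  moreover have "((\<lambda>s. (norm (P s))\<^sup>2) has_integral integral {0..1} (\<lambda>s. (norm (P s))\<^sup>2)) {0..1}"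
    by (intro integrable_integral integrable_continuous_interval continuous_intros cP)
  ultimately have "((\<lambda>s. 2 * ((1 - s) * (P' s \<bullet> P s)) - (norm (P s))\<^sup>2 + (norm (P s))\<^sup>2) has_integral
      ((1 - 1) * (P 1 \<bullet> P 1) - (1 - 0) * (P 0 \<bullet> P 0) + integral {0..1} (\<lambda>s. (norm (P s))\<^sup>2))) {0..1}"
    by (rule has_integral_add)
  from has_integral_mult_right[OF this, of "1/2"] show ?thesis
    by (simp add: power2_norm_eq_inner algebra_simps)
qed

text \<open>The \<open>leg q\<close> part of the test function is orthogonal to the derivative of
  \<open>tpoly q d\<close>, whose degree is too low to notice it. What remains is the weighted
  square identity.\<close>

lemma ref_derivative_test:
  fixes d :: "nat \<Rightarrow> 'b::euclidean_space"
  assumes "q \<ge> 1"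
  shows "((\<lambda>s. tpoly (q - 1) (dcoef d) s \<bullet> tpoly q (tcoef q d) s) has_integral
     (1/2) * (integral {0..1} (\<lambda>s. (norm (tpoly q d s))\<^sup>2) - (norm (tpoly q d 0))\<^sup>2)) {0..1}"
proof -
  have "((\<lambda>s. (1 - s) * (tpoly (q - 1) (dcoef d) s \<bullet> tpoly q d s) + leg q s * (d (q - 1) \<bullet> tpoly (q - 1) (dcoef d) s))
     has_integral ((1/2) * (integral {0..1} (\<lambda>s. (norm (tpoly q d s))\<^sup>2) - (norm (tpoly q d 0))\<^sup>2) + 0)) {0..1}"
    using tpoly_has_vector_derivative[of "q - 1" d] assms
    by (intro has_integral_add weighted_square_has_integral leg_orth) auto
  then show ?thesis
    by (simp add: tpoly_tcoef[OF assms] inner_add_right inner_commute)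
qed

text \<open>The test function has degree below \<open>q\<close>, so \<open>U\<close> may be replaced by its projection; after an
  integration by parts the same holds for the remaining factor.\<close>
lemma ref_value_test:
  fixes c :: "nat \<Rightarrow> 'b::euclidean_space"
  assumes q: "q \<ge> 1"
  defines "p \<equiv> \<lambda>j. c j - lcoef q j *\<^sub>R c q"
  shows "integral {0..1} (\<lambda>s. tpoly (Suc q) c s \<bullet> tpoly q (tcoef q (dcoef c)) s) =
     (1/2) * integral {0..1} (\<lambda>s. (norm (tpoly q p s))\<^sup>2) + (1/2) * (norm (tpoly q p 0))\<^sup>2 - tpoly q p 0 \<bullet> tpoly (Suc q) c 0"
proof -
  define P where "P = tpoly q p"
  define P' where "P' = tpoly (q - 1) (dcoef p)"
  define U where "U = tpoly (Suc q) c"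
  define U' where "U' = tpoly q (dcoef c)"
  define I where "I = integral {0..1} (\<lambda>s. (norm (P s))\<^sup>2)"
  have U: "U s = leg q s *\<^sub>R c q + P s" for s
    unfolding U_def P_def p_def by (rule tpoly_leg_decomp)
  have dP: "(P has_vector_derivative P' s) (at s within S)" for s S
    using tpoly_has_vector_derivative[of "q - 1" p] q by (simp add: P_def P'_def)
  have dU: "(U has_vector_derivative U' s) (at s within S)" for s S
    unfolding U_def U'_def by (rule tpoly_has_vector_derivative)
  have LP: "((\<lambda>s. leg q s * (e \<bullet> P s)) has_integral 0) {0..1}" for e
    unfolding P_def by (intro leg_orth) simp
  have LP': "((\<lambda>s. leg q s * (e \<bullet> ((1 - s) *\<^sub>R P' s))) has_integral 0) {0..1}" for e
    unfolding P'_def one_minus_tpoly using q by (intro leg_orth) simp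
  have sq: "((\<lambda>s. (norm (P s))\<^sup>2) has_integral I) {0..1}"
    unfolding I_def P_def by (intro integrable_integral integrable_continuous_interval continuous_intros)
  have "((\<lambda>s. - (P s \<bullet> U s) + (1 - s) * (P' s \<bullet> U s) + (1 - s) * (P s \<bullet> U' s)) has_integral
      ((1 - 1) * (P 1 \<bullet> U 1) - (1 - 0) * (P 0 \<bullet> U 0))) {0..1}"
  proof (rule fundamental_theorem_of_calculus)
    fix s :: real assume s: "s \<in> {0..1}"
    note [derivative_intros] = bounded_bilinear.has_vector_derivative[OF bounded_bilinear_inner]
    show "((\<lambda>s. (1 - s) * (P s \<bullet> U s)) has_vector_derivative
        - (P s \<bullet> U s) + (1 - s) * (P' s \<bullet> U s) + (1 - s) * (P s \<bullet> U' s)) (at s within {0..1})"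
      using dP[of s "{0..1}"] dU[of s "{0..1}"]
      by (auto intro!: derivative_eq_intros simp: algebra_simps)
  qed simp
  \<comment> \<open>Integrals of known value, with signs chosen so that adding them to the exact
    derivative above leaves \<open>U\<close> paired with the test function.\<close>
  moreover have "((\<lambda>s. (norm (P s))\<^sup>2 + leg q s * (c q \<bullet> P s)
       - ((1 - s) * (P' s \<bullet> P s) + leg q s * (c q \<bullet> ((1 - s) *\<^sub>R P' s)))
       + (leg q s * (c q \<bullet> tpoly q (tcoef q (dcoef c)) s) + leg q s * (dcoef c (q - 1) \<bullet> P s)))
      has_integral (I + 0 - ((1/2) * (integral {0..1} (\<lambda>s. (norm (P s))\<^sup>2) - (norm (P 0))\<^sup>2) + 0) + (0 + 0))) {0..1}"
    by (intro has_integral_add has_integral_diff sq LP LP' weighted_square_has_integral dP leg_orth order_refl)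
  ultimately have "((\<lambda>s. (- (P s \<bullet> U s) + (1 - s) * (P' s \<bullet> U s) + (1 - s) * (P s \<bullet> U' s)) +
       ((norm (P s))\<^sup>2 + leg q s * (c q \<bullet> P s)
       - ((1 - s) * (P' s \<bullet> P s) + leg q s * (c q \<bullet> ((1 - s) *\<^sub>R P' s)))
       + (leg q s * (c q \<bullet> tpoly q (tcoef q (dcoef c)) s) + leg q s * (dcoef c (q - 1) \<bullet> P s))))
      has_integral ((1 - 1) * (P 1 \<bullet> U 1) - (1 - 0) * (P 0 \<bullet> U 0) +
        (I + 0 - ((1/2) * (integral {0..1} (\<lambda>s. (norm (P s))\<^sup>2) - (norm (P 0))\<^sup>2) + 0) + (0 + 0)))) {0..1}"
    by (rule has_integral_add)
  moreover have "(- (P s \<bullet> U s) + (1 - s) * (P' s \<bullet> U s) + (1 - s) * (P s \<bullet> U' s)) +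
       ((norm (P s))\<^sup>2 + leg q s * (c q \<bullet> P s)
       - ((1 - s) * (P' s \<bullet> P s) + leg q s * (c q \<bullet> ((1 - s) *\<^sub>R P' s)))
       + (leg q s * (c q \<bullet> tpoly q (tcoef q (dcoef c)) s) + leg q s * (dcoef c (q - 1) \<bullet> P s)))
      = U s \<bullet> tpoly q (tcoef q (dcoef c)) s" for s
    unfolding U tpoly_tcoef[OF q] U'_def[symmetric]
    by (simp add: power2_norm_eq_inner inner_commute algebra_simps)
  ultimately show ?thesis
    unfolding P_def[symmetric] U_def[symmetric] I_def[symmetric]
    by (simp add: integral_unique algebra_simps)
qed

lemma norm_tpoly_le:
  fixes c :: "nat \<Rightarrow> 'b::real_normed_vector"
  assumes "\<And>j. j < m \<Longrightarrow> norm (c j) \<le> B" "s \<in> {0..1}"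
  shows "norm (tpoly m c s) \<le> real m * B"
proof -
  have "norm (tpoly m c s) \<le> (\<Sum>j<m. norm (s ^ j *\<^sub>R c j))" unfolding tpoly_def by (rule norm_sum)
  also have "\<dots> \<le> (\<Sum>j<m. B)"
  proof (rule sum_mono)
    fix j assume "j \<in> {..<m}"
    then have "norm (c j) \<le> B" using assms by simp
    moreover have "\<bar>s ^ j\<bar> \<le> 1" using assms(2) by (simp add: power_le_one power_abs)
    ultimately have "\<bar>s ^ j\<bar> * norm (c j) \<le> 1 * B" by (intro mult_mono) auto
    then show "norm (s ^ j *\<^sub>R c j) \<le> B" by simp
  qed
  finally show ?thesis by simp
qed

text \<open>Completing the square at 0, the boundary terms of \<open>ref_value_test\<close> are at
  worst minus half the squared initial value. Adding that value makes the bracket control both the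
  projection \<open>p\<close> and \<open>tpoly (Suc q) c 0\<close>. At 0 these two determine the
  leading coefficient, since \<open>leg q 0\<close> is nonzero, and with it all
  coefficients.\<close>

lemma ref_value_bound:
  assumes q: "q \<ge> 1"
  shows "\<exists>K>0. \<forall>c::nat \<Rightarrow> 'b::euclidean_space. \<forall>s\<in>{0..1}.
    (norm (tpoly (Suc q) c s))\<^sup>2 \<le> K * (integral {0..1} (\<lambda>s. tpoly (Suc q) c s \<bullet> tpoly q (tcoef q (dcoef c)) s)
       + (norm (tpoly (Suc q) c 0))\<^sup>2)"
proof -
  obtain K1 where K1: "K1 > 0" and K1b: "\<And>(d::nat \<Rightarrow> 'b) j. j < q \<Longrightarrow>
      (norm (d j))\<^sup>2 \<le> K1 * integral {0..1} (\<lambda>s. (norm (tpoly q d s))\<^sup>2)"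
    using tpoly_coeff_bound[of q] by blast
  define L0 where "L0 = \<bar>leg q 0\<bar>"
  have L0: "L0 > 0" using leg_0_nonzero[OF q] by (simp add: L0_def)
  define l where "l = (\<Sum>j<q. \<bar>lcoef q j\<bar>)"
  have l: "\<bar>lcoef q j\<bar> \<le> l" if "j < q" for j
    unfolding l_def using that by (intro member_le_sum) auto
  have l0: "l \<ge> 0" unfolding l_def by (intro sum_nonneg) auto
  \<comment> \<open>In units of \<open>sqrt Z\<close>: \<open>b1\<close> bounds the coefficients of
    the projection, \<open>b2\<close> the leading coefficient after division by
    \<open>leg q 0\<close>, and \<open>b\<close> all coefficients.\<close>
  define b1 where "b1 = sqrt (2 * K1)"
  define b2 where "b2 = (sqrt 2 + b1) / L0"
  define b where "b = b1 + b2 + l * b2"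
  have b1: "b1 > 0" using K1 by (simp add: b1_def)
  have b2: "b2 > 0" using L0 b1 by (simp add: b2_def add_pos_pos)
  have b: "b > 0" "b2 \<le> b" "b1 + l * b2 \<le> b"
    using b1 b2 l0 by (auto simp: b_def intro!: add_pos_nonneg)
  show ?thesis
  proof (intro exI[of _ "(real (Suc q) * b)\<^sup>2"] conjI allI ballI)
    show "0 < (real (Suc q) * b)\<^sup>2" using b by simp
    fix c :: "nat \<Rightarrow> 'b" and s :: real assume s: "s \<in> {0..1}"
    define p where "p = (\<lambda>j. c j - lcoef q j *\<^sub>R c q)"
    define Z where "Z = integral {0..1} (\<lambda>s. tpoly (Suc q) c s \<bullet> tpoly q (tcoef q (dcoef c)) s) + (norm (tpoly (Suc q) c 0))\<^sup>2"
    define I where "I = integral {0..1} (\<lambda>s. (norm (tpoly q p s))\<^sup>2)"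
    have I0: "I \<ge> 0" unfolding I_def
      by (intro integral_nonneg integrable_continuous_interval continuous_intros) auto
    have "(norm (tpoly q p 0 - tpoly (Suc q) c 0))\<^sup>2 \<ge> 0" by simp
    then have "(1/2) * (norm (tpoly q p 0))\<^sup>2 - tpoly q p 0 \<bullet> tpoly (Suc q) c 0 \<ge> - (1/2) * (norm (tpoly (Suc q) c 0))\<^sup>2"
      unfolding power2_norm_eq_inner by (simp add: inner_diff_left inner_diff_right inner_commute)
    then have Z: "Z \<ge> (1/2) * I + (1/2) * (norm (tpoly (Suc q) c 0))\<^sup>2"
      using ref_value_test[OF q, of c] unfolding Z_def p_def[symmetric] I_def[symmetric] by simp
    then have IZ: "I \<le> 2 * Z" "(norm (tpoly (Suc q) c 0))\<^sup>2 \<le> 2 * Z" "Z \<ge> 0"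
      using I0 Z zero_le_power2[of "norm (tpoly (Suc q) c 0)"] by linarith+
    have "norm (p j) \<le> b1 * sqrt Z" if "j < q" for j
    proof -
      have "(norm (p j))\<^sup>2 \<le> K1 * I" unfolding I_def by (rule K1b[OF that])
      also have "\<dots> \<le> K1 * (2 * Z)" using K1 IZ by simp
      finally show ?thesis using real_le_rsqrt[of "norm (p j)"] 
        by (simp add: b1_def real_sqrt_mult[symmetric] mult_ac)
    qed note pj = this
    have U0: "norm (tpoly (Suc q) c 0) \<le> sqrt 2 * sqrt Z"
      using real_le_rsqrt[OF IZ(2)] by (simp add: real_sqrt_mult)
    have "tpoly m y 0 = y 0" if "m \<ge> 1" for m and y :: "nat \<Rightarrow> 'b"
    proof -
      obtain m' where "m = Suc m'" using \<open>m \<ge> 1\<close> by (cases m) auto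
      then show ?thesis by (simp add: tpoly_def sum.lessThan_Suc_shift del: sum.lessThan_Suc)
    qed
    then have "leg q 0 *\<^sub>R c q = tpoly (Suc q) c 0 - p 0"
      using tpoly_leg_decomp[of q c 0] q by (simp add: p_def)
    then have "L0 * norm (c q) = norm (tpoly (Suc q) c 0 - p 0)"
      unfolding L0_def by (metis norm_scaleR)
    also have "\<dots> \<le> norm (tpoly (Suc q) c 0) + norm (p 0)" by (rule norm_triangle_ineq4)
    also have "\<dots> \<le> (sqrt 2 + b1) * sqrt Z" using U0 pj[of 0] q by (simp add: algebra_simps)
    finally have cq: "norm (c q) \<le> b2 * sqrt Z"
      using L0 by (simp add: b2_def field_simps)
    have "norm (c j) \<le> b * sqrt Z" if "j < Suc q" for j
    proof (cases "j = q")
      case True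
      then show ?thesis using cq mult_right_mono[OF b(2), of "sqrt Z"] IZ by simp
    next
      case False
      then have j: "j < q" using that by simp
      have "c j = p j + lcoef q j *\<^sub>R c q" by (simp add: p_def)
      then have "norm (c j) \<le> norm (p j) + \<bar>lcoef q j\<bar> * norm (c q)"
        by (metis norm_scaleR norm_triangle_ineq)
      also have "\<dots> \<le> b1 * sqrt Z + l * (b2 * sqrt Z)"
        using pj[OF j] cq l[OF j] l0 by (intro add_mono mult_mono) auto
      also have "\<dots> = (b1 + l * b2) * sqrt Z" by (simp add: algebra_simps)
      also have "\<dots> \<le> b * sqrt Z" using b(3) IZ by (intro mult_right_mono) auto
      finally show ?thesis .
    qed
    then have "norm (tpoly (Suc q) c s) \<le> real (Suc q) * (b * sqrt Z)"
      using s by (rule norm_tpoly_le)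
    then have "(norm (tpoly (Suc q) c s))\<^sup>2 \<le> (real (Suc q) * (b * sqrt Z))\<^sup>2"
      by (intro power_mono) auto
    also have "\<dots> = (real (Suc q) * b)\<^sup>2 * Z" using IZ by (simp add: power_mult_distrib)
    finally show "(norm (tpoly (Suc q) c s))\<^sup>2 \<le> (real (Suc q) * b)\<^sup>2 *
      (integral {0..1} (\<lambda>s. tpoly (Suc q) c s \<bullet> tpoly q (tcoef q (dcoef c)) s) + (norm (tpoly (Suc q) c 0))\<^sup>2)"
      by (simp add: Z_def)
  qed
qed

text \<open>All four functions depend linearly on the coefficients of \<open>d\<close>, which the
  integral controls by \<open>tpoly_coeff_bound\<close>. This is an inverse estimate in time
  only.\<close>

lemma ref_sup_bound:
  assumes q: "q \<ge> 1"
  shows "\<exists>K\<ge>1. \<forall>d::nat \<Rightarrow> 'b::euclidean_space. \<forall>s\<in>{0..1}.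
    (let I = integral {0..1} (\<lambda>s. (norm (tpoly q d s))\<^sup>2) in
      (norm (tpoly q d s))\<^sup>2 \<le> K * I \<and> (norm (tpoly (q - 1) (dcoef d) s))\<^sup>2 \<le> K * I \<and>
      (norm (tpoly q (tcoef q d) s))\<^sup>2 \<le> K * I \<and> (norm (tpoly (q - 1) (dcoef (tcoef q d)) s))\<^sup>2 \<le> K * I)"
proof -
  obtain K1 where K1: "K1 > 0" and K1b: "\<And>(d::nat \<Rightarrow> 'b) j. j < q \<Longrightarrow>
      (norm (d j))\<^sup>2 \<le> K1 * integral {0..1} (\<lambda>s. (norm (tpoly q d s))\<^sup>2)"
    using tpoly_coeff_bound[of q] by blast
  define l where "l = (\<Sum>j<q. \<bar>lcoef q j\<bar>)"
  have l: "\<bar>lcoef q j\<bar> \<le> l" if "j < q" for j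
    unfolding l_def using that by (intro member_le_sum) auto
  have l0: "l \<ge> 0" unfolding l_def by (intro sum_nonneg) auto
  \<comment> \<open>One factor \<open>real q\<close> counts coefficients, the other is the cost of a
    derivative; \<open>2 + l\<close> bounds the growth of coefficients from \<open>d\<close> to
    \<open>tcoef q d\<close>.\<close>
  define b where "b = real q * (real q * (2 + l))"
  show ?thesis
  proof (intro exI[of _ "b\<^sup>2 * K1 + 1"] conjI allI ballI)
    show "1 \<le> b\<^sup>2 * K1 + 1" using K1 by simp
    fix d :: "nat \<Rightarrow> 'b" and s :: real assume s: "s \<in> {0..1}"
    define I where "I = integral {0..1} (\<lambda>s. (norm (tpoly q d s))\<^sup>2)"
    have I0: "I \<ge> 0" unfolding I_def
      by (intro integral_nonneg integrable_continuous_interval continuous_intros) auto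
    define B where "B = sqrt (K1 * I)"
    have B0: "B \<ge> 0" using K1 I0 by (simp add: B_def)
    have dj: "norm (d j) \<le> B" if "j < q" for j
      unfolding B_def I_def by (intro real_le_rsqrt K1b that)
    have wj: "norm (tcoef q d j) \<le> (2 + l) * B" if "j < q" for j
    proof -
      have "norm (tcoef q d j) \<le> norm (d j) + norm (if j = 0 then 0 else d (j - 1)) + norm (lcoef q j *\<^sub>R d (q - 1))"
        unfolding tcoef_def by (intro order_trans[OF norm_triangle_ineq] add_mono norm_triangle_ineq4 order_refl)
      also have "\<dots> \<le> B + B + l * B"
        using dj[of j] dj[of "j - 1"] that B0 l[of j] l0 dj[of "q - 1"] q
        by (intro add_mono) (auto intro!: mult_mono)
      finally show ?thesis by (simp add: algebra_simps)
    qed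
    have dc: "norm (dcoef y j) \<le> real q * B'" if "\<And>j. j < q \<Longrightarrow> norm (y j) \<le> B'" "j < q - 1" for y :: "nat \<Rightarrow> 'b" and B' j
    proof -
      have "norm (dcoef y j) = real (Suc j) * norm (y (Suc j))" by (simp add: dcoef_def)
      also have "\<dots> \<le> real q * B'" using that by (intro mult_mono) auto
      finally show ?thesis .
    qed
    have q1: "real q \<ge> 1" using q by simp
    have B1: "B \<le> real q * ((2 + l) * B)"
    proof -
      have "1 * 1 \<le> real q * (2 + l)" using q1 l0 by (intro mult_mono) auto
      then show ?thesis using B0 mult_right_mono[of 1 "real q * (2 + l)" B] by (simp add: mult_ac)
    qed
    have lB: "0 \<le> (2 + l) * B" using l0 B0 by simp
    have B2: "(2 + l) * B \<le> real q * ((2 + l) * B)" 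
      using mult_right_mono[OF q1 lB] by simp
    have B3: "real q * B \<le> real q * ((2 + l) * B)"
      using l0 B0 by (intro mult_left_mono) (auto simp: algebra_simps)
    have fin: "(norm x)\<^sup>2 \<le> (b\<^sup>2 * K1 + 1) * I"
      if "norm x \<le> real m * (real q * ((2 + l) * B))" "m \<le> q" for x :: 'b and m
    proof -
      have "real m * (real q * ((2 + l) * B)) \<le> real q * (real q * ((2 + l) * B))"
        using that B0 l0 by (intro mult_right_mono) auto
      then have "norm x \<le> b * B" using that by (simp add: b_def mult_ac)
      then have "(norm x)\<^sup>2 \<le> (b * B)\<^sup>2" by (intro power_mono) auto
      also have "\<dots> = b\<^sup>2 * K1 * I" using K1 I0 by (simp add: B_def power_mult_distrib)
      also have "\<dots> \<le> (b\<^sup>2 * K1 + 1) * I" using I0 by (simp add: algebra_simps)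
      finally show ?thesis .
    qed
    show "let I = integral {0..1} (\<lambda>s. (norm (tpoly q d s))\<^sup>2) in
      (norm (tpoly q d s))\<^sup>2 \<le> (b\<^sup>2 * K1 + 1) * I \<and> (norm (tpoly (q - 1) (dcoef d) s))\<^sup>2 \<le> (b\<^sup>2 * K1 + 1) * I \<and>
      (norm (tpoly q (tcoef q d) s))\<^sup>2 \<le> (b\<^sup>2 * K1 + 1) * I \<and>
      (norm (tpoly (q - 1) (dcoef (tcoef q d)) s))\<^sup>2 \<le> (b\<^sup>2 * K1 + 1) * I"
      unfolding Let_def I_def[symmetric]
    proof (intro conjI)
      show "(norm (tpoly q d s))\<^sup>2 \<le> (b\<^sup>2 * K1 + 1) * I"
        by (rule fin[OF norm_tpoly_le[OF _ s]]) (auto intro: order_trans[OF dj B1])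
      show "(norm (tpoly (q - 1) (dcoef d) s))\<^sup>2 \<le> (b\<^sup>2 * K1 + 1) * I"
        by (rule fin[OF norm_tpoly_le[OF _ s]]) (auto intro!: order_trans[OF dc B3] dj)
      show "(norm (tpoly q (tcoef q d) s))\<^sup>2 \<le> (b\<^sup>2 * K1 + 1) * I"
        by (rule fin[OF norm_tpoly_le[OF _ s]]) (auto intro: order_trans[OF wj B2])
      show "(norm (tpoly (q - 1) (dcoef (tcoef q d)) s))\<^sup>2 \<le> (b\<^sup>2 * K1 + 1) * I"
        by (rule fin[OF norm_tpoly_le[OF _ s]]) (auto intro!: dc wj)
    qed
  qed
qed

section \<open>Estimates on one time interval\<close>

definition spoly :: "real \<Rightarrow> real \<Rightarrow> nat \<Rightarrow> (nat \<Rightarrow> 'b::real_vector) \<Rightarrow> real \<Rightarrow> 'b" where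
  "spoly a b q c t = tpoly q c ((t - a) / (b - a))"

definition sdcoef :: "real \<Rightarrow> real \<Rightarrow> (nat \<Rightarrow> 'b::real_vector) \<Rightarrow> nat \<Rightarrow> 'b" where
  "sdcoef a b c j = (1 / (b - a)) *\<^sub>R dcoef c j"

definition meansq :: "real \<Rightarrow> real \<Rightarrow> (real \<Rightarrow> 'b::real_normed_vector) \<Rightarrow> real" where
  "meansq a b v = (1 / (b - a)) * integral {a..b} (\<lambda>t. (norm (v t))\<^sup>2)"

lemma continuous_on_spoly [continuous_intros]:
  fixes c :: "nat \<Rightarrow> 'b::real_normed_vector"
  shows "continuous_on S g \<Longrightarrow> continuous_on S (\<lambda>s. spoly a b q c (g s))"
  unfolding spoly_def by (cases "a = b") (auto intro!: continuous_intros)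

lemma spoly_has_vector_derivative:
  fixes c :: "nat \<Rightarrow> 'b::real_normed_vector"
  assumes "a < b"
  shows "(spoly a b (Suc q) c has_vector_derivative spoly a b q (sdcoef a b c) t) (at t within S)"
proof -
  have "((\<lambda>t. (t - a) / (b - a)) has_vector_derivative 1 / (b - a)) (at t within S)"
    using assms by (auto intro!: derivative_eq_intros simp: has_real_derivative_iff_has_vector_derivative[symmetric])
  from vector_diff_chain_within[OF this tpoly_has_vector_derivative]
  show ?thesis
    by (simp add: spoly_def[abs_def] sdcoef_def[abs_def] tpoly_scaleR o_def)
qed

lemma integral_affine_unit:
  fixes F :: "real \<Rightarrow> real"
  assumes "a < b" "continuous_on {0..1} F"
  shows "integral {a..b} (\<lambda>t. F ((t - a) / (b - a))) = (b - a) * integral {0..1} F"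
proof -
  have "(F has_integral integral {0..1} F) (cbox 0 1)"
    using assms(2) by (simp add: integrable_continuous_interval integrable_integral)
  from has_integral_affinity'[OF this, of "1 / (b - a)" "- a / (b - a)"] assms(1)
  have "((\<lambda>t. F ((1 / (b - a)) *\<^sub>R t + - a / (b - a))) has_integral
      integral {0..1} F /\<^sub>R (1 / (b - a)) ^ DIM(real))
      (cbox ((0 - (- a / (b - a))) /\<^sub>R (1 / (b - a))) ((1 - (- a / (b - a))) /\<^sub>R (1 / (b - a))))"
    by simp
  moreover have "(0 - (- a / (b - a))) /\<^sub>R (1 / (b - a)) = a" "(1 - (- a / (b - a))) /\<^sub>R (1 / (b - a)) = b"
    using assms(1) by (simp_all add: field_simps)
  moreover have "(1 / (b - a)) *\<^sub>R t + - a / (b - a) = (t - a) / (b - a)" for t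
    by (simp add: diff_divide_distrib)
  ultimately have "((\<lambda>t. F ((t - a) / (b - a))) has_integral integral {0..1} F /\<^sub>R (1 / (b - a)) ^ DIM(real)) {a..b}"
    by simp
  then show ?thesis using assms(1) by (simp add: integral_unique)
qed

lemma meansq_spoly:
  fixes d :: "nat \<Rightarrow> 'b::euclidean_space"
  assumes "a < b"
  shows "meansq a b (spoly a b q d) = integral {0..1} (\<lambda>s. (norm (tpoly q d s))\<^sup>2)"
  using assms unfolding meansq_def spoly_def
  by (subst integral_affine_unit[of a b "\<lambda>s. (norm (tpoly q d s))\<^sup>2"]) (auto intro!: continuous_intros)

text \<open>The derivative contributes 1/(b - a) and the change of variables \<open>b - a\<close>.
  The identity is thus scale-free and produces the mean \<open>meansq\<close> instead of the
  integral.\<close>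

lemma slab_derivative_test:
  fixes d :: "nat \<Rightarrow> 'b::euclidean_space"
  assumes "q \<ge> 1" "a < b"
  shows "integral {a..b} (\<lambda>t. spoly a b (q - 1) (sdcoef a b d) t \<bullet> spoly a b q (tcoef q d) t) =
     (1/2) * (meansq a b (spoly a b q d) - (norm (spoly a b q d a))\<^sup>2)"
proof -
  have "integral {a..b} (\<lambda>t. spoly a b (q - 1) (sdcoef a b d) t \<bullet> spoly a b q (tcoef q d) t) =
     integral {a..b} (\<lambda>t. (\<lambda>s. (1 / (b - a)) * (tpoly (q - 1) (dcoef d) s \<bullet> tpoly q (tcoef q d) s)) ((t - a) / (b - a)))"
    by (simp add: spoly_def sdcoef_def[abs_def] tpoly_scaleR)
  also have "\<dots> = integral {0..1} (\<lambda>s. tpoly (q - 1) (dcoef d) s \<bullet> tpoly q (tcoef q d) s)"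
    using assms(2) by (subst integral_affine_unit) (auto intro!: continuous_intros)
  finally show ?thesis
    using ref_derivative_test[OF assms(1), of d] assms(2)
    by (simp add: integral_unique meansq_spoly spoly_def)
qed

lemma slab_value_bound:
  assumes "q \<ge> 1"
  shows "\<exists>K>0. \<forall>a b t. \<forall>c::nat \<Rightarrow> 'b::euclidean_space. a < b \<longrightarrow> t \<in> {a..b} \<longrightarrow>
    (norm (spoly a b (Suc q) c t))\<^sup>2 \<le> K * (integral {a..b} (\<lambda>t. spoly a b (Suc q) c t \<bullet> spoly a b q (tcoef q (sdcoef a b c)) t)
       + (norm (spoly a b (Suc q) c a))\<^sup>2)"
proof -
  obtain K where K: "K > 0" and Kb: "\<And>(c::nat \<Rightarrow> 'b) s. s \<in> {0..1} \<Longrightarrow>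
    (norm (tpoly (Suc q) c s))\<^sup>2 \<le> K * (integral {0..1} (\<lambda>s. tpoly (Suc q) c s \<bullet> tpoly q (tcoef q (dcoef c)) s)
       + (norm (tpoly (Suc q) c 0))\<^sup>2)"
    using ref_value_bound[OF assms, where 'b='b] by blast
  show ?thesis
  proof (intro exI[of _ K] conjI K allI impI)
    fix a b t :: real and c :: "nat \<Rightarrow> 'b" assume ab: "a < b" "t \<in> {a..b}"
    have "integral {a..b} (\<lambda>t. spoly a b (Suc q) c t \<bullet> spoly a b q (tcoef q (sdcoef a b c)) t) =
       integral {a..b} (\<lambda>t. (\<lambda>s. (1 / (b - a)) * (tpoly (Suc q) c s \<bullet> tpoly q (tcoef q (dcoef c)) s)) ((t - a) / (b - a)))"
    proof -
      have "tcoef q (sdcoef a b c) = (\<lambda>j. (1 / (b - a)) *\<^sub>R tcoef q (dcoef c) j)"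
        unfolding sdcoef_def[abs_def] by (rule ext) (rule tcoef_scaleR)
      then show ?thesis by (simp add: spoly_def tpoly_scaleR)
    qed
    also have "\<dots> = integral {0..1} (\<lambda>s. tpoly (Suc q) c s \<bullet> tpoly q (tcoef q (dcoef c)) s)"
      using ab by (subst integral_affine_unit) (auto intro!: continuous_intros)
    finally show "(norm (spoly a b (Suc q) c t))\<^sup>2 \<le> K * (integral {a..b} (\<lambda>t. spoly a b (Suc q) c t \<bullet> spoly a b q (tcoef q (sdcoef a b c)) t)
       + (norm (spoly a b (Suc q) c a))\<^sup>2)"
      using Kb[of "(t - a) / (b - a)" c] ab by (simp add: spoly_def)
  qed
qed

lemma slab_sup_bound:
  assumes q: "q \<ge> 1"
  shows "\<exists>K\<ge>1. \<forall>a b t. \<forall>d::nat \<Rightarrow> 'b::euclidean_space. a < b \<longrightarrow> t \<in> {a..b} \<longrightarrow>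
      (norm (spoly a b q d t))\<^sup>2 \<le> K * meansq a b (spoly a b q d) \<and>
      (norm (spoly a b (q - 1) (sdcoef a b d) t))\<^sup>2 \<le> K * meansq a b (spoly a b q d) / (b - a)\<^sup>2 \<and>
      (norm (spoly a b q (tcoef q d) t))\<^sup>2 \<le> K * meansq a b (spoly a b q d) \<and>
      (norm (spoly a b (q - 1) (sdcoef a b (tcoef q d)) t))\<^sup>2 \<le> K * meansq a b (spoly a b q d) / (b - a)\<^sup>2"
proof -
  obtain K where K: "K \<ge> 1" and Kb: "\<And>(d::nat \<Rightarrow> 'b) s. s \<in> {0..1} \<Longrightarrow>
    (let I = integral {0..1} (\<lambda>s. (norm (tpoly q d s))\<^sup>2) in
      (norm (tpoly q d s))\<^sup>2 \<le> K * I \<and> (norm (tpoly (q - 1) (dcoef d) s))\<^sup>2 \<le> K * I \<and>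
      (norm (tpoly q (tcoef q d) s))\<^sup>2 \<le> K * I \<and> (norm (tpoly (q - 1) (dcoef (tcoef q d)) s))\<^sup>2 \<le> K * I)"
    using ref_sup_bound[OF q, where 'b='b] by blast
  show ?thesis
  proof (intro exI[of _ K] conjI K allI impI)
    fix a b t :: real and d :: "nat \<Rightarrow> 'b" assume ab: "a < b" "t \<in> {a..b}"
    define s where "s = (t - a) / (b - a)"
    have s: "s \<in> {0..1}" using ab by (simp add: s_def)
    have r: "(norm ((1 / (b - a)) *\<^sub>R x))\<^sup>2 = (norm x)\<^sup>2 / (b - a)\<^sup>2" for x :: 'b
      using ab by (simp add: power_divide)
    note B = Kb[OF s, of d, unfolded Let_def meansq_spoly[OF ab(1), symmetric]]
    show "(norm (spoly a b q d t))\<^sup>2 \<le> K * meansq a b (spoly a b q d)"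
      "(norm (spoly a b q (tcoef q d) t))\<^sup>2 \<le> K * meansq a b (spoly a b q d)"
      using B by (auto simp: spoly_def s_def)
    have e: "spoly a b m (sdcoef a b y) t = (1 / (b - a)) *\<^sub>R tpoly m (dcoef y) s" for m and y :: "nat \<Rightarrow> 'b"
      unfolding spoly_def sdcoef_def[abs_def] tpoly_scaleR s_def ..
    show "(norm (spoly a b (q - 1) (sdcoef a b d) t))\<^sup>2 \<le> K * meansq a b (spoly a b q d) / (b - a)\<^sup>2"
      "(norm (spoly a b (q - 1) (sdcoef a b (tcoef q d)) t))\<^sup>2 \<le> K * meansq a b (spoly a b q d) / (b - a)\<^sup>2"
      using B unfolding e r by (auto intro!: divide_right_mono)
  qed
qed

section \<open>Coefficients varying in time\<close>

lemma abs_mult_le_of_squares: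
  fixes x y :: real
  assumes "x\<^sup>2 \<le> A * B" "y\<^sup>2 \<le> B / A" "A > 0"
  shows "\<bar>x * y\<bar> \<le> B"
proof -
  have "B / A \<ge> 0" using assms(2) zero_le_power2 order_trans by blast
  then have B: "B \<ge> 0" using assms(3) by (simp add: zero_le_divide_iff)
  have "(x * y)\<^sup>2 \<le> (A * B) * (B / A)"
    unfolding power_mult_distrib using assms B by (intro mult_mono) auto
  also have "\<dots> = B\<^sup>2" using assms by (simp add: power2_eq_square)
  finally show ?thesis using B by (simp add: abs_le_square_iff[symmetric])
qed

text \<open>Two errors of equal size. One is the term with \<open>\<rho>'\<close>. The other is the
  deviation of \<open>\<rho>\<close> from its value at \<open>a\<close>, at most the integral of
  \<open>R\<close>; it multiplies \<open>v'\<close>, whose bound has the factor 1/(b - a), and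
  integration over the slab removes that factor.\<close>

lemma variable_coefficient_test:
  fixes \<rho> \<rho>' R v v' w :: "real \<Rightarrow> real"
  assumes ab: "a < b"
    and d: "\<And>t. t \<in> {a..b} \<Longrightarrow> (\<rho> has_vector_derivative \<rho>' t) (at t within {a..b})"
    and cont: "continuous_on {a..b} \<rho>'" "continuous_on {a..b} R" "continuous_on {a..b} v"
      "continuous_on {a..b} v'" "continuous_on {a..b} w"
    and R: "\<And>t. t \<in> {a..b} \<Longrightarrow> \<bar>\<rho>' t\<bar> \<le> R t"
    and v: "\<And>t. t \<in> {a..b} \<Longrightarrow> (v t)\<^sup>2 \<le> B"
    and w: "\<And>t. t \<in> {a..b} \<Longrightarrow> (w t)\<^sup>2 \<le> B"
    and v': "\<And>t. t \<in> {a..b} \<Longrightarrow> (v' t)\<^sup>2 \<le> B / (b - a)\<^sup>2"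
  shows "\<bar>integral {a..b} (\<lambda>t. (\<rho>' t * v t + \<rho> t * v' t) * w t) - \<rho> a * integral {a..b} (\<lambda>t. v' t * w t)\<bar>
    \<le> 2 * B * integral {a..b} R"
proof -
  have c\<rho>: "continuous_on {a..b} \<rho>" using d by (rule continuous_on_vector_derivative)
  have R0: "R t \<ge> 0" if "t \<in> {a..b}" for t using R[OF that] by linarith
  have iR: "R integrable_on {a..b}" by (intro integrable_continuous_interval cont)
  define I where "I = integral {a..b} R"
  have B0: "B \<ge> 0" using order_trans[OF zero_le_power2 v[of a]] ab by simp
  have dev: "\<bar>\<rho> t - \<rho> a\<bar> \<le> I" if t: "t \<in> {a..b}" for t
  proof -
    have "(\<rho>' has_integral (\<rho> t - \<rho> a)) {a..t}"
      using t d by (intro fundamental_theorem_of_calculus has_vector_derivative_within_subset[OF d]) auto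
    then have "\<bar>\<rho> t - \<rho> a\<bar> = norm (integral {a..t} \<rho>')" by (simp add: integral_unique)
    also have "\<dots> \<le> integral {a..t} R"
      using t by (intro integral_norm_bound_integral integrable_continuous_interval
          continuous_on_subset[OF cont(1)] continuous_on_subset[OF cont(2)]) (auto intro: R)
    also have "\<dots> \<le> I" unfolding I_def
      using t by (intro integral_subset_le iR integrable_on_subinterval[OF iR]) (auto intro: R0)
    finally show ?thesis .
  qed
  have I0: "I \<ge> 0" using dev[of a] ab by simp
  have "integral {a..b} (\<lambda>t. (\<rho>' t * v t + \<rho> t * v' t) * w t) - \<rho> a * integral {a..b} (\<lambda>t. v' t * w t)
     = integral {a..b} (\<lambda>t. \<rho>' t * (v t * w t) + (\<rho> t - \<rho> a) * (v' t * w t))"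
    unfolding integral_mult_right[symmetric]
    by (subst integral_diff[symmetric]) (auto intro!: integrable_continuous_interval continuous_intros cont c\<rho>
        arg_cong[where f="integral {a..b}"] simp: algebra_simps)
  also have "norm \<dots> \<le> integral {a..b} (\<lambda>t. B * R t + I * B / (b - a))"
  proof (rule integral_norm_bound_integral)
    fix t assume t: "t \<in> {a..b}"
    have "\<bar>v t * w t\<bar> \<le> B"
      using abs_mult_le_of_squares[of "v t" 1 B "w t"] v[OF t] w[OF t] by simp
    then have "\<bar>\<rho>' t\<bar> * \<bar>v t * w t\<bar> \<le> R t * B" using R[OF t] by (intro mult_mono) auto
    moreover have "\<bar>w t * v' t\<bar> \<le> B / (b - a)"
      using abs_mult_le_of_squares[of "w t" "b - a" "B / (b - a)" "v' t"] w[OF t] v'[OF t] ab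
      by (simp add: power2_eq_square)
    then have "\<bar>\<rho> t - \<rho> a\<bar> * \<bar>w t * v' t\<bar> \<le> I * (B / (b - a))" using dev[OF t] I0 by (intro mult_mono) auto
    ultimately show "norm (\<rho>' t * (v t * w t) + (\<rho> t - \<rho> a) * (v' t * w t)) \<le> B * R t + I * B / (b - a)"
      using abs_triangle_ineq[of "\<rho>' t * (v t * w t)" "(\<rho> t - \<rho> a) * (v' t * w t)"]
      by (simp add: abs_mult mult_ac)
  qed (intro integrable_continuous_interval continuous_intros cont c\<rho>)+
  also have "\<dots> = 2 * B * I"
    using ab iR by (subst integral_add) (auto simp: I_def mult_ac intro!: integrable_continuous_interval continuous_intros cont)
  finally show ?thesis by (simp add: I_def)
qed

text \<open>The integrand is the derivative of \<open>\<rho> t * (v t)^2 / 2\<close> plus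
  \<open>\<rho>' t * (v t)^2 / 2\<close>; only the last term is an error.\<close>

lemma variable_coefficient_energy:
  fixes \<rho> \<rho>' R v v' :: "real \<Rightarrow> real"
  assumes ab: "a < b"
    and d: "\<And>t. t \<in> {a..b} \<Longrightarrow> (\<rho> has_vector_derivative \<rho>' t) (at t within {a..b})"
    and dv: "\<And>t. t \<in> {a..b} \<Longrightarrow> (v has_vector_derivative v' t) (at t within {a..b})"
    and cont: "continuous_on {a..b} \<rho>'" "continuous_on {a..b} R"
    and R: "\<And>t. t \<in> {a..b} \<Longrightarrow> \<bar>\<rho>' t\<bar> \<le> R t"
    and v: "\<And>t. t \<in> {a..b} \<Longrightarrow> (v t)\<^sup>2 \<le> B"
  shows "\<bar>integral {a..b} (\<lambda>t. (\<rho>' t * v t + \<rho> t * v' t) * v t) - (1/2) * (\<rho> b * (v b)\<^sup>2 - \<rho> a * (v a)\<^sup>2)\<bar>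
    \<le> B * integral {a..b} R"
proof -
  have cv: "continuous_on {a..b} v" using dv by (rule continuous_on_vector_derivative)
  have iR: "R integrable_on {a..b}" by (intro integrable_continuous_interval cont)
  have "((\<lambda>t. \<rho>' t * (v t)\<^sup>2 + \<rho> t * (2 * v t * v' t)) has_integral (\<rho> b * (v b)\<^sup>2 - \<rho> a * (v a)\<^sup>2)) {a..b}"
  proof (rule fundamental_theorem_of_calculus)
    show "((\<lambda>t. \<rho> t * (v t)\<^sup>2) has_vector_derivative \<rho>' t * (v t)\<^sup>2 + \<rho> t * (2 * v t * v' t)) (at t within {a..b})"
      if "t \<in> {a..b}" for t
      using d[OF that] dv[OF that] unfolding has_real_derivative_iff_has_vector_derivative[symmetric]
      by (auto intro!: derivative_eq_intros simp: algebra_simps)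
  qed (use ab in simp)
  from has_integral_mult_right[OF this, of "1/2"]
  have h1: "((\<lambda>t. (1/2) * (\<rho>' t * (v t)\<^sup>2 + \<rho> t * (2 * v t * v' t))) has_integral (1/2) * (\<rho> b * (v b)\<^sup>2 - \<rho> a * (v a)\<^sup>2)) {a..b}" .
  have h2: "((\<lambda>t. (1/2) * (\<rho>' t * (v t)\<^sup>2)) has_integral integral {a..b} (\<lambda>t. (1/2) * (\<rho>' t * (v t)\<^sup>2))) {a..b}"
    by (intro integrable_integral integrable_continuous_interval continuous_intros cont cv)
  have "integral {a..b} (\<lambda>t. (\<rho>' t * v t + \<rho> t * v' t) * v t) =
     (1/2) * (\<rho> b * (v b)\<^sup>2 - \<rho> a * (v a)\<^sup>2) + integral {a..b} (\<lambda>t. (1/2) * (\<rho>' t * (v t)\<^sup>2))"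
    using has_integral_add[OF h1 h2]
    by (intro integral_unique) (simp add: algebra_simps power2_eq_square)
  moreover have "norm (integral {a..b} (\<lambda>t. (1/2) * (\<rho>' t * (v t)\<^sup>2))) \<le> integral {a..b} (\<lambda>t. B * R t)"
  proof (rule integral_norm_bound_integral)
    fix t assume t: "t \<in> {a..b}"
    have "\<bar>\<rho>' t\<bar> * (v t)\<^sup>2 \<le> R t * B" using R[OF t] v[OF t] by (intro mult_mono) auto
    then have "\<bar>\<rho>' t\<bar> * (v t)\<^sup>2 \<le> B * R t" by (simp only: mult.commute)
    moreover have "\<bar>\<rho>' t\<bar> * (v t)\<^sup>2 \<ge> 0" by simp
    ultimately have "(1/2) * (\<bar>\<rho>' t\<bar> * (v t)\<^sup>2) \<le> B * R t"
      by linarith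
    then show "norm ((1/2) * (\<rho>' t * (v t)\<^sup>2)) \<le> B * R t"
      by (simp add: abs_mult)
  qed (intro integrable_continuous_interval continuous_intros cont cv)+
  ultimately show ?thesis by simp
qed

section \<open>Lebesgue integration over space-time cylinders\<close>

text \<open>Rests on the completeness of Lebesgue measure. It allows integrands to be changed on
  null sets below without separate measurability arguments.\<close>

lemma measurable_lebesgue_AE:
  fixes f g :: "'c::euclidean_space \<Rightarrow> 'b::topological_space"
  assumes f: "f \<in> borel_measurable lebesgue" and eq: "AE x in lebesgue. f x = g x"
  shows "g \<in> borel_measurable lebesgue"
proof (rule measurableI)
  fix A :: "'b set" assume "A \<in> sets borel"
  then have "f -` A \<inter> space lebesgue \<in> sets lebesgue" by (rule measurable_sets[OF f])
  moreover have "AE x in lebesgue. x \<in> f -` A \<inter> space lebesgue \<longleftrightarrow> x \<in> g -` A \<inter> space lebesgue"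
    using eq by eventually_elim simp
  ultimately show "g -` A \<inter> space lebesgue \<in> sets lebesgue"
    using completion.in_sets_AE[of "f -` A \<inter> space lebesgue" "g -` A \<inter> space lebesgue" lborel]
    by (metis inf_le2)
qed simp

lemma integrable_lebesgue_AE:
  fixes f g :: "'c::euclidean_space \<Rightarrow> real"
  assumes f: "integrable lebesgue f" and eq: "AE x in lebesgue. f x = g x"
  shows "integrable lebesgue g"
  using f eq measurable_lebesgue_AE[OF borel_measurable_integrable[OF f] eq]
  by (subst integrable_cong_AE[where g=f]) (auto elim: eventually_mono)

text \<open>Either both functions are integrable or neither is, and in the second case both
  integrals are 0 by convention.\<close>

lemma integral_lebesgue_AE:
  fixes f g :: "'c::euclidean_space \<Rightarrow> real"
  assumes eq: "AE x in lebesgue. f x = g x"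
  shows "integral\<^sup>L lebesgue f = integral\<^sup>L lebesgue g"
proof (cases "integrable lebesgue f")
  case True
  then show ?thesis
    using eq borel_measurable_integrable[OF integrable_lebesgue_AE[OF True eq]]
    by (intro integral_cong_AE) auto
next
  case False
  have "AE x in lebesgue. g x = f x" using eq by eventually_elim simp
  then have "\<not> integrable lebesgue g" using False integrable_lebesgue_AE by blast
  then show ?thesis using False by (simp add: not_integrable_integral_eq)
qed

lemma set_integral_lebesgue_null_diff:
  fixes f :: "'c::euclidean_space \<Rightarrow> real"
  assumes "A \<subseteq> B" "B - A \<in> null_sets lebesgue"
  shows "(LINT x:B|lebesgue. f x) = (LINT x:A|lebesgue. f x)"
  unfolding set_lebesgue_integral_def
proof (rule integral_lebesgue_AE)
  from AE_not_in[OF assms(2)] show "AE x in lebesgue. indicator B x *\<^sub>R f x = indicator A x *\<^sub>R f x"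
    using assms(1) by (auto simp: indicator_def elim!: eventually_mono)
qed

lemma sets_Times_lebesgue:
  fixes A :: "'c::euclidean_space set" and I :: "real set"
  assumes "A \<in> sets lborel" "I \<in> sets lborel"
  shows "A \<times> I \<in> sets lebesgue"
proof -
  have "A \<times> I \<in> sets (lborel \<Otimes>\<^sub>M lborel)" using assms by (rule pair_measureI)
  then show ?thesis unfolding lborel_prod by auto
qed

text \<open>A Lebesgue null set lies in a Borel null set, whose product with the whole line is null;
  completeness then allows an arbitrary \<open>B\<close>.\<close>

lemma null_sets_Times_lebesgue1:
  fixes N :: "'c::euclidean_space set" and B :: "real set"
  assumes "N \<in> null_sets lebesgue"
  shows "N \<times> B \<in> null_sets lebesgue"
proof -
  obtain N' where "N' \<in> null_sets lborel" "N \<subseteq> N'"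
    using assms by (auto simp: null_sets_completion_iff2)
  then have "N' \<times> (UNIV :: real set) \<in> null_sets (lborel \<Otimes>\<^sub>M lborel)" "N \<times> B \<subseteq> N' \<times> UNIV"
    by (auto intro: lborel.times_in_null_sets1)
  then show ?thesis unfolding lborel_prod null_sets_completion_iff2 by blast
qed

lemma null_sets_Times_lebesgue2:
  fixes A :: "'c::euclidean_space set" and N :: "real set"
  assumes "N \<in> null_sets lborel"
  shows "A \<times> N \<in> null_sets lebesgue"
proof -
  have "(UNIV :: 'c set) \<times> N \<in> null_sets (lborel \<Otimes>\<^sub>M lborel)" "A \<times> N \<subseteq> UNIV \<times> N"
    using assms by (auto intro: lborel.times_in_null_sets2)
  then show ?thesis unfolding lborel_prod null_sets_completion_iff2 by blast
qed

lemma Oint_null_diff: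
  assumes "O' \<subseteq> \<Omega>" "\<Omega> - O' \<in> null_sets lebesgue"
  shows "Oint \<Omega> F = Oint O' F"
  unfolding Oint_def by (rule set_integral_lebesgue_null_diff[OF assms])

lemma Qint_null_diff:
  assumes "O' \<subseteq> \<Omega>" "\<Omega> - O' \<in> null_sets lebesgue"
  shows "Qint \<Omega> a b F = Qint O' a b F"
proof -
  have "\<Omega> \<times> {a..b} - O' \<times> {a..b} = (\<Omega> - O') \<times> {a..b}" by auto
  then show ?thesis unfolding Qint_def
    using assms null_sets_Times_lebesgue1[OF assms(2)]
    by (intro set_integral_lebesgue_null_diff) auto
qed

lemma null_sets_interval_ends: "{a..b} - {a<..<b} \<in> null_sets (lborel :: real measure)"
proof (rule countable_imp_null_set_lborel)
  have "{a..b} - {a<..<b} \<subseteq> {a, b}" by auto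
  then show "countable ({a..b} - {a<..<b})" by (rule countable_subset) simp
qed

lemma Qint_open_interval:
  "Qint \<Omega> a b F = (LINT z:(\<Omega> \<times> {a<..<b})|lebesgue. F (fst z) (snd z))"
proof -
  have "\<Omega> \<times> {a..b} - \<Omega> \<times> {a<..<b} = \<Omega> \<times> ({a..b} - {a<..<b})" by auto
  then show ?thesis unfolding Qint_def
    using null_sets_Times_lebesgue2[OF null_sets_interval_ends]
    by (intro set_integral_lebesgue_null_diff) auto
qed

lemma LINT_open_interval:
  fixes f :: "real \<Rightarrow> real"
  shows "(LINT t:{a..b}|lebesgue. f t) = (LINT t:{a<..<b}|lebesgue. f t)"
proof (rule set_integral_lebesgue_null_diff)
  show "{a..b} - {a<..<b} \<in> null_sets lebesgue"
    by (rule null_sets_completionI[OF null_sets_interval_ends])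
qed auto

section \<open>Young's inequality\<close>

lemma young_inner:
  fixes x y :: "'b::real_inner"
  assumes "l > 0"
  shows "\<bar>x \<bullet> y\<bar> \<le> (1/2) * (l * (norm x)\<^sup>2 + (norm y)\<^sup>2 / l)"
proof -
  have "\<bar>x \<bullet> y\<bar> \<le> norm x * norm y" by (rule Cauchy_Schwarz_ineq2)
  also have "\<dots> = (sqrt l * norm x) * (norm y / sqrt l)" using assms by simp
  also have "\<dots> = (1/2) * (2 * (sqrt l * norm x) * (norm y / sqrt l))"
    by simp
  also have "\<dots> \<le> (1/2) * ((sqrt l * norm x)\<^sup>2 + (norm y / sqrt l)\<^sup>2)"
    using sum_squares_bound[of "sqrt l * norm x" "norm y / sqrt l"]
    by (intro mult_left_mono) auto
  also have "\<dots> = (1/2) * (l * (norm x)\<^sup>2 + (norm y)\<^sup>2 / l)"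
    using assms by (simp add: power_mult_distrib power_divide)
  finally show ?thesis .
qed

lemma set_lebesgue_integral_nonneg:
  fixes f :: "'c \<Rightarrow> real"
  assumes "\<And>x. x \<in> A \<Longrightarrow> 0 \<le> f x"
  shows "0 \<le> (LINT x:A|M. f x)"
  unfolding set_lebesgue_integral_def
  by (rule Bochner_Integration.integral_nonneg) (use assms in \<open>auto simp: indicator_def\<close>)

text \<open>No integrability of the product is needed: otherwise its integral is 0 by convention.\<close>
lemma set_integral_young:
  fixes f g :: "'c \<Rightarrow> 'b::real_inner"
  assumes f: "set_integrable M A (\<lambda>x. (norm (f x))\<^sup>2)" and g: "set_integrable M A (\<lambda>x. (norm (g x))\<^sup>2)"
    and l: "l > 0"
  shows "\<bar>LINT x:A|M. f x \<bullet> g x\<bar> \<le> (1/2) * (l * (LINT x:A|M. (norm (f x))\<^sup>2) + (LINT x:A|M. (norm (g x))\<^sup>2) / l)"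
proof (cases "set_integrable M A (\<lambda>x. f x \<bullet> g x)")
  case True
  have "norm (LINT x:A|M. f x \<bullet> g x) \<le> (LINT x:A|M. norm (f x \<bullet> g x))"
    by (rule set_integral_norm_bound[OF True])
  also have "\<dots> \<le> (LINT x:A|M. (1/2) * (l * (norm (f x))\<^sup>2 + (norm (g x))\<^sup>2 / l))"
    using young_inner[OF l] True f g
    by (intro set_integral_mono set_integrable_norm set_integrable_mult_right set_integral_add(1) set_integrable_divide) auto
  also have "\<dots> = (1/2) * (l * (LINT x:A|M. (norm (f x))\<^sup>2) + (LINT x:A|M. (norm (g x))\<^sup>2) / l)"
    using f g by (simp add: set_integral_add)
  finally show ?thesis by simp
next
  case False
  then have "(LINT x:A|M. f x \<bullet> g x) = 0"
    unfolding set_integrable_def set_lebesgue_integral_def by (rule not_integrable_integral_eq)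
  moreover have "(LINT x:A|M. (norm (h x))\<^sup>2) \<ge> 0" for h :: "'c \<Rightarrow> 'b"
    by (rule set_lebesgue_integral_nonneg) simp
  ultimately show ?thesis using l by simp
qed

section \<open>Time slices and sources that are L^1 in time\<close>

lemma AE_lebesgue_slices:
  fixes P :: "'c::euclidean_space \<times> real \<Rightarrow> bool"
  assumes "AE z in lebesgue. P z"
  shows "AE t in lborel. AE x in lborel. P (x, t)"
proof -
  have "AE z in lborel. P z" using assms by (simp add: AE_completion_iff)
  then obtain N where N: "N \<in> null_sets (lborel :: ('c \<times> real) measure)" and sub: "{z. \<not> P z} \<subseteq> N"
    unfolding eventually_ae_filter by auto
  have "AE z in lborel \<Otimes>\<^sub>M lborel. z \<notin> N"
    unfolding lborel_prod by (rule AE_not_in[OF N])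
  then have "AE x in lborel. AE t in lborel. (x, t) \<notin> N"
    by (rule lborel_pair.AE_pair)
  moreover have "{z \<in> space (lborel \<Otimes>\<^sub>M lborel). (fst z, snd z) \<notin> N} = - N"
    by (auto simp: space_pair_measure)
  then have "{z \<in> space (lborel \<Otimes>\<^sub>M lborel). (fst z, snd z) \<notin> N} \<in> sets (lborel \<Otimes>\<^sub>M (lborel :: real measure) :: ('c \<times> real) measure)"
    using null_setsD2[OF N] unfolding lborel_prod by auto
  ultimately have "AE t in lborel. AE x in lborel. (x, t) \<notin> N"
    by (subst lborel_pair.AE_commute[symmetric]) auto
  then show ?thesis using sub by (auto elim!: eventually_mono)
qed

text \<open>Tonelli applies to a Borel representative of \<open>g\<close>; the exceptional null set
  has null slices at almost every time.\<close>

lemma nn_integral_lebesgue_slices: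
  fixes g :: "'c::euclidean_space \<times> real \<Rightarrow> ennreal"
  assumes "g \<in> borel_measurable lebesgue"
  shows "(\<integral>\<^sup>+z. g z \<partial>lebesgue) = (\<integral>\<^sup>+t. \<integral>\<^sup>+x. g (x, t) \<partial>lborel \<partial>lborel)"
proof -
  obtain g' where g': "g' \<in> borel_measurable lborel" and eq: "AE z in lborel. g z = g' z"
    using completion_ex_borel_measurable[OF assms] by blast
  have "(\<integral>\<^sup>+z. g z \<partial>lebesgue) = (\<integral>\<^sup>+z. g' z \<partial>(lborel \<Otimes>\<^sub>M lborel))"
    unfolding nn_integral_completion lborel_prod by (rule nn_integral_cong_AE[OF eq])
  also have "\<dots> = (\<integral>\<^sup>+t. \<integral>\<^sup>+x. g' (x, t) \<partial>lborel \<partial>lborel)"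
    using g' by (subst lborel_pair.nn_integral_snd) (simp_all add: lborel_prod)
  also have "\<dots> = (\<integral>\<^sup>+t. \<integral>\<^sup>+x. g (x, t) \<partial>lborel \<partial>lborel)"
  proof (rule nn_integral_cong_AE)
    have "AE z in lebesgue. g z = g' z" using eq by (rule AE_completion)
    from AE_lebesgue_slices[OF this]
    show "AE t in lborel. (\<integral>\<^sup>+x. g' (x, t) \<partial>lborel) = (\<integral>\<^sup>+x. g (x, t) \<partial>lborel)"
      by eventually_elim (auto intro!: nn_integral_cong_AE elim: eventually_mono)
  qed
  finally show ?thesis .
qed

lemma ennreal_le_of_young:
  fixes x :: ennreal
  assumes le: "\<And>l. l > 0 \<Longrightarrow> x \<le> ennreal ((1/2) * (l * p\<^sup>2 + r\<^sup>2 / l))" and p: "p \<ge> 0" and r: "r \<ge> 0"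
  shows "x \<le> ennreal (p * r)"
proof -
  have "x < top" using le[of 1] by (simp add: order_le_less_trans)
  then obtain y where y: "x = ennreal y" "y \<ge> 0" by (cases x) auto
  have ley: "y \<le> (1/2) * (l * p\<^sup>2 + r\<^sup>2 / l)" if "l > 0" for l
    using le[OF that] y that by (subst (asm) y) (subst (asm) ennreal_le_iff, auto)
  have "y \<le> p * r"
  proof (cases "p = 0 \<or> r = 0 \<or> y = 0")
    case False
    then have "r / p > 0" using p r by simp
    from ley[OF this] have "y \<le> (1/2) * (r / p * p\<^sup>2 + r\<^sup>2 / (r / p))" .
    also have "\<dots> = p * r" using False by (simp add: power2_eq_square)
    finally show ?thesis .
  next
    case True
    have "False" if y0: "y > 0" and z: "p = 0 \<or> r = 0"
    proof (cases "p = 0")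
      case True
      from ley[of "(r\<^sup>2 + 1) / y"] y0 have "y \<le> (1/2) * (r\<^sup>2 / ((r\<^sup>2 + 1) / y))"
        using True by (simp add: add_nonneg_pos)
      also have "\<dots> = (1/2) * (r\<^sup>2 / (r\<^sup>2 + 1) * y)" using y0 by simp
      also have "\<dots> \<le> (1/2) * (1 * y)"
        using y0 by (intro mult_left_mono mult_right_mono) (auto simp: divide_le_eq add_nonneg_pos)
      finally show False using y0 by simp
    next
      case False
      then have "r = 0" using z by simp
      with ley[of "y / p\<^sup>2"] y0 False have "y \<le> (1/2) * (y / p\<^sup>2 * p\<^sup>2)" by simp
      then show False using y0 False by simp
    qed
    then show ?thesis using True y(2) p r by (cases "y = 0") (auto simp: less_le)
  qed
  then show ?thesis using y by (auto intro: ennreal_leI)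
qed

text \<open>The slices \<open>f(\<cdot>, t)\<close> need not be measurable, which rules out the Cauchy--Schwarz inequality
  on slices; Young's inequality with every weight needs only their squares.\<close>
lemma source_bound:
  fixes f w :: "'c::euclidean_space \<Rightarrow> real \<Rightarrow> real"
  assumes f: "L1L2 O' T f" and ab: "0 \<le> a" "b \<le> T"
    and w: "set_borel_measurable lebesgue (O' \<times> {a<..<b}) (\<lambda>z. w (fst z) (snd z))"
    and wi: "\<And>t. t \<in> {a<..<b} \<Longrightarrow> set_integrable lebesgue O' (\<lambda>x. (w x t)\<^sup>2)"
    and wB: "\<And>t. t \<in> {a<..<b} \<Longrightarrow> Oint O' (\<lambda>x. (w x t)\<^sup>2) \<le> B\<^sup>2"
    and B: "B \<ge> 0" and O': "O' \<in> sets lborel"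
  shows "\<bar>Qint O' a b (\<lambda>x t. f x t * w x t)\<bar> \<le> B * (LINT t:{a..b}|lebesgue. sqrt (Oint O' (\<lambda>x. (f x t)\<^sup>2)))"
proof -
  define h where "h t = sqrt (Oint O' (\<lambda>x. (f x t)\<^sup>2))" for t
  define H where "H z = indicator (O' \<times> {a<..<b}) z *\<^sub>R (f (fst z) (snd z) * w (fst z) (snd z))" for z
  have sub: "{a<..<b} \<subseteq> {0<..<T}" using ab by auto
  have Oint0: "Oint O' (\<lambda>x. (v x)\<^sup>2) \<ge> 0" for v :: "'c \<Rightarrow> real"
    unfolding Oint_def by (rule set_lebesgue_integral_nonneg) simp
  have S: "O' \<times> {a<..<b} \<in> sets lebesgue" using O' by (intro sets_Times_lebesgue) auto
  have "set_borel_measurable lebesgue (O' \<times> {a<..<b}) (\<lambda>z. f (fst z) (snd z))"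
  proof (rule set_borel_measurable_subset[OF _ S])
    show "set_borel_measurable lebesgue (O' \<times> {0<..<T}) (\<lambda>z. f (fst z) (snd z))"
      using f by (simp add: L1L2_def)
  qed (use sub in blast)
  then have "(\<lambda>z. (indicator (O' \<times> {a<..<b}) z *\<^sub>R f (fst z) (snd z)) * (indicator (O' \<times> {a<..<b}) z *\<^sub>R w (fst z) (snd z)))
      \<in> borel_measurable lebesgue"
    using w unfolding set_borel_measurable_def by (rule borel_measurable_times)
  moreover have "H = (\<lambda>z. (indicator (O' \<times> {a<..<b}) z *\<^sub>R f (fst z) (snd z)) * (indicator (O' \<times> {a<..<b}) z *\<^sub>R w (fst z) (snd z)))"
    by (auto simp: H_def indicator_def)
  ultimately have Hm: "H \<in> borel_measurable lebesgue" by simp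
  have hi: "set_integrable lebesgue {a<..<b} h"
  proof (rule set_integrable_subset[OF _ _ sub])
    show "set_integrable lebesgue {0<..<T} h" using f by (simp add: L1L2_def h_def[abs_def])
  qed simp
  have "AE t in lborel. t \<in> {0<..<T} \<longrightarrow> set_integrable lebesgue O' (\<lambda>x. (f x t)\<^sup>2)"
    using f by (simp add: L1L2_def AE_completion_iff)
  then have inner: "AE t in lborel. (\<integral>\<^sup>+x. ennreal (norm (H (x, t))) \<partial>lborel) \<le> ennreal (indicator {a<..<b} t *\<^sub>R (B * h t))"
  proof eventually_elim
    case (elim t)
    show ?case
    proof (cases "t \<in> {a<..<b}")
      case False
      then show ?thesis by (simp add: H_def)
    next
      case True
      then have fi: "set_integrable lebesgue O' (\<lambda>x. (f x t)\<^sup>2)" using elim sub by auto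
      have "(\<integral>\<^sup>+x. ennreal (norm (H (x, t))) \<partial>lborel) \<le> ennreal (h t * B)"
      proof (rule ennreal_le_of_young)
        fix l :: real assume l: "l > 0"
        have i: "set_integrable lebesgue O' (\<lambda>x. (1/2) * (l * (f x t)\<^sup>2 + (w x t)\<^sup>2 / l))"
          using fi wi[OF True] by (intro set_integrable_mult_right set_integral_add(1) set_integrable_divide) auto
        have "(\<integral>\<^sup>+x. ennreal (norm (H (x, t))) \<partial>lborel)
            \<le> (\<integral>\<^sup>+x. ennreal (indicator O' x *\<^sub>R ((1/2) * (l * (f x t)\<^sup>2 + (w x t)\<^sup>2 / l))) \<partial>lborel)"
        proof (rule nn_integral_mono, rule ennreal_leI)
          fix x
          show "norm (H (x, t)) \<le> indicator O' x *\<^sub>R ((1/2) * (l * (f x t)\<^sup>2 + (w x t)\<^sup>2 / l))"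
            using young_inner[OF l, of "f x t" "w x t"] by (auto simp: H_def indicator_def)
        qed
        also have "\<dots> = (\<integral>\<^sup>+x. ennreal (indicator O' x *\<^sub>R ((1/2) * (l * (f x t)\<^sup>2 + (w x t)\<^sup>2 / l))) \<partial>lebesgue)"
          by (simp only: nn_integral_completion)
        also have "\<dots> = ennreal (LINT x:O'|lebesgue. (1/2) * (l * (f x t)\<^sup>2 + (w x t)\<^sup>2 / l))"
          unfolding set_lebesgue_integral_def using i[unfolded set_integrable_def] l
          by (intro nn_integral_eq_integral) auto
        also have "(LINT x:O'|lebesgue. (1/2) * (l * (f x t)\<^sup>2 + (w x t)\<^sup>2 / l))
            = (1/2) * (l * Oint O' (\<lambda>x. (f x t)\<^sup>2) + Oint O' (\<lambda>x. (w x t)\<^sup>2) / l)"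
          unfolding Oint_def using fi wi[OF True] by (simp add: set_integral_add)
        also have "\<dots> \<le> (1/2) * (l * (h t)\<^sup>2 + B\<^sup>2 / l)"
          using wB[OF True] l Oint0 by (auto simp: h_def intro!: divide_right_mono)
        finally show "(\<integral>\<^sup>+x. ennreal (norm (H (x, t))) \<partial>lborel) \<le> ennreal ((1/2) * (l * (h t)\<^sup>2 + B\<^sup>2 / l))"
          by (simp add: ennreal_leI)
      qed (use B Oint0 in \<open>auto simp: h_def\<close>)
      then show ?thesis using True by (simp add: mult.commute)
    qed
  qed
  have rhs0: "(LINT t:{a<..<b}|lebesgue. B * h t) \<ge> 0"
    using B Oint0 by (intro set_lebesgue_integral_nonneg) (auto simp: h_def)
  \<comment> \<open>If \<open>H\<close> is not integrable, its integral is 0 and the bound is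
    trivial.\<close>
  have "ennreal \<bar>integral\<^sup>L lebesgue H\<bar> \<le> (\<integral>\<^sup>+z. ennreal (norm (H z)) \<partial>lebesgue)"
  proof (cases "integrable lebesgue H")
    case True
    then show ?thesis using integral_norm_bound_ennreal[OF True] by simp
  qed (simp add: not_integrable_integral_eq)
  also have "\<dots> = (\<integral>\<^sup>+t. \<integral>\<^sup>+x. ennreal (norm (H (x, t))) \<partial>lborel \<partial>lborel)"
    using Hm by (intro nn_integral_lebesgue_slices) measurable
  also have "\<dots> \<le> (\<integral>\<^sup>+t. ennreal (indicator {a<..<b} t *\<^sub>R (B * h t)) \<partial>lborel)"
    by (rule nn_integral_mono_AE[OF inner])
  also have "\<dots> = (\<integral>\<^sup>+t. ennreal (indicator {a<..<b} t *\<^sub>R (B * h t)) \<partial>lebesgue)"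
    by (simp only: nn_integral_completion)
  also have "\<dots> = ennreal (LINT t:{a<..<b}|lebesgue. B * h t)"
  proof -
    have "set_integrable lebesgue {a<..<b} (\<lambda>t. B * h t)" using hi by (intro set_integrable_mult_right)
    then show ?thesis unfolding set_lebesgue_integral_def set_integrable_def
      using B Oint0 by (intro nn_integral_eq_integral) (auto simp: h_def indicator_def)
  qed
  finally have "\<bar>integral\<^sup>L lebesgue H\<bar> \<le> (LINT t:{a<..<b}|lebesgue. B * h t)"
    using rhs0 by (simp add: ennreal_le_iff)
  then show ?thesis
    unfolding Qint_open_interval LINT_open_interval h_def[symmetric]
    by (simp add: H_def[abs_def] set_lebesgue_integral_def[of _ "O' \<times> {a<..<b}"])
qed

section \<open>Bounded continuous integrands\<close>

lemma L1L2_subset: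
  assumes f: "L1L2 \<Omega> T f" and sub: "O' \<subseteq> \<Omega>" and null: "\<Omega> - O' \<in> null_sets lebesgue" and O': "O' \<in> sets lborel"
  shows "L1L2 O' T f"
  unfolding L1L2_def
proof (intro conjI)
  have S: "O' \<times> {0<..<T} \<in> sets lebesgue" using O' by (intro sets_Times_lebesgue) auto
  show "set_borel_measurable lebesgue (O' \<times> {0<..<T}) (\<lambda>z. f (fst z) (snd z))"
  proof (rule set_borel_measurable_subset[OF _ S])
    show "set_borel_measurable lebesgue (\<Omega> \<times> {0<..<T}) (\<lambda>z. f (fst z) (snd z))"
      using f by (simp add: L1L2_def)
  qed (use sub in blast)
  have "AE t in lebesgue. t \<in> {0<..<T} \<longrightarrow> set_integrable lebesgue \<Omega> (\<lambda>x. (f x t)\<^sup>2)"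
    using f by (simp add: L1L2_def)
  then show "AE t in lebesgue. t \<in> {0<..<T} \<longrightarrow> set_integrable lebesgue O' (\<lambda>x. (f x t)\<^sup>2)"
  proof eventually_elim
    case (elim t)
    then show ?case using O' sub by (auto intro: set_integrable_subset[of lebesgue \<Omega>])
  qed
  show "set_integrable lebesgue {0<..<T} (\<lambda>t. sqrt (Oint O' (\<lambda>x. (f x t)\<^sup>2)))"
    using f by (simp add: L1L2_def Oint_null_diff[OF sub null])
qed

text \<open>The interval is bounded, so \<open>1 + \<phi>\<close> is an integrable majorant of the
  square root.\<close>

lemma set_integrable_sqrt:
  fixes \<phi> :: "real \<Rightarrow> real"
  assumes "set_integrable lebesgue {a<..<b} \<phi>" and "\<And>t. t \<in> {a<..<b} \<Longrightarrow> \<phi> t \<ge> 0"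
  shows "set_integrable lebesgue {a<..<b} (\<lambda>t. sqrt (\<phi> t))"
  unfolding set_integrable_def
proof (rule Bochner_Integration.integrable_bound)
  have "set_integrable lebesgue {a<..<b} (\<lambda>t. 1 :: real)"
    unfolding set_integrable_def using emeasure_bounded_finite[of "{a<..<b}"]
    by (auto intro!: integrable_real_indicator)
  then show "integrable lebesgue (\<lambda>t. indicator {a<..<b} t *\<^sub>R (1 + \<phi> t))"
    using assms(1) set_integral_add(1) unfolding set_integrable_def[symmetric] by blast
  have "(\<lambda>t. sqrt (indicator {a<..<b} t *\<^sub>R \<phi> t)) \<in> borel_measurable lebesgue"
    using measurable_compose[OF borel_measurable_integrable[OF assms(1)[unfolded set_integrable_def]] borel_measurable_sqrt]
    by simp
  moreover have "(\<lambda>t. sqrt (indicator {a<..<b} t *\<^sub>R \<phi> t)) = (\<lambda>t. indicator {a<..<b} t *\<^sub>R sqrt (\<phi> t))"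
    by (auto simp: indicator_def)
  ultimately show "(\<lambda>t. indicator {a<..<b} t *\<^sub>R sqrt (\<phi> t)) \<in> borel_measurable lebesgue" by simp
  have "sqrt x \<le> 1 + x" if "x \<ge> 0" for x :: real
    using that by (intro real_le_lsqrt) (auto simp: power2_eq_square algebra_simps)
  then show "AE t in lebesgue. norm (indicator {a<..<b} t *\<^sub>R sqrt (\<phi> t)) \<le> norm (indicator {a<..<b} t *\<^sub>R (1 + \<phi> t))"
    using assms(2) by (intro AE_I2) (auto simp: indicator_def)
qed

text \<open>Carries \<xi>, given as square integrable on the cylinder, into the slicewise class in
  which sources are estimated. Fubini is applied to a Borel representative of the squared function,
  and the identities for slices hold at almost every time.\<close>

lemma L1L2_of_square_integrable:
  fixes \<xi> :: "'c::euclidean_space \<Rightarrow> real \<Rightarrow> real"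
  assumes m: "set_borel_measurable lebesgue (\<Omega> \<times> {0<..<T}) (\<lambda>z. \<xi> (fst z) (snd z))"
    and i: "set_integrable lebesgue (\<Omega> \<times> {0<..<T}) (\<lambda>z. (\<xi> (fst z) (snd z))\<^sup>2)"
  shows "L1L2 \<Omega> T \<xi>"
proof -
  define g where "g z = indicator (\<Omega> \<times> {0<..<T}) z *\<^sub>R (\<xi> (fst z) (snd z))\<^sup>2" for z
  have gi: "integrable lebesgue g" using i by (simp add: g_def[abs_def] set_integrable_def)
  obtain g' where g'm: "g' \<in> borel_measurable lborel" and "AE z in lborel. g z = g' z"
    using completion_ex_borel_measurable_real[OF borel_measurable_integrable[OF gi]] by blast
  then have eq: "AE z in lebesgue. g z = g' z" by (auto intro: AE_completion)
  have "integrable lebesgue g'" by (rule integrable_lebesgue_AE[OF gi eq])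
  then have "integrable lborel g'" using g'm by (simp add: integrable_completion)
  then have g'i: "integrable (lborel \<Otimes>\<^sub>M lborel) (case_prod (\<lambda>x t. g' (x, t)))"
    by (simp add: lborel_prod)
  have gx: "g (x, t) = indicator \<Omega> x *\<^sub>R (\<xi> x t)\<^sup>2" if "t \<in> {0<..<T}" for x t
    using that by (auto simp: g_def indicator_def)
  have "AE t in lborel. t \<in> {0<..<T} \<longrightarrow> set_integrable lebesgue \<Omega> (\<lambda>x. (\<xi> x t)\<^sup>2)
      \<and> Oint \<Omega> (\<lambda>x. (\<xi> x t)\<^sup>2) = (\<integral>x. g' (x, t) \<partial>lborel)"
    using AE_lebesgue_slices[OF eq] lborel_pair.AE_integrable_snd[OF g'i]
  proof eventually_elim
    case (elim t)
    show ?case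
    proof
      assume t: "t \<in> {0<..<T}"
      have e: "AE x in lebesgue. g' (x, t) = indicator \<Omega> x *\<^sub>R (\<xi> x t)\<^sup>2"
        using AE_completion[OF elim(1)] by eventually_elim (simp add: gx[OF t])
      have m: "(\<lambda>x. g' (x, t)) \<in> borel_measurable lborel" using elim(2) by (rule borel_measurable_integrable)
      have "integrable lebesgue (\<lambda>x. g' (x, t))" using elim(2) m by (simp add: integrable_completion)
      from integrable_lebesgue_AE[OF this e] have 1: "set_integrable lebesgue \<Omega> (\<lambda>x. (\<xi> x t)\<^sup>2)"
        by (simp add: set_integrable_def)
      have "Oint \<Omega> (\<lambda>x. (\<xi> x t)\<^sup>2) = (\<integral>x. g' (x, t) \<partial>lebesgue)"
        unfolding Oint_def set_lebesgue_integral_def by (rule integral_lebesgue_AE[OF e, symmetric])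
      with 1 m show "set_integrable lebesgue \<Omega> (\<lambda>x. (\<xi> x t)\<^sup>2)
          \<and> Oint \<Omega> (\<lambda>x. (\<xi> x t)\<^sup>2) = (\<integral>x. g' (x, t) \<partial>lborel)"
        by (simp add: integral_completion)
    qed
  qed
  then have ae: "AE t in lebesgue. t \<in> {0<..<T} \<longrightarrow> set_integrable lebesgue \<Omega> (\<lambda>x. (\<xi> x t)\<^sup>2)
      \<and> Oint \<Omega> (\<lambda>x. (\<xi> x t)\<^sup>2) = (\<integral>x. g' (x, t) \<partial>lborel)" by (rule AE_completion)
  have "integrable lborel (\<lambda>t. \<integral>x. g' (x, t) \<partial>lborel)"
    by (rule lborel_pair.integrable_snd[OF g'i])
  then have "integrable lebesgue (\<lambda>t. \<integral>x. g' (x, t) \<partial>lborel)"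
    by (subst integrable_completion) (auto dest: borel_measurable_integrable)
  then have "integrable lebesgue (\<lambda>t. indicator {0<..<T} t *\<^sub>R (\<integral>x. g' (x, t) \<partial>lborel))"
    by (intro integrable_mult_indicator) auto
  moreover have "AE t in lebesgue. indicator {0<..<T} t *\<^sub>R (\<integral>x. g' (x, t) \<partial>lborel)
      = indicator {0<..<T} t *\<^sub>R Oint \<Omega> (\<lambda>x. (\<xi> x t)\<^sup>2)"
    using ae by eventually_elim (auto simp: indicator_def)
  ultimately have "set_integrable lebesgue {0<..<T} (\<lambda>t. Oint \<Omega> (\<lambda>x. (\<xi> x t)\<^sup>2))"
    unfolding set_integrable_def by (rule integrable_lebesgue_AE)
  then have "set_integrable lebesgue {0<..<T} (\<lambda>t. sqrt (Oint \<Omega> (\<lambda>x. (\<xi> x t)\<^sup>2)))"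
    by (rule set_integrable_sqrt) (simp add: Oint_def set_lebesgue_integral_nonneg)
  then show ?thesis unfolding L1L2_def using m ae by (auto elim: eventually_mono)
qed

text \<open>Boundedness is a separate condition because the relevant sets omit the mesh skeleton:
  they are not compact, and gradients may jump across it. Both conditions together are stable under
  sums and products and give integrability on bounded Borel sets.\<close>

definition bcont :: "'c::topological_space set \<Rightarrow> ('c \<Rightarrow> 'b::real_normed_vector) \<Rightarrow> bool" where
  "bcont S f \<longleftrightarrow> continuous_on S f \<and> (\<exists>B. \<forall>x\<in>S. norm (f x) \<le> B)"

named_theorems bcont_intros

lemma bcont_const [bcont_intros]: "bcont S (\<lambda>x. c)"
  by (auto simp: bcont_def)

lemma bcont_add [bcont_intros]: "bcont S f \<Longrightarrow> bcont S g \<Longrightarrow> bcont S (\<lambda>x. f x + g x)"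
  unfolding bcont_def by (fast intro: continuous_on_add order_trans[OF norm_triangle_ineq add_mono])

lemma bcont_diff [bcont_intros]: "bcont S f \<Longrightarrow> bcont S g \<Longrightarrow> bcont S (\<lambda>x. f x - g x)"
  unfolding bcont_def by (fast intro: continuous_on_diff order_trans[OF norm_triangle_ineq4 add_mono])

lemma bcont_bilinear:
  assumes b: "bounded_bilinear h" and f: "bcont S f" and g: "bcont S g"
  shows "bcont S (\<lambda>x. h (f x) (g x))"
proof -
  interpret bounded_bilinear h by (rule b)
  obtain F G where F: "\<And>x. x \<in> S \<Longrightarrow> norm (f x) \<le> F" and G: "\<And>x. x \<in> S \<Longrightarrow> norm (g x) \<le> G"
    using f g unfolding bcont_def by blast
  obtain K where K: "K \<ge> 0" "\<And>a c. norm (h a c) \<le> norm a * norm c * K"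
    using nonneg_bounded by blast
  have "norm (h (f x) (g x)) \<le> F * G * K" if "x \<in> S" for x
  proof -
    have "F \<ge> 0" using F[OF that] norm_ge_zero order_trans by blast
    then have "norm (f x) * norm (g x) * K \<le> F * G * K"
      using F[OF that] G[OF that] K(1) by (intro mult_right_mono mult_mono) auto
    then show ?thesis using K(2) order_trans by blast
  qed
  then show ?thesis using f g unfolding bcont_def by (auto intro: continuous_on)
qed

lemmas bcont_mult [bcont_intros] = bcont_bilinear[OF bounded_bilinear_mult]
lemmas bcont_scaleR [bcont_intros] = bcont_bilinear[OF bounded_bilinear_scaleR]
lemmas bcont_inner [bcont_intros] = bcont_bilinear[OF bounded_bilinear_inner]

lemma bcont_power2 [bcont_intros]:
  fixes f :: "'c::topological_space \<Rightarrow> real"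
  shows "bcont S f \<Longrightarrow> bcont S (\<lambda>x. (f x)\<^sup>2)"
  unfolding power2_eq_square by (rule bcont_mult)

lemma bcont_norm_power2 [bcont_intros]:
  fixes f :: "'c::topological_space \<Rightarrow> 'b::real_inner"
  shows "bcont S f \<Longrightarrow> bcont S (\<lambda>x. (norm (f x))\<^sup>2)"
  unfolding power2_norm_eq_inner by (rule bcont_inner)

lemma bcont_sum [bcont_intros]:
  assumes "\<And>i. i \<in> I \<Longrightarrow> bcont S (f i)"
  shows "bcont S (\<lambda>x. \<Sum>i\<in>I. f i x)"
  using assms
proof (induction I rule: infinite_finite_induct)
  case (insert i I)
  then show ?case by (simp add: bcont_add)
qed (simp_all add: bcont_const)

lemma bcont_subset: "bcont S f \<Longrightarrow> S' \<subseteq> S \<Longrightarrow> bcont S' f"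
  unfolding bcont_def by (blast intro: continuous_on_subset)

lemma bcont_fst [bcont_intros]: "bcont O' f \<Longrightarrow> bcont (O' \<times> I) (\<lambda>z. f (fst z))"
  unfolding bcont_def by (auto intro!: continuous_on_compose2[of O' f] continuous_intros)

lemma bcont_snd [bcont_intros]:
  assumes "continuous_on {a..b::real} g"
  shows "bcont (O' \<times> {a..b}) (\<lambda>z. g (snd z))"
proof -
  have "bounded (g ` {a..b})"
    using assms by (intro compact_imp_bounded compact_continuous_image) auto
  then obtain B where "\<forall>t\<in>{a..b}. norm (g t) \<le> B" unfolding bounded_iff by auto
  then show ?thesis unfolding bcont_def
    using assms by (auto intro!: continuous_on_compose2[of "{a..b}" g] continuous_intros)
qed

lemma bcont_slice_x: "bcont (O' \<times> I) (\<lambda>z. F (fst z) (snd z)) \<Longrightarrow> t \<in> I \<Longrightarrow> bcont O' (\<lambda>x. F x t)"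
  unfolding bcont_def by (auto intro!: continuous_on_compose2[of "O' \<times> I" "\<lambda>z. F (fst z) (snd z)" O' "\<lambda>x. (x, t)", simplified] continuous_intros)

lemma bcont_slice_t: "bcont (O' \<times> I) (\<lambda>z. F (fst z) (snd z)) \<Longrightarrow> x \<in> O' \<Longrightarrow> continuous_on I (F x)"
  unfolding bcont_def
  by (auto intro!: continuous_on_compose2[of "O' \<times> I" "\<lambda>z. F (fst z) (snd z)" I "\<lambda>t. (x, t)", simplified] continuous_intros)

lemma bcont_spoly [bcont_intros]:
  assumes "\<And>j. j < q \<Longrightarrow> bcont O' (c j)"
  shows "bcont (O' \<times> {a..b}) (\<lambda>z. spoly a b q (\<lambda>j. c j (fst z)) (snd z))"
proof -
  have "continuous_on {a..b} (\<lambda>t. ((t - a) / (b - a)) ^ j)" for j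
    by (cases "a = b") (auto intro!: continuous_intros)
  then show ?thesis unfolding spoly_def tpoly_def
    using assms by (intro bcont_sum bcont_scaleR bcont_fst bcont_snd[where g = "\<lambda>t. ((t - a) / (b - a)) ^ _"]) auto
qed

lemma bcont_set_integrable:
  fixes f :: "'c::euclidean_space \<Rightarrow> real"
  assumes f: "bcont S f" and S: "S \<in> sets borel" "bounded S"
  shows "set_integrable lborel S f"
proof -
  obtain B where B: "\<And>x. x \<in> S \<Longrightarrow> norm (f x) \<le> B" using f unfolding bcont_def by blast
  have "(\<lambda>x. indicator S x *\<^sub>R f x) \<in> borel_measurable borel"
    using f S by (intro borel_measurable_continuous_on_indicator) (auto simp: bcont_def)
  then have "integrable lborel (\<lambda>x. indicator S x *\<^sub>R (indicator S x *\<^sub>R f x))"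
    using S emeasure_bounded_finite[of S] B
    by (intro integrableI_bounded_set_indicator[where B=B] AE_I2) auto
  moreover have "(\<lambda>x. indicator S x *\<^sub>R (indicator S x *\<^sub>R f x)) = (\<lambda>x. indicator S x *\<^sub>R f x)"
    by (auto simp: indicator_def)
  ultimately show ?thesis by (simp only: set_integrable_def)
qed

lemma bcont_set_integrable_lebesgue:
  fixes f :: "'c::euclidean_space \<Rightarrow> real"
  assumes f: "bcont S f" and S: "S \<in> sets borel" "bounded S"
  shows "set_integrable lebesgue S f" "(LINT x:S|lebesgue. f x) = (LINT x:S|lborel. f x)"
proof -
  have i: "integrable lborel (\<lambda>x. indicator S x *\<^sub>R f x)"
    using bcont_set_integrable[OF assms] by (simp add: set_integrable_def)
  then have m: "(\<lambda>x. indicator S x *\<^sub>R f x) \<in> borel_measurable lborel" by (rule borel_measurable_integrable)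
  show "set_integrable lebesgue S f" using i m by (simp add: set_integrable_def integrable_completion)
  show "(LINT x:S|lebesgue. f x) = (LINT x:S|lborel. f x)"
    unfolding set_lebesgue_integral_def by (rule integral_completion[OF m])
qed

text \<open>The inner time integral is the gauge integral, so that identities from the fundamental
  theorem of calculus can be inserted at fixed \<open>x\<close>. Its integrability in
  \<open>x\<close> is what comparison of the outer integrals requires.\<close>

lemma Qint_iterated:
  fixes F :: "'c::euclidean_space \<Rightarrow> real \<Rightarrow> real"
  assumes O': "open O'" "bounded O'" and F: "bcont (O' \<times> {a..b}) (\<lambda>z. F (fst z) (snd z))"
  shows "Qint O' a b F = Oint O' (\<lambda>x. integral {a..b} (F x))"
    and "set_integrable lebesgue O' (\<lambda>x. integral {a..b} (F x))"
    and "set_integrable lebesgue (O' \<times> {a..b}) (\<lambda>z. F (fst z) (snd z))"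
proof -
  have "O' \<times> {a..b} \<in> sets (borel \<Otimes>\<^sub>M borel)" using O' by (intro pair_measureI) auto
  then have S: "O' \<times> {a..b} \<in> sets borel" unfolding borel_prod by simp
  have bS: "bounded (O' \<times> {a..b})" using O' by (intro bounded_Times) auto
  define H where "H z = indicator (O' \<times> {a..b}) z *\<^sub>R F (fst z) (snd z)" for z
  have Hi: "integrable (lborel \<Otimes>\<^sub>M lborel) H"
    using bcont_set_integrable[OF F S bS] by (simp add: set_integrable_def H_def[abs_def] lborel_prod)
  have inner: "(\<integral>t. H (x, t) \<partial>lborel) = indicator O' x *\<^sub>R integral {a..b} (F x)" for x
  proof (cases "x \<in> O'")
    case True
    have "bcont {a..b} (F x)"
      using bcont_slice_t[OF F True] compact_continuous_image[of "{a..b}" "F x"]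
      by (auto simp: bcont_def bounded_iff dest!: compact_imp_bounded)
    then have "set_integrable lborel {a..b} (F x)" by (rule bcont_set_integrable) auto
    from set_borel_integral_eq_integral(2)[OF this] True show ?thesis
      by (simp add: H_def set_lebesgue_integral_def indicator_def)
  qed (simp add: H_def)
  have i: "integrable lborel (\<lambda>x. indicator O' x *\<^sub>R integral {a..b} (F x))"
    using lborel_pair.integrable_fst'[OF Hi] by (simp add: inner)
  then have m: "(\<lambda>x. indicator O' x *\<^sub>R integral {a..b} (F x)) \<in> borel_measurable lborel"
    by (rule borel_measurable_integrable)
  show "set_integrable lebesgue O' (\<lambda>x. integral {a..b} (F x))"
    using i m by (simp add: set_integrable_def integrable_completion)
  show "set_integrable lebesgue (O' \<times> {a..b}) (\<lambda>z. F (fst z) (snd z))"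
    by (rule bcont_set_integrable_lebesgue[OF F S bS])
  have "Qint O' a b F = (\<integral>z. H z \<partial>(lborel \<Otimes>\<^sub>M lborel))"
    unfolding Qint_def bcont_set_integrable_lebesgue(2)[OF F S bS]
    by (simp add: set_lebesgue_integral_def H_def[abs_def] lborel_prod)
  also have "\<dots> = (\<integral>x. (\<integral>t. H (x, t) \<partial>lborel) \<partial>lborel)"
    by (rule lborel_pair.integral_fst'[OF Hi, symmetric])
  also have "\<dots> = Oint O' (\<lambda>x. integral {a..b} (F x))"
    unfolding inner Oint_def set_lebesgue_integral_def by (rule integral_completion[OF m, symmetric])
  finally show "Qint O' a b F = Oint O' (\<lambda>x. integral {a..b} (F x))" .
qed

text \<open>The coefficients are bounded uniformly in \<open>x\<close>, so all functions share the
  modulus of continuity \<open>E\<close> in time, and the supremum inherits it. Continuity makes the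
  time integral of the supremum the same in the gauge and in the Lebesgue sense.\<close>

lemma continuous_on_SUP_spoly:
  fixes c :: "nat \<Rightarrow> 'c::topological_space \<Rightarrow> real"
  assumes ne: "\<Omega> \<noteq> {}" and c: "\<And>j. j < q \<Longrightarrow> bcont \<Omega> (c j)"
  shows "continuous_on {a..b} (\<lambda>t. SUP x\<in>\<Omega>. \<bar>spoly a b q (\<lambda>j. c j x) t\<bar>)" 
    and "\<And>x t. x \<in> \<Omega> \<Longrightarrow> t \<in> {a..b} \<Longrightarrow> \<bar>spoly a b q (\<lambda>j. c j x) t\<bar> \<le> (SUP y\<in>\<Omega>. \<bar>spoly a b q (\<lambda>j. c j y) t\<bar>)"
proof -
  let ?S = "\<lambda>t. SUP x\<in>\<Omega>. \<bar>spoly a b q (\<lambda>j. c j x) t\<bar>"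
  have "bcont (\<Omega> \<times> {a..b}) (\<lambda>z. spoly a b q (\<lambda>j. c j (fst z)) (snd z))"
    using c by (rule bcont_spoly)
  then obtain B where B: "\<And>x t. x \<in> \<Omega> \<Longrightarrow> t \<in> {a..b} \<Longrightarrow> \<bar>spoly a b q (\<lambda>j. c j x) t\<bar> \<le> B"
    unfolding bcont_def by fastforce
  have bdd: "bdd_above ((\<lambda>x. \<bar>spoly a b q (\<lambda>j. c j x) t\<bar>) ` \<Omega>)" if "t \<in> {a..b}" for t
    using B[OF _ that] by (auto intro!: bdd_aboveI)
  show up: "\<bar>spoly a b q (\<lambda>j. c j x) t\<bar> \<le> ?S t" if "x \<in> \<Omega>" "t \<in> {a..b}" for x t
    by (rule cSUP_upper[OF that(1) bdd[OF that(2)]])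
  have "\<forall>j. \<exists>C. j < q \<longrightarrow> (\<forall>x\<in>\<Omega>. \<bar>c j x\<bar> \<le> C)"
    using c unfolding bcont_def by (metis real_norm_def)
  then obtain C where C: "\<And>j x. j < q \<Longrightarrow> x \<in> \<Omega> \<Longrightarrow> \<bar>c j x\<bar> \<le> C j" by metis
  define \<phi> where "\<phi> j t = ((t - a) / (b - a)) ^ j" for j :: nat and t
  define E where "E t t' = (\<Sum>j<q. \<bar>\<phi> j t - \<phi> j t'\<bar> * C j)" for t t'
  have dev: "\<bar>spoly a b q (\<lambda>j. c j x) t - spoly a b q (\<lambda>j. c j x) t'\<bar> \<le> E t t'" if "x \<in> \<Omega>" for x t t'
  proof -
    have "spoly a b q (\<lambda>j. c j x) t - spoly a b q (\<lambda>j. c j x) t' = (\<Sum>j<q. (\<phi> j t - \<phi> j t') * c j x)"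
      by (simp add: spoly_def tpoly_def \<phi>_def sum_subtractf left_diff_distrib)
    also have "\<bar>\<dots>\<bar> \<le> (\<Sum>j<q. \<bar>(\<phi> j t - \<phi> j t') * c j x\<bar>)" by (rule sum_abs)
    also have "\<dots> \<le> E t t'" unfolding E_def
      using C[OF _ that] by (intro sum_mono) (auto simp: abs_mult intro!: mult_left_mono)
    finally show ?thesis .
  qed
  have le: "?S t \<le> ?S t' + E t t'" if "t' \<in> {a..b}" for t t'
  proof (rule cSUP_least[OF ne])
    fix x assume x: "x \<in> \<Omega>"
    show "\<bar>spoly a b q (\<lambda>j. c j x) t\<bar> \<le> ?S t' + E t t'"
      using dev[OF x, of t t'] up[OF x that] by linarith
  qed
  have "E t t' = E t' t" for t t' by (simp add: E_def abs_minus_commute)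
  then have le2: "\<bar>?S t - ?S t'\<bar> \<le> E t t'" if "t \<in> {a..b}" "t' \<in> {a..b}" for t t'
    using le[OF that(1), of t'] le[OF that(2), of t] by (simp add: abs_le_iff)
  have cont: "continuous_on {a..b} (\<lambda>t. E t t')" for t'
    unfolding E_def \<phi>_def by (cases "a = b") (auto intro!: continuous_intros)
  show "continuous_on {a..b} ?S"
    unfolding continuous_on_def
  proof
    fix t' assume t': "t' \<in> {a..b}"
    have "((\<lambda>t. E t t') \<longlongrightarrow> E t' t') (at t' within {a..b})"
      using cont t' unfolding continuous_on_def by blast
    moreover have "E t' t' = 0" by (simp add: E_def)
    ultimately have "((\<lambda>t. E t t') \<longlongrightarrow> 0) (at t' within {a..b})" by simp
    moreover have "\<forall>\<^sub>F t in at t' within {a..b}. norm (?S t - ?S t') \<le> E t t'"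
      using le2[OF _ t'] unfolding eventually_at_filter by (auto intro!: always_eventually)
    ultimately have "((\<lambda>t. ?S t - ?S t') \<longlongrightarrow> 0) (at t' within {a..b})"
      by (rule Lim_null_comparison[rotated])
    then show "(?S \<longlongrightarrow> ?S t') (at t' within {a..b})" by (rule LIM_zero_cancel)
  qed
qed

section \<open>Finite element spaces\<close>

text \<open>Continuity of the polynomial is carried through the induction because the product rule
  places the factors themselves into the gradient.\<close>

lemma mpoly_le_gradient:
  assumes "mpoly_le n (P :: 'a::euclidean_space \<Rightarrow> real)"
  shows "continuous_on UNIV P \<and> (\<exists>G. continuous_on UNIV G \<and> (\<forall>x. (P has_derivative (\<lambda>h. G x \<bullet> h)) (at x)))"
  using assms
proof induction
  case (const n a)
  have "((\<lambda>x. a) has_derivative (\<lambda>h. 0 \<bullet> h)) (at x)" for x :: 'a by simp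
  then show ?case by (intro conjI exI[of _ "\<lambda>x. 0"]) auto
next
  case (lin n v)
  show ?case
    by (auto intro!: exI[of _ "\<lambda>x. v"] derivative_eq_intros continuous_intros simp: inner_commute)
next
  case (add n f g)
  then obtain F G where FG: "continuous_on UNIV F" "\<And>x. (f has_derivative (\<lambda>h. F x \<bullet> h)) (at x)"
    "continuous_on UNIV G" "\<And>x. (g has_derivative (\<lambda>h. G x \<bullet> h)) (at x)" by blast
  have "((\<lambda>x. f x + g x) has_derivative (\<lambda>h. (F x + G x) \<bullet> h)) (at x)" for x
    using has_derivative_add[OF FG(2) FG(4)] by (simp add: inner_add_left)
  moreover have "continuous_on UNIV (\<lambda>x. F x + G x)" using FG by (intro continuous_intros)
  moreover have "continuous_on UNIV (\<lambda>x. f x + g x)" using add by (intro continuous_intros) auto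
  ultimately show ?case by blast
next
  case (mult n f m g)
  then obtain F G where FG: "continuous_on UNIV F" "\<And>x. (f has_derivative (\<lambda>h. F x \<bullet> h)) (at x)"
    "continuous_on UNIV G" "\<And>x. (g has_derivative (\<lambda>h. G x \<bullet> h)) (at x)" by blast
  have "((\<lambda>x. f x * g x) has_derivative (\<lambda>h. (f x *\<^sub>R G x + g x *\<^sub>R F x) \<bullet> h)) (at x)" for x
    using has_derivative_mult[OF FG(2) FG(4)] by (simp add: inner_add_left mult.commute)
  moreover have "continuous_on UNIV (\<lambda>x. f x *\<^sub>R G x + g x *\<^sub>R F x)"
    using FG mult by (intro continuous_intros) auto
  moreover have "continuous_on UNIV (\<lambda>x. f x * g x)" using mult by (intro continuous_intros) auto
  ultimately show ?case by blast
qed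

section \<open>Rules for the classical gradient\<close>

lemma sgrad_unique:
  assumes "(f has_derivative (\<lambda>h. g \<bullet> h)) (at x)"
  shows "sgrad f x = g"
proof -
  have "frechet_derivative f (at x) = (\<lambda>h. g \<bullet> h)"
    using frechet_derivative_at[OF assms] by simp
  moreover have "f differentiable (at x)" using assms by (auto simp: differentiable_def)
  ultimately show ?thesis by (simp add: sgrad_def euclidean_representation)
qed

lemma sgrad_has_derivative:
  fixes f :: "'a::euclidean_space \<Rightarrow> real"
  assumes "f differentiable (at x)"
  shows "(f has_derivative (\<lambda>h. sgrad f x \<bullet> h)) (at x)"
proof -
  let ?D = "frechet_derivative f (at x)"
  have D: "(f has_derivative ?D) (at x)" using assms by (simp add: frechet_derivative_works)
  then interpret bounded_linear ?D by (rule has_derivative_bounded_linear)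
  have "sgrad f x \<bullet> h = ?D h" for h
  proof -
    have "?D h = ?D (\<Sum>b\<in>Basis. (h \<bullet> b) *\<^sub>R b)" by (simp add: euclidean_representation)
    also have "\<dots> = (\<Sum>b\<in>Basis. (h \<bullet> b) * ?D b)" by (simp add: sum scaleR)
    also have "\<dots> = sgrad f x \<bullet> h"
      using assms by (simp add: sgrad_def inner_sum_left inner_commute[of h] mult.commute)
    finally show ?thesis by simp
  qed
  then show ?thesis using D by simp
qed

lemma sgrad_add:
  fixes f g :: "'a::euclidean_space \<Rightarrow> real"
  assumes "f differentiable (at x)" "g differentiable (at x)"
  shows "sgrad (\<lambda>y. f y + g y) x = sgrad f x + sgrad g x"
  using has_derivative_add[OF assms[THEN sgrad_has_derivative]]
  by (intro sgrad_unique) (simp add: inner_add_left)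

lemma sgrad_diff:
  fixes f g :: "'a::euclidean_space \<Rightarrow> real"
  assumes "f differentiable (at x)" "g differentiable (at x)"
  shows "sgrad (\<lambda>y. f y - g y) x = sgrad f x - sgrad g x"
  using has_derivative_diff[OF assms[THEN sgrad_has_derivative]]
  by (intro sgrad_unique) (simp add: inner_diff_left)

lemma sgrad_cmult:
  fixes f :: "'a::euclidean_space \<Rightarrow> real"
  assumes "f differentiable (at x)"
  shows "sgrad (\<lambda>y. r * f y) x = r *\<^sub>R sgrad f x"
  using has_derivative_mult_right[OF sgrad_has_derivative[OF assms], of r]
  by (intro sgrad_unique) simp

lemma sgrad_const [simp]: "sgrad (\<lambda>y. r) x = 0"
  by (rule sgrad_unique) simp

lemma sgrad_sum:
  fixes f :: "'i \<Rightarrow> 'a::euclidean_space \<Rightarrow> real"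
  assumes "\<And>i. i \<in> I \<Longrightarrow> f i differentiable (at x)"
  shows "sgrad (\<lambda>y. \<Sum>i\<in>I. f i y) x = (\<Sum>i\<in>I. sgrad (f i) x)"
proof (rule sgrad_unique)
  have "((\<lambda>y. \<Sum>i\<in>I. f i y) has_derivative (\<lambda>h. \<Sum>i\<in>I. sgrad (f i) x \<bullet> h)) (at x)"
    using assms by (intro has_derivative_sum sgrad_has_derivative)
  then show "((\<lambda>y. \<Sum>i\<in>I. f i y) has_derivative (\<lambda>h. (\<Sum>i\<in>I. sgrad (f i) x) \<bullet> h)) (at x)"
    by (simp add: inner_sum_left)
qed

lemma gradx_spoly:
  fixes e :: "nat \<Rightarrow> 'a::euclidean_space \<Rightarrow> real"
  assumes "\<And>j. j < m \<Longrightarrow> e j differentiable (at x)"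
  shows "gradx (\<lambda>y t. spoly a b m (\<lambda>j. e j y) t) x t = spoly a b m (\<lambda>j. sgrad (e j) x) t"
  using assms unfolding gradx_def spoly_def tpoly_def real_scaleR_def
  by (subst sgrad_sum) (auto intro!: sum.cong sgrad_cmult)

lemma sgrad_sdcoef:
  assumes "c (Suc j) differentiable (at x)"
  shows "sgrad (\<lambda>y. sdcoef a b (\<lambda>i. c i y) j) x = sdcoef a b (\<lambda>i. sgrad (c i) x) j"
  using sgrad_cmult[OF assms, of "1 / (b - a) * real (Suc j)"]
  by (simp add: sdcoef_def dcoef_def mult.assoc)

lemma sgrad_tcoef:
  assumes "\<And>i. i < q \<Longrightarrow> d i differentiable (at x)" "j < q"
  shows "sgrad (\<lambda>y. tcoef q (\<lambda>i. d i y) j) x = tcoef q (\<lambda>i. sgrad (d i) x) j"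
  using assms
  by (cases "j = 0") (auto simp: tcoef_def sgrad_add sgrad_diff sgrad_cmult)

text \<open>The domain without the mesh skeleton; finite element functions are differentiable there.\<close>
definition reg :: "'a::euclidean_space set set \<Rightarrow> 'a set \<Rightarrow> 'a set" where
  "reg M \<Omega> = \<Omega> \<inter> (\<Union>K\<in>M. interior K)"

lemma conforming_mesh_elements:
  assumes "conforming_mesh M \<Omega>" "K \<in> M"
  shows "convex K" "compact K"
  using assms by (auto simp: conforming_mesh_def intro: convex_simplex compact_simplex)

lemma reg_subset: "reg M \<Omega> \<subseteq> \<Omega>" by (auto simp: reg_def)

lemma open_reg: "open \<Omega> \<Longrightarrow> open (reg M \<Omega>)" by (auto simp: reg_def)

text \<open>The elements cover the closure of the domain, so a point outside all interiors lies on
  the frontier of some element. Elements are convex, and frontiers of convex sets are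
  negligible.\<close>

lemma null_sets_reg:
  assumes M: "conforming_mesh M \<Omega>"
  shows "\<Omega> - reg M \<Omega> \<in> null_sets lebesgue"
proof -
  have "negligible (\<Union>K\<in>M. frontier K)"
    using M conforming_mesh_elements[OF M]
    by (intro negligible_Union) (auto simp: conforming_mesh_def intro: negligible_convex_frontier)
  moreover have "\<Omega> - reg M \<Omega> \<subseteq> (\<Union>K\<in>M. frontier K)"
  proof
    fix x assume x: "x \<in> \<Omega> - reg M \<Omega>"
    then have "x \<in> closure \<Omega>" using closure_subset by auto
    then obtain K where "K \<in> M" "x \<in> K" using M unfolding conforming_mesh_def by blast
    moreover have "x \<notin> interior K" using x \<open>K \<in> M\<close> by (auto simp: reg_def)
    ultimately show "x \<in> (\<Union>K\<in>M. frontier K)"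
      using closure_subset by (auto simp: frontier_def)
  qed
  ultimately show ?thesis using negligible_iff_null_sets negligible_subset by blast
qed

lemma Vh_bcont:
  assumes "Vh M \<Omega> p v" "bounded \<Omega>"
  shows "bcont \<Omega> v"
proof -
  have "compact (v ` closure \<Omega>)"
    using assms by (intro compact_continuous_image) (auto simp: Vh_def intro: continuous_on_subset)
  then have "bounded (v ` closure \<Omega>)" by (rule compact_imp_bounded)
  then show ?thesis using assms closure_subset[of \<Omega>]
    by (auto simp: bcont_def Vh_def bounded_iff intro: continuous_on_subset)
qed

lemma Vh_piece_gradient:
  assumes "Vh M \<Omega> p v" "K \<in> M"
  shows "\<exists>G. continuous_on UNIV G \<and> (\<forall>x\<in>interior K. (v has_derivative (\<lambda>h. G x \<bullet> h)) (at x))"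
proof -
  obtain P where P: "mpoly_le p P" "\<And>x. x \<in> K \<Longrightarrow> v x = P x" using assms unfolding Vh_def by blast
  obtain G where G: "continuous_on UNIV G" "\<And>x. (P has_derivative (\<lambda>h. G x \<bullet> h)) (at x)"
    using mpoly_le_gradient[OF P(1)] by blast
  have "(v has_derivative (\<lambda>h. G x \<bullet> h)) (at x)" if "x \<in> interior K" for x
    using G(2) that by (rule has_derivative_transform_within_open[OF _ open_interior])
      (use P(2) interior_subset in force)
  then show ?thesis using G(1) by blast
qed

lemma Vh_differentiable:
  assumes "Vh M \<Omega> p v" "x \<in> reg M \<Omega>"
  shows "v differentiable (at x)"
proof -
  obtain K where "K \<in> M" "x \<in> interior K" using assms by (auto simp: reg_def)
  then show ?thesis using Vh_piece_gradient[OF assms(1), of K] by (auto simp: differentiable_def)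
qed

text \<open>In the interior of an element \<open>sgrad v\<close> is a polynomial gradient,
  continuous on the whole space and hence bounded on the compact element. Continuity glues over the
  open interiors, boundedness over the finitely many elements.\<close>

lemma bcont_sgrad:
  assumes M: "conforming_mesh M \<Omega>" and v: "Vh M \<Omega> p v"
  shows "bcont (reg M \<Omega>) (sgrad v)"
proof -
  obtain G where G: "\<And>K. K \<in> M \<Longrightarrow> continuous_on UNIV (G K)"
    and "\<And>K x. K \<in> M \<Longrightarrow> x \<in> interior K \<Longrightarrow> (v has_derivative (\<lambda>h. G K x \<bullet> h)) (at x)"
    using Vh_piece_gradient[OF v] by metis
  then have GK: "\<And>K x. K \<in> M \<Longrightarrow> x \<in> interior K \<Longrightarrow> sgrad v x = G K x"
    by (blast intro: sgrad_unique)
  have "continuous_on (\<Union>K\<in>M. interior K) (sgrad v)"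
  proof (rule continuous_on_open_UN)
    fix K assume K: "K \<in> M"
    have "continuous_on (interior K) (G K)" using G[OF K] by (rule continuous_on_subset) simp
    then show "continuous_on (interior K) (sgrad v)" using GK[OF K] by (simp cong: continuous_on_cong)
  qed simp
  moreover have "\<exists>B. \<forall>x\<in>K. norm (G K x) \<le> B" if "K \<in> M" for K
  proof -
    have "compact (G K ` K)" using conforming_mesh_elements(2)[OF M that] G[OF that]
      by (intro compact_continuous_image) (auto intro: continuous_on_subset)
    then have "bounded (G K ` K)" by (rule compact_imp_bounded)
    then show ?thesis by (auto simp: bounded_iff)
  qed
  then obtain B where B: "\<And>K x. K \<in> M \<Longrightarrow> x \<in> K \<Longrightarrow> norm (G K x) \<le> B K" by metis
  have fin: "finite M" using M by (simp add: conforming_mesh_def)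
  have "norm (sgrad v x) \<le> (\<Sum>K\<in>M. \<bar>B K\<bar>)" if x: "x \<in> reg M \<Omega>" for x
  proof -
    obtain K where K: "K \<in> M" "x \<in> interior K" using x by (auto simp: reg_def)
    then have "norm (sgrad v x) \<le> B K" using GK[OF K] B[of K x] interior_subset[of K] by auto
    also have "\<dots> \<le> \<bar>B K\<bar>" by simp
    also have "\<dots> \<le> (\<Sum>K\<in>M. \<bar>B K\<bar>)" using fin K by (intro member_le_sum) auto
    finally show ?thesis .
  qed
  ultimately show ?thesis unfolding bcont_def
    by (auto simp: reg_def intro: continuous_on_subset)
qed

section \<open>Linear combinations in space and polynomials in time\<close>

lemma Vh_zero: "Vh M \<Omega> p (\<lambda>x. 0)"
  by (auto simp: Vh_def intro!: exI[of _ "\<lambda>x. 0"] mpoly_le.const)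

lemma Vh_add:
  assumes "Vh M \<Omega> p f" "Vh M \<Omega> p g"
  shows "Vh M \<Omega> p (\<lambda>x. f x + g x)"
  unfolding Vh_def
proof (intro conjI ballI)
  show "continuous_on UNIV (\<lambda>x. f x + g x)" using assms by (auto simp: Vh_def intro: continuous_intros)
  show "\<forall>x. x \<notin> \<Omega> \<longrightarrow> f x + g x = 0" using assms by (auto simp: Vh_def)
  fix K assume "K \<in> M"
  then obtain P Q where "mpoly_le p P" "\<forall>x\<in>K. f x = P x" "mpoly_le p Q" "\<forall>x\<in>K. g x = Q x"
    using assms unfolding Vh_def by metis
  then show "\<exists>P. mpoly_le p P \<and> (\<forall>x\<in>K. f x + g x = P x)"
    by (auto intro!: exI[of _ "\<lambda>x. P x + Q x"] mpoly_le.add)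
qed

lemma Vh_cmult:
  assumes "Vh M \<Omega> p f"
  shows "Vh M \<Omega> p (\<lambda>x. r * f x)"
  unfolding Vh_def
proof (intro conjI ballI)
  show "continuous_on UNIV (\<lambda>x. r * f x)" using assms by (auto simp: Vh_def intro: continuous_intros)
  show "\<forall>x. x \<notin> \<Omega> \<longrightarrow> r * f x = 0" using assms by (auto simp: Vh_def)
  fix K assume "K \<in> M"
  then obtain P where "mpoly_le p P" "\<forall>x\<in>K. f x = P x"
    using assms unfolding Vh_def by metis
  \<comment> \<open>A constant is given degree 0, so the product rule for degrees returns
    \<open>0 + p\<close>.\<close>
  then show "\<exists>P. mpoly_le p P \<and> (\<forall>x\<in>K. r * f x = P x)"
    using mpoly_le.mult[OF mpoly_le.const[of 0 r], of p P] by auto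
qed

lemma Vh_diff: "Vh M \<Omega> p f \<Longrightarrow> Vh M \<Omega> p g \<Longrightarrow> Vh M \<Omega> p (\<lambda>x. f x - g x)"
  using Vh_add[OF _ Vh_cmult[of M \<Omega> p g "-1"], of f] by simp

lemma Vh_sum:
  assumes "\<And>i. i \<in> I \<Longrightarrow> Vh M \<Omega> p (f i)"
  shows "Vh M \<Omega> p (\<lambda>x. \<Sum>i\<in>I. f i x)"
  using assms
proof (induction I rule: infinite_finite_induct)
  case (insert i I)
  then show ?case by (simp add: Vh_add)
qed (simp_all add: Vh_zero)

lemma Vh_sdcoef: "Vh M \<Omega> p (c (Suc j)) \<Longrightarrow> Vh M \<Omega> p (\<lambda>y. sdcoef a b (\<lambda>i. c i y) j)"
  using Vh_cmult[of M \<Omega> p "c (Suc j)" "1 / (b - a) * real (Suc j)"]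
  by (simp add: sdcoef_def dcoef_def mult.assoc)

lemma Vh_tcoef:
  assumes "\<And>i. i < q \<Longrightarrow> Vh M \<Omega> p (d i)" "j < q"
  shows "Vh M \<Omega> p (\<lambda>y. tcoef q (\<lambda>i. d i y) j)"
  using assms by (cases "j = 0") (auto simp: tcoef_def intro!: Vh_add Vh_diff Vh_cmult)

lemma Ppiece_mono:
  assumes "Ppiece M \<Omega> p m F" "m \<le> q"
  shows "Ppiece M \<Omega> p q F"
proof -
  obtain c where c: "\<forall>j\<le>m. Vh M \<Omega> p (c j)" "\<And>x t. F x t = (\<Sum>j\<le>m. t ^ j * c j x)"
    using assms(1) unfolding Ppiece_def by blast
  define c' where "c' j = (if j \<le> m then c j else (\<lambda>x. 0))" for j
  have "F x t = (\<Sum>j\<le>q. t ^ j * c' j x)" for x t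
    unfolding c(2) using assms(2) by (intro sum.mono_neutral_cong_left) (auto simp: c'_def)
  moreover have "\<forall>j\<le>q. Vh M \<Omega> p (c' j)" using c(1) by (auto simp: c'_def Vh_zero)
  ultimately show ?thesis unfolding Ppiece_def by blast
qed

lemma Ppiece_sum:
  assumes "\<And>i. i \<in> I \<Longrightarrow> Ppiece M \<Omega> p q (F i)"
  shows "Ppiece M \<Omega> p q (\<lambda>x t. \<Sum>i\<in>I. F i x t)"
proof -
  have "\<forall>i\<in>I. \<exists>c. (\<forall>j\<le>q. Vh M \<Omega> p (c j)) \<and> (\<forall>x t. F i x t = (\<Sum>j\<le>q. t ^ j * c j x))"
    using assms unfolding Ppiece_def by blast
  then obtain c where c: "\<And>i j. i \<in> I \<Longrightarrow> j \<le> q \<Longrightarrow> Vh M \<Omega> p (c i j)"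
    "\<And>i x t. i \<in> I \<Longrightarrow> F i x t = (\<Sum>j\<le>q. t ^ j * c i j x)" by metis
  have "(\<Sum>i\<in>I. F i x t) = (\<Sum>j\<le>q. t ^ j * (\<Sum>i\<in>I. c i j x))" for x t
    by (simp add: c(2) sum_distrib_left) (rule sum.swap)
  then show ?thesis unfolding Ppiece_def
    using c(1) by (intro exI[of _ "\<lambda>j x. \<Sum>i\<in>I. c i j x"]) (auto intro: Vh_sum)
qed

lemma Ppiece_affine_mult:
  assumes "Ppiece M \<Omega> p q F"
  shows "Ppiece M \<Omega> p (Suc q) (\<lambda>x t. (\<alpha> + \<beta> * t) * F x t)"
proof -
  obtain c where c: "\<forall>j\<le>q. Vh M \<Omega> p (c j)" "\<And>x t. F x t = (\<Sum>j\<le>q. t ^ j * c j x)"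
    using assms(1) unfolding Ppiece_def by blast
  define c' where "c' j x = (if j \<le> q then \<alpha> * c j x else 0) + (if j = 0 then 0 else \<beta> * c (j - 1) x)" for j x
  have "(\<alpha> + \<beta> * t) * F x t = (\<Sum>j\<le>Suc q. t ^ j * c' j x)" for x t
  proof -
    have "(\<Sum>j\<le>Suc q. t ^ j * c' j x) = (\<Sum>j\<le>Suc q. t ^ j * (if j \<le> q then \<alpha> * c j x else 0))
        + (\<Sum>j\<le>Suc q. t ^ j * (if j = 0 then 0 else \<beta> * c (j - 1) x))"
      by (simp only: c'_def distrib_left sum.distrib)
    also have "(\<Sum>j\<le>Suc q. t ^ j * (if j \<le> q then \<alpha> * c j x else 0)) = \<alpha> * F x t"
      by (simp add: c(2) sum_distrib_left mult_ac)
    also have "(\<Sum>j\<le>Suc q. t ^ j * (if j = 0 then 0 else \<beta> * c (j - 1) x)) = \<beta> * t * F x t"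
      by (subst sum.atMost_Suc_shift) (simp add: c(2) sum_distrib_left mult_ac)
    finally show ?thesis by (simp add: algebra_simps)
  qed
  moreover have "\<forall>j\<le>Suc q. Vh M \<Omega> p (c' j)"
  proof (intro allI impI)
    fix j assume j: "j \<le> Suc q"
    have "Vh M \<Omega> p (\<lambda>x. if j \<le> q then \<alpha> * c j x else 0)" using c(1) by (cases "j \<le> q") (auto simp: Vh_cmult Vh_zero)
    moreover have "Vh M \<Omega> p (\<lambda>x. if j = 0 then 0 else \<beta> * c (j - 1) x)"
      using c(1) j by (cases "j = 0") (auto simp: Vh_cmult Vh_zero)
    ultimately show "Vh M \<Omega> p (c' j)" unfolding c'_def[abs_def] by (rule Vh_add)
  qed
  ultimately show ?thesis unfolding Ppiece_def by blast
qed

text \<open>An affine change of time variable keeps the degree. It is used in both directions: to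
  recognize functions built on the reference interval as elements of the space, and to rewrite given
  pieces in reference coordinates.\<close>

lemma Ppiece_affine_poly:
  assumes "\<And>j. j \<le> q \<Longrightarrow> Vh M \<Omega> p (c j)"
  shows "Ppiece M \<Omega> p q (\<lambda>x t. \<Sum>j\<le>q. (\<alpha> + \<beta> * t) ^ j * c j x)"
proof (rule Ppiece_sum)
  have *: "Ppiece M \<Omega> p j (\<lambda>x t. (\<alpha> + \<beta> * t) ^ j * v x)" if v: "Vh M \<Omega> p v" for j v
  proof (induction j)
    case 0
    show ?case unfolding Ppiece_def using v by (intro exI[of _ "\<lambda>_. v"]) auto
  next
    case (Suc j)
    from Ppiece_affine_mult[OF this] show ?case by (simp add: mult.assoc)
  qed
  fix j assume "j \<in> {..q}"
  then show "Ppiece M \<Omega> p q (\<lambda>x t. (\<alpha> + \<beta> * t) ^ j * c j x)"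
    using *[OF assms, of j j] by (auto intro: Ppiece_mono)
qed

lemma Ppiece_spoly:
  assumes "a < b" "\<And>j. j \<le> q \<Longrightarrow> Vh M \<Omega> p (c j)"
  shows "Ppiece M \<Omega> p q (\<lambda>x t. spoly a b (Suc q) (\<lambda>j. c j x) t)"
proof -
  have "(t - a) / (b - a) = - a / (b - a) + (1 / (b - a)) * t" for t
    by (simp add: diff_divide_distrib)
  then show ?thesis
    using Ppiece_affine_poly[where c=c, OF assms(2), where q=q and \<alpha>="- a / (b - a)" and \<beta>="1 / (b - a)"]
    by (simp only: spoly_def tpoly_def lessThan_Suc_atMost real_scaleR_def)
qed

lemma Ppiece_obtain_spoly:
  assumes "a < b" "Ppiece M \<Omega> p q U"
  obtains c where "\<And>j. j \<le> q \<Longrightarrow> Vh M \<Omega> p (c j)" "U = (\<lambda>x t. spoly a b (Suc q) (\<lambda>j. c j x) t)"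
proof -
  obtain cf where cf: "\<And>j. j \<le> q \<Longrightarrow> Vh M \<Omega> p (cf j)" "\<And>x t. U x t = (\<Sum>j\<le>q. t ^ j * cf j x)"
    using assms(2) unfolding Ppiece_def by blast
  obtain c where c: "\<And>j. j \<le> q \<Longrightarrow> Vh M \<Omega> p (c j)"
    "\<And>x s. (\<Sum>j\<le>q. (a + (b - a) * s) ^ j * cf j x) = (\<Sum>j\<le>q. s ^ j * c j x)"
    using Ppiece_affine_poly[where c=cf, OF cf(1), where q=q and \<alpha>=a and \<beta>="b - a"] unfolding Ppiece_def by blast
  have "U x t = spoly a b (Suc q) (\<lambda>j. c j x) t" for x t
  proof -
    have "a + (b - a) * ((t - a) / (b - a)) = t" using assms(1) by simp
    then show ?thesis
      using c(2)[of "(t - a) / (b - a)" x] by (simp add: cf(2) spoly_def tpoly_def lessThan_Suc_atMost)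
  qed
  then show ?thesis using c(1) that by blast
qed

lemma dtp_spoly:
  assumes "a < b"
  shows "dtp (\<lambda>x t. spoly a b (Suc q) (\<lambda>j. c j x) t) x t = spoly a b q (sdcoef a b (\<lambda>j. c j x)) t"
  using spoly_has_vector_derivative[OF assms, of q "\<lambda>j. c j x" t UNIV]
  unfolding dtp_def has_real_derivative_iff_has_vector_derivative[symmetric]
  by (intro DERIV_imp_deriv) simp

section \<open>Estimates on one slab\<close>

lemma bcont_sdcoef:
  "bcont S (c (Suc j)) \<Longrightarrow> bcont S (\<lambda>x. sdcoef a b (\<lambda>i. c i x) j)"
  unfolding sdcoef_def dcoef_def by (intro bcont_scaleR bcont_const)

lemma bcont_tcoef:
  assumes "\<And>i. i < q \<Longrightarrow> bcont S (d i)" "j < q"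
  shows "bcont S (\<lambda>x. tcoef q (\<lambda>i. d i x) j)"
  using assms by (cases "j = 0") (auto simp: tcoef_def intro!: bcont_intros)

lemma Oint_nonneg: "(\<And>x. x \<in> S \<Longrightarrow> 0 \<le> F x) \<Longrightarrow> 0 \<le> Oint S F"
  unfolding Oint_def by (rule set_lebesgue_integral_nonneg)

lemma Qint_nonneg: "(\<And>x t. x \<in> S \<Longrightarrow> 0 \<le> F x t) \<Longrightarrow> 0 \<le> Qint S a b F"
  unfolding Qint_def by (rule set_lebesgue_integral_nonneg) auto

text \<open>The type argument records the value space: \<open>real\<close> for the time derivative
  of \<open>u\<close>, the spatial type for gradients. A single \<open>K\<close> can then be
  required for both.\<close>

definition sup_const :: "nat \<Rightarrow> real \<Rightarrow> 'b::euclidean_space itself \<Rightarrow> bool" where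
  "sup_const q K (_ :: 'b itself) \<longleftrightarrow> (\<forall>a b t. \<forall>d::nat \<Rightarrow> 'b. a < b \<longrightarrow> t \<in> {a..b} \<longrightarrow>
      (norm (spoly a b q d t))\<^sup>2 \<le> K * meansq a b (spoly a b q d) \<and>
      (norm (spoly a b (q - 1) (sdcoef a b d) t))\<^sup>2 \<le> K * meansq a b (spoly a b q d) / (b - a)\<^sup>2 \<and>
      (norm (spoly a b q (tcoef q d) t))\<^sup>2 \<le> K * meansq a b (spoly a b q d) \<and>
      (norm (spoly a b (q - 1) (sdcoef a b (tcoef q d)) t))\<^sup>2 \<le> K * meansq a b (spoly a b q d) / (b - a)\<^sup>2)"

definition value_const :: "nat \<Rightarrow> real \<Rightarrow> 'b::euclidean_space itself \<Rightarrow> bool" where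
  "value_const q K (_ :: 'b itself) \<longleftrightarrow> (\<forall>a b t. \<forall>c::nat \<Rightarrow> 'b. a < b \<longrightarrow> t \<in> {a..b} \<longrightarrow>
    (norm (spoly a b (Suc q) c t))\<^sup>2 \<le> K * (integral {a..b} (\<lambda>t. spoly a b (Suc q) c t \<bullet> spoly a b q (tcoef q (sdcoef a b c)) t)
       + (norm (spoly a b (Suc q) c a))\<^sup>2))"

lemma meansq_nonneg:
  fixes v :: "real \<Rightarrow> 'b::real_normed_vector"
  assumes "a < b" shows "meansq a b v \<ge> 0"
proof (cases "(\<lambda>t. (norm (v t))\<^sup>2) integrable_on {a..b}")
  case True
  then show ?thesis using assms unfolding meansq_def by (intro mult_nonneg_nonneg integral_nonneg) auto
qed (simp add: meansq_def not_integrable_integral)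

text \<open>Each property is monotone in \<open>K\<close>, so the sum of the three separate
  constants serves all of them.\<close>

lemma ex_slab_const:
  assumes "q \<ge> 1"
  shows "\<exists>K\<ge>1. sup_const q K TYPE(real) \<and> sup_const q K TYPE('b::euclidean_space) \<and> value_const q K TYPE('b)"
proof -
  obtain K1 where K1: "K1 \<ge> 1" "sup_const q K1 TYPE(real)"
    using slab_sup_bound[OF assms, where 'b=real] unfolding sup_const_def by blast
  obtain K2 where K2: "K2 \<ge> 1" "sup_const q K2 TYPE('b)"
    using slab_sup_bound[OF assms, where 'b='b] unfolding sup_const_def by blast
  obtain K3 where K3: "K3 > 0" "value_const q K3 TYPE('b)"
    using slab_value_bound[OF assms, where 'b='b] unfolding value_const_def by blast
  have mono1: "sup_const q K' TYPE('d::euclidean_space)" if "sup_const q K TYPE('d)" "K \<le> K'" for K K'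
    unfolding sup_const_def
  proof (intro allI impI)
    fix a b t :: real and d :: "nat \<Rightarrow> 'd" assume ab: "a < b" "t \<in> {a..b}"
    have "K * meansq a b (spoly a b q d) \<le> K' * meansq a b (spoly a b q d)"
      using that meansq_nonneg[OF ab(1)] by (intro mult_right_mono) auto
    moreover from this have "K * meansq a b (spoly a b q d) / (b - a)\<^sup>2 \<le> K' * meansq a b (spoly a b q d) / (b - a)\<^sup>2"
      by (rule divide_right_mono) simp
    ultimately show "(norm (spoly a b q d t))\<^sup>2 \<le> K' * meansq a b (spoly a b q d) \<and>
      (norm (spoly a b (q - 1) (sdcoef a b d) t))\<^sup>2 \<le> K' * meansq a b (spoly a b q d) / (b - a)\<^sup>2 \<and>
      (norm (spoly a b q (tcoef q d) t))\<^sup>2 \<le> K' * meansq a b (spoly a b q d) \<and>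
      (norm (spoly a b (q - 1) (sdcoef a b (tcoef q d)) t))\<^sup>2 \<le> K' * meansq a b (spoly a b q d) / (b - a)\<^sup>2"
      using that(1)[unfolded sup_const_def, rule_format, OF ab, of d] by linarith
  qed
  have mono2: "value_const q K' TYPE('b)" if v: "value_const q K TYPE('b)" "0 < K" "K \<le> K'" for K K'
    unfolding value_const_def
  proof (intro allI impI)
    fix a b t :: real and c :: "nat \<Rightarrow> 'b" assume ab: "a < b" "t \<in> {a..b}"
    let ?Z = "integral {a..b} (\<lambda>t. spoly a b (Suc q) c t \<bullet> spoly a b q (tcoef q (sdcoef a b c)) t)
       + (norm (spoly a b (Suc q) c a))\<^sup>2"
    have le: "(norm (spoly a b (Suc q) c t))\<^sup>2 \<le> K * ?Z"
      using v(1)[unfolded value_const_def] ab by blast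
    \<comment> \<open>Enlarging the constant requires a nonnegative bracket. The estimate itself
      provides this, although the pairing inside the bracket has no sign.\<close>
    then have "0 \<le> K * ?Z" using zero_le_power2 order_trans by blast
    then have "0 \<le> ?Z" using v(2) by (simp add: zero_le_mult_iff)
    then have "K * ?Z \<le> K' * ?Z" using v(3) by (intro mult_right_mono)
    with le show "(norm (spoly a b (Suc q) c t))\<^sup>2 \<le> K' * ?Z" by linarith
  qed
  show ?thesis
    using K1 K2 K3 by (intro exI[of _ "K1 + K2 + K3"] conjI mono1[OF K1(2)] mono1[OF K2(2)] mono2[OF K3(2)]) auto
qed

text \<open>One slab \<open>\<Omega> \<times> (a, b)\<close>: \<open>cu\<close> and \<open>ca\<close> are the coefficients of \<open>u\<close> and \<open>\<alpha>\<close> in powers of \<open>(t - a) / (b - a)\<close>.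
  Below, \<open>v = \<partial>\<^sub>tu\<close>, \<open>w\<close> is the projected test function, \<open>dv\<close>, \<open>dw\<close>, \<open>\<alpha>'\<close> are time derivatives, and
  \<open>Gu\<close>, \<open>Gv\<close>, \<open>Gw\<close> are the spatial gradients off the mesh skeleton.\<close>
locale slab =
  fixes M :: "'a::euclidean_space set set" and \<Omega> :: "'a set" and p q :: nat and K a b :: real
    and cu ca :: "nat \<Rightarrow> 'a \<Rightarrow> real" and k \<rho>0 \<rho>1 :: real
  assumes q: "q \<ge> 1" and ab: "a < b" and dom: "open \<Omega>" "bounded \<Omega>" "\<Omega> \<noteq> {}"
    and mesh: "conforming_mesh M \<Omega>"
    and cu: "\<And>j. j \<le> q \<Longrightarrow> Vh M \<Omega> p (cu j)" and ca: "\<And>j. j \<le> q \<Longrightarrow> Vh M \<Omega> p (ca j)"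
    and K: "K \<ge> 1" "sup_const q K TYPE(real)" "sup_const q K TYPE('a)" "value_const q K TYPE('a)"
    and \<rho>0: "\<rho>0 > 0"
    and \<rho>_bounds: "\<And>x t. x \<in> \<Omega> \<Longrightarrow> t \<in> {a..b} \<Longrightarrow> \<rho>0 \<le> 1 + k * spoly a b (Suc q) (\<lambda>j. ca j x) t
      \<and> 1 + k * spoly a b (Suc q) (\<lambda>j. ca j x) t \<le> \<rho>1"
begin

definition "\<Omega>r = reg M \<Omega>"
definition "u x t = spoly a b (Suc q) (\<lambda>j. cu j x) t"
definition "v x t = spoly a b q (sdcoef a b (\<lambda>j. cu j x)) t"
definition "dv x t = spoly a b (q - 1) (sdcoef a b (sdcoef a b (\<lambda>j. cu j x))) t"
definition "w x t = spoly a b q (tcoef q (sdcoef a b (\<lambda>j. cu j x))) t"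
definition "dw x t = spoly a b (q - 1) (sdcoef a b (tcoef q (sdcoef a b (\<lambda>j. cu j x)))) t"
definition "Gu x t = spoly a b (Suc q) (\<lambda>j. sgrad (cu j) x) t"
definition "Gv x t = spoly a b q (sdcoef a b (\<lambda>j. sgrad (cu j) x)) t"
definition "Gw x t = spoly a b q (tcoef q (sdcoef a b (\<lambda>j. sgrad (cu j) x))) t"
definition "\<rho> x t = 1 + k * spoly a b (Suc q) (\<lambda>j. ca j x) t"
definition "\<alpha>' x t = spoly a b q (sdcoef a b (\<lambda>j. ca j x)) t"
definition "R t = (SUP x\<in>\<Omega>. \<bar>\<alpha>' x t\<bar>)"
definition "r = integral {a..b} R"
definition "S = (1 / (b - a)) * Qint \<Omega>r a b (\<lambda>x t. (v x t)\<^sup>2)"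
definition "D = Qint \<Omega>r a b (\<lambda>x t. (norm (Gv x t))\<^sup>2)"
definition "H t = Oint \<Omega>r (\<lambda>x. (norm (Gu x t))\<^sup>2)"

lemma \<Omega>r: "open \<Omega>r" "bounded \<Omega>r" "\<Omega>r \<subseteq> \<Omega>" "\<Omega> - \<Omega>r \<in> null_sets lebesgue"
  using dom open_reg[of \<Omega> M] reg_subset[of M \<Omega>] null_sets_reg[OF mesh] bounded_subset[of \<Omega> "reg M \<Omega>"]
  by (auto simp: \<Omega>r_def)

lemma \<Omega>r_sets: "\<Omega>r \<in> sets borel" "\<Omega>r \<in> sets lborel" using \<Omega>r(1) by auto

lemma bcont_cu: "j \<le> q \<Longrightarrow> bcont \<Omega>r (cu j)"
  by (rule bcont_subset[OF Vh_bcont[OF cu dom(2)] \<Omega>r(3)])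
lemma bcont_Gcu: "j \<le> q \<Longrightarrow> bcont \<Omega>r (\<lambda>x. sgrad (cu j) x)"
  unfolding \<Omega>r_def by (rule bcont_sgrad[OF mesh cu])
lemma bcont_ca: "j \<le> q \<Longrightarrow> bcont \<Omega> (ca j)"
  by (rule Vh_bcont[OF ca dom(2)])

lemma bcont_stp2:
  assumes "\<And>j. j < m \<Longrightarrow> bcont S' (\<lambda>x. c x j)"
  shows "bcont (S' \<times> {a..b}) (\<lambda>z. spoly a b m (c (fst z)) (snd z))"
  using bcont_spoly[where c = "\<lambda>j x. c x j", OF assms] by simp

lemma bcont_fields:
  "bcont (\<Omega>r \<times> {a..b}) (\<lambda>z. u (fst z) (snd z))" "bcont (\<Omega>r \<times> {a..b}) (\<lambda>z. v (fst z) (snd z))"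
  "bcont (\<Omega>r \<times> {a..b}) (\<lambda>z. dv (fst z) (snd z))" "bcont (\<Omega>r \<times> {a..b}) (\<lambda>z. w (fst z) (snd z))"
  "bcont (\<Omega>r \<times> {a..b}) (\<lambda>z. dw (fst z) (snd z))" "bcont (\<Omega>r \<times> {a..b}) (\<lambda>z. Gu (fst z) (snd z))"
  "bcont (\<Omega>r \<times> {a..b}) (\<lambda>z. Gv (fst z) (snd z))" "bcont (\<Omega>r \<times> {a..b}) (\<lambda>z. Gw (fst z) (snd z))"
  "bcont (\<Omega>r \<times> {a..b}) (\<lambda>z. \<rho> (fst z) (snd z))" "bcont (\<Omega>r \<times> {a..b}) (\<lambda>z. \<alpha>' (fst z) (snd z))"
proof -
  have d: "bcont \<Omega>r (\<lambda>x. sdcoef a b (\<lambda>i. cu i x) j)" if "j < q" for j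
    using that by (intro bcont_sdcoef bcont_cu) auto
  have gd: "bcont \<Omega>r (\<lambda>x. sdcoef a b (\<lambda>i. sgrad (cu i) x) j)" if "j < q" for j
    using bcont_sdcoef[where c = "\<lambda>i x. sgrad (cu i) x", OF bcont_Gcu] that by simp
  have e: "bcont \<Omega>r (\<lambda>x. tcoef q (sdcoef a b (\<lambda>i. cu i x)) j)" if "j < q" for j
    using bcont_tcoef[where d = "\<lambda>i x. sdcoef a b (\<lambda>i. cu i x) i", OF d that] by simp
  have ge: "bcont \<Omega>r (\<lambda>x. tcoef q (sdcoef a b (\<lambda>i. sgrad (cu i) x)) j)" if "j < q" for j
    using bcont_tcoef[where d = "\<lambda>i x. sdcoef a b (\<lambda>i. sgrad (cu i) x) i", OF gd that] by simp
  have dd: "bcont \<Omega>r (\<lambda>x. sdcoef a b (sdcoef a b (\<lambda>i. cu i x)) j)" if "j < q - 1" for j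
    using bcont_sdcoef[where c = "\<lambda>i x. sdcoef a b (\<lambda>i. cu i x) i" and j = j, OF d] that by simp
  have de: "bcont \<Omega>r (\<lambda>x. sdcoef a b (tcoef q (sdcoef a b (\<lambda>i. cu i x))) j)" if "j < q - 1" for j
    using bcont_sdcoef[where c = "\<lambda>i x. tcoef q (sdcoef a b (\<lambda>i. cu i x)) i" and j = j, OF e] that by simp
  have ra: "bcont \<Omega>r (ca j)" if "j \<le> q" for j using bcont_subset[OF bcont_ca[OF that] \<Omega>r(3)] .
  have rd: "bcont \<Omega>r (\<lambda>x. sdcoef a b (\<lambda>i. ca i x) j)" if "j < q" for j
    using that by (intro bcont_sdcoef ra) auto
  show "bcont (\<Omega>r \<times> {a..b}) (\<lambda>z. u (fst z) (snd z))" "bcont (\<Omega>r \<times> {a..b}) (\<lambda>z. v (fst z) (snd z))"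
    "bcont (\<Omega>r \<times> {a..b}) (\<lambda>z. dv (fst z) (snd z))" "bcont (\<Omega>r \<times> {a..b}) (\<lambda>z. w (fst z) (snd z))"
    "bcont (\<Omega>r \<times> {a..b}) (\<lambda>z. dw (fst z) (snd z))" "bcont (\<Omega>r \<times> {a..b}) (\<lambda>z. Gu (fst z) (snd z))"
    "bcont (\<Omega>r \<times> {a..b}) (\<lambda>z. Gv (fst z) (snd z))" "bcont (\<Omega>r \<times> {a..b}) (\<lambda>z. Gw (fst z) (snd z))"
    unfolding u_def v_def dv_def w_def dw_def Gu_def Gv_def Gw_def
    by (rule bcont_stp2, simp add: bcont_cu bcont_Gcu d gd e ge dd de)+
  show "bcont (\<Omega>r \<times> {a..b}) (\<lambda>z. \<rho> (fst z) (snd z))"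
    unfolding \<rho>_def by (intro bcont_add bcont_mult bcont_const bcont_stp2) (simp add: ra)
  show "bcont (\<Omega>r \<times> {a..b}) (\<lambda>z. \<alpha>' (fst z) (snd z))"
    unfolding \<alpha>'_def by (rule bcont_stp2) (simp add: rd)
qed

lemma bcont_slices:
  assumes "t \<in> {a..b}"
  shows "bcont \<Omega>r (\<lambda>x. u x t)" "bcont \<Omega>r (\<lambda>x. v x t)" "bcont \<Omega>r (\<lambda>x. dv x t)" "bcont \<Omega>r (\<lambda>x. w x t)" "bcont \<Omega>r (\<lambda>x. dw x t)"
    "bcont \<Omega>r (\<lambda>x. Gu x t)" "bcont \<Omega>r (\<lambda>x. Gv x t)" "bcont \<Omega>r (\<lambda>x. Gw x t)" "bcont \<Omega>r (\<lambda>x. \<rho> x t)"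
  using bcont_fields[THEN bcont_slice_x, OF assms] by simp_all

lemmas Oi = bcont_set_integrable_lebesgue(1)[OF _ \<Omega>r_sets(1) \<Omega>r(2)]
lemmas Qi = Qint_iterated[OF \<Omega>r(1,2)]

lemma R: "continuous_on {a..b} R" "x \<in> \<Omega> \<Longrightarrow> t \<in> {a..b} \<Longrightarrow> \<bar>\<alpha>' x t\<bar> \<le> R t"
proof -
  have rd: "bcont \<Omega> (\<lambda>x. sdcoef a b (\<lambda>i. ca i x) j)" if "j < q" for j
    using that by (intro bcont_sdcoef bcont_ca) auto
  show "continuous_on {a..b} R"
    using continuous_on_SUP_spoly(1)[where c = "\<lambda>j x. sdcoef a b (\<lambda>i. ca i x) j", OF dom(3) rd, where a=a and b=b]
    by (simp add: R_def[abs_def] \<alpha>'_def)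
  show "x \<in> \<Omega> \<Longrightarrow> t \<in> {a..b} \<Longrightarrow> \<bar>\<alpha>' x t\<bar> \<le> R t"
    using continuous_on_SUP_spoly(2)[where c = "\<lambda>j x. sdcoef a b (\<lambda>i. ca i x) j", OF dom(3) rd, where a=a and b=b]
    by (simp add: R_def \<alpha>'_def)
qed

lemma r_nonneg: "r \<ge> 0"
proof -
  obtain x where "x \<in> \<Omega>" using dom by blast
  have "0 \<le> R t" if "t \<in> {a..b}" for t
    using R(2)[OF \<open>x \<in> \<Omega>\<close> that] by linarith
  then show ?thesis unfolding r_def
    by (intro integral_nonneg integrable_continuous_interval R(1)) auto
qed

lemma \<rho>: "x \<in> \<Omega>r \<Longrightarrow> t \<in> {a..b} \<Longrightarrow> \<rho>0 \<le> \<rho> x t" "x \<in> \<Omega>r \<Longrightarrow> t \<in> {a..b} \<Longrightarrow> \<rho> x t \<le> \<rho>1"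
  using \<rho>_bounds \<Omega>r(3) by (auto simp: \<rho>_def)

text \<open>The slab mean at a fixed point in space, whose integral is \<open>S\<close>. It serves
  as the bound \<open>B\<close> in the scalar estimates in time before integration over the
  domain.\<close>

definition "\<sigma> x = meansq a b (v x)"

lemma \<sigma>: "set_integrable lebesgue \<Omega>r \<sigma>" "Oint \<Omega>r \<sigma> = S" "\<sigma> x \<ge> 0"
proof -
  have F: "bcont (\<Omega>r \<times> {a..b}) (\<lambda>z. (v (fst z) (snd z))\<^sup>2)" by (intro bcont_intros bcont_fields)
  have e: "\<sigma> = (\<lambda>x. (1 / (b - a)) * integral {a..b} (\<lambda>t. (v x t)\<^sup>2))"
    by (simp add: \<sigma>_def[abs_def] meansq_def)
  show "set_integrable lebesgue \<Omega>r \<sigma>" unfolding e by (intro set_integrable_mult_right Qi(2)[OF F])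
  show "Oint \<Omega>r \<sigma> = S" unfolding e S_def Qi(1)[OF F] by (simp add: Oint_def)
  show "\<sigma> x \<ge> 0" unfolding \<sigma>_def by (rule meansq_nonneg[OF ab])
qed

lemma pw:
  assumes "t \<in> {a..b}"
  shows "(v x t)\<^sup>2 \<le> K * \<sigma> x" "(dv x t)\<^sup>2 \<le> K * \<sigma> x / (b - a)\<^sup>2"
    "(w x t)\<^sup>2 \<le> K * \<sigma> x" "(dw x t)\<^sup>2 \<le> K * \<sigma> x / (b - a)\<^sup>2"
proof -
  have e: "spoly a b q (sdcoef a b (\<lambda>j. cu j x)) = v x" by (rule ext) (simp add: v_def)
  note * = K(2)[unfolded sup_const_def, rule_format, OF ab assms, of "sdcoef a b (\<lambda>j. cu j x)", unfolded e]
  show "(v x t)\<^sup>2 \<le> K * \<sigma> x" "(dv x t)\<^sup>2 \<le> K * \<sigma> x / (b - a)\<^sup>2"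
    "(w x t)\<^sup>2 \<le> K * \<sigma> x" "(dw x t)\<^sup>2 \<le> K * \<sigma> x / (b - a)\<^sup>2"
    using * by (auto simp: \<sigma>_def dv_def w_def dw_def)
qed

lemma S_nonneg: "S \<ge> 0" using Oint_nonneg[of \<Omega>r \<sigma>] \<sigma> by simp

lemma Oint_mono:
  "set_integrable lebesgue \<Omega>r F \<Longrightarrow> set_integrable lebesgue \<Omega>r G \<Longrightarrow> (\<And>x. x \<in> \<Omega>r \<Longrightarrow> F x \<le> G x) \<Longrightarrow> Oint \<Omega>r F \<le> Oint \<Omega>r G"
  unfolding Oint_def by (rule set_integral_mono)

lemma Oint_le_S:
  assumes "bcont \<Omega>r y" "\<And>x. x \<in> \<Omega>r \<Longrightarrow> (y x)\<^sup>2 \<le> C * \<sigma> x"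
  shows "Oint \<Omega>r (\<lambda>x. (y x)\<^sup>2) \<le> C * S"
proof -
  have "Oint \<Omega>r (\<lambda>x. (y x)\<^sup>2) \<le> Oint \<Omega>r (\<lambda>x. C * \<sigma> x)"
    using assms by (intro Oint_mono Oi bcont_intros set_integrable_mult_right \<sigma>)
  also have "\<dots> = C * S" using \<sigma>(2) by (simp add: Oint_def)
  finally show ?thesis .
qed

lemma slice_bounds:
  assumes "t \<in> {a..b}"
  shows "Oint \<Omega>r (\<lambda>x. (v x t)\<^sup>2) \<le> K * S" "Oint \<Omega>r (\<lambda>x. (dv x t)\<^sup>2) \<le> K * S / (b - a)\<^sup>2"
    "Oint \<Omega>r (\<lambda>x. (w x t)\<^sup>2) \<le> K * S" "Oint \<Omega>r (\<lambda>x. (dw x t)\<^sup>2) \<le> K * S / (b - a)\<^sup>2"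
  using Oint_le_S[OF bcont_slices(2)[OF assms] pw(1)[OF assms]]
    Oint_le_S[OF bcont_slices(3)[OF assms], of "K / (b - a)\<^sup>2"]
    Oint_le_S[OF bcont_slices(4)[OF assms] pw(3)[OF assms]]
    Oint_le_S[OF bcont_slices(5)[OF assms], of "K / (b - a)\<^sup>2"] pw(2,4)[OF assms]
  by auto

lemma derivs:
  "(v x has_vector_derivative dv x t) (at t within T')"
  "(Gu x has_vector_derivative Gv x t) (at t within T')"
  "(\<rho> x has_vector_derivative k * \<alpha>' x t) (at t within T')"
proof -
  have "(spoly a b (Suc (q - 1)) (sdcoef a b (\<lambda>j. cu j x)) has_vector_derivative dv x t) (at t within T')"
    unfolding dv_def by (rule spoly_has_vector_derivative[OF ab])
  then show "(v x has_vector_derivative dv x t) (at t within T')" using q by (simp add: v_def[abs_def])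
  show "(Gu x has_vector_derivative Gv x t) (at t within T')"
    using spoly_has_vector_derivative[OF ab, of q "\<lambda>j. sgrad (cu j) x"] by (simp add: Gu_def[abs_def] Gv_def)
  have "((\<lambda>t. 1 + k * spoly a b (Suc q) (\<lambda>j. ca j x) t) has_vector_derivative 0 + k * \<alpha>' x t) (at t within T')"
    unfolding \<alpha>'_def
    by (intro has_vector_derivative_add has_vector_derivative_const
        has_vector_derivative_mult_right spoly_has_vector_derivative[OF ab])
  then show "(\<rho> x has_vector_derivative k * \<alpha>' x t) (at t within T')" by (simp add: \<rho>_def[abs_def])
qed

lemma cont_t:
  assumes "x \<in> \<Omega>r"
  shows "continuous_on {a..b} (v x)" "continuous_on {a..b} (dv x)" "continuous_on {a..b} (w x)"
    "continuous_on {a..b} (\<alpha>' x)" "continuous_on {a..b} (\<rho> x)" "continuous_on {a..b} (Gv x)"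
    "continuous_on {a..b} (Gu x)" "continuous_on {a..b} (Gw x)"
  using bcont_fields[THEN bcont_slice_t, OF assms] by simp_all

text \<open>The nodal energies appear exactly. The only loss is the time derivative of the
  coefficient, estimated at fixed \<open>x\<close> by \<open>K * \<sigma> x\<close> times the
  integral of its supremum in space.\<close>

lemma momentum_energy:
  "Qint \<Omega>r a b (\<lambda>x t. (k * \<alpha>' x t * v x t + \<rho> x t * dv x t) * v x t)
     \<ge> (1/2) * (Oint \<Omega>r (\<lambda>x. \<rho> x b * (v x b)\<^sup>2) - Oint \<Omega>r (\<lambda>x. \<rho> x a * (v x a)\<^sup>2)) - K * \<bar>k\<bar> * r * S"
proof -
  have F: "bcont (\<Omega>r \<times> {a..b}) (\<lambda>z. (k * \<alpha>' (fst z) (snd z) * v (fst z) (snd z) + \<rho> (fst z) (snd z) * dv (fst z) (snd z)) * v (fst z) (snd z))"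
    by (intro bcont_intros bcont_fields)
  have ia: "set_integrable lebesgue \<Omega>r (\<lambda>x. \<rho> x t * (v x t)\<^sup>2)" if "t \<in> {a..b}" for t
    using that by (intro Oi bcont_intros bcont_slices)
  have ab': "a \<in> {a..b}" "b \<in> {a..b}" using ab by auto
  have "(1/2) * (Oint \<Omega>r (\<lambda>x. \<rho> x b * (v x b)\<^sup>2) - Oint \<Omega>r (\<lambda>x. \<rho> x a * (v x a)\<^sup>2)) - K * \<bar>k\<bar> * r * S
     = Oint \<Omega>r (\<lambda>x. (1/2) * (\<rho> x b * (v x b)\<^sup>2 - \<rho> x a * (v x a)\<^sup>2) - K * \<bar>k\<bar> * r * \<sigma> x)"
    using ia[OF ab'(1)] ia[OF ab'(2)] \<sigma>(1) unfolding \<sigma>(2)[symmetric]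
    by (simp add: Oint_def set_integral_diff)
  also have "\<dots> \<le> Oint \<Omega>r (\<lambda>x. integral {a..b} (\<lambda>t. (k * \<alpha>' x t * v x t + \<rho> x t * dv x t) * v x t))"
  proof (rule Oint_mono)
    show "set_integrable lebesgue \<Omega>r (\<lambda>x. (1/2) * (\<rho> x b * (v x b)\<^sup>2 - \<rho> x a * (v x a)\<^sup>2) - K * \<bar>k\<bar> * r * \<sigma> x)"
      using ia[OF ab'(1)] ia[OF ab'(2)] \<sigma>(1)
      by (intro set_integral_diff(1) set_integrable_mult_right)
    show "set_integrable lebesgue \<Omega>r (\<lambda>x. integral {a..b} (\<lambda>t. (k * \<alpha>' x t * v x t + \<rho> x t * dv x t) * v x t))"
      by (rule Qi(2)[OF F])
    fix x assume x: "x \<in> \<Omega>r"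
    have "\<bar>integral {a..b} (\<lambda>t. (k * \<alpha>' x t * v x t + \<rho> x t * dv x t) * v x t)
        - (1/2) * (\<rho> x b * (v x b)\<^sup>2 - \<rho> x a * (v x a)\<^sup>2)\<bar> \<le> (K * \<sigma> x) * integral {a..b} (\<lambda>t. \<bar>k\<bar> * R t)"
      using x \<Omega>r(3) R(2)
      by (intro variable_coefficient_energy ab derivs continuous_intros cont_t R(1) pw)
        (auto simp: abs_mult intro!: mult_left_mono)
    then show "(1/2) * (\<rho> x b * (v x b)\<^sup>2 - \<rho> x a * (v x a)\<^sup>2) - K * \<bar>k\<bar> * r * \<sigma> x
        \<le> integral {a..b} (\<lambda>t. (k * \<alpha>' x t * v x t + \<rho> x t * dv x t) * v x t)"
      unfolding r_def by (simp add: mult_ac)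
  qed
  finally show ?thesis unfolding Qi(1)[OF F] .
qed

lemma momentum_test:
  "Qint \<Omega>r a b (\<lambda>x t. (k * \<alpha>' x t * v x t + \<rho> x t * dv x t) * w x t)
     \<ge> (1/2) * \<rho>0 * S - (1/2) * Oint \<Omega>r (\<lambda>x. \<rho> x a * (v x a)\<^sup>2) - 2 * K * \<bar>k\<bar> * r * S"
proof -
  have F: "bcont (\<Omega>r \<times> {a..b}) (\<lambda>z. (k * \<alpha>' (fst z) (snd z) * v (fst z) (snd z) + \<rho> (fst z) (snd z) * dv (fst z) (snd z)) * w (fst z) (snd z))"
    by (intro bcont_intros bcont_fields)
  have ab': "a \<in> {a..b}" using ab by auto
  have ia: "set_integrable lebesgue \<Omega>r (\<lambda>x. \<rho> x a * (v x a)\<^sup>2)"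
    using ab' by (intro Oi bcont_intros bcont_slices)
  have "(1/2) * \<rho>0 * S - (1/2) * Oint \<Omega>r (\<lambda>x. \<rho> x a * (v x a)\<^sup>2) - 2 * K * \<bar>k\<bar> * r * S
     = Oint \<Omega>r (\<lambda>x. ((1/2) * \<rho>0 * \<sigma> x - (1/2) * (\<rho> x a * (v x a)\<^sup>2)) - 2 * K * \<bar>k\<bar> * r * \<sigma> x)"
    using ia \<sigma>(1) unfolding \<sigma>(2)[symmetric]
    by (simp add: Oint_def set_integral_diff)
  also have "\<dots> \<le> Oint \<Omega>r (\<lambda>x. integral {a..b} (\<lambda>t. (k * \<alpha>' x t * v x t + \<rho> x t * dv x t) * w x t))"
  proof (rule Oint_mono)
    show "set_integrable lebesgue \<Omega>r (\<lambda>x. ((1/2) * \<rho>0 * \<sigma> x - (1/2) * (\<rho> x a * (v x a)\<^sup>2)) - 2 * K * \<bar>k\<bar> * r * \<sigma> x)"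
      using ia \<sigma>(1) by (intro set_integral_diff(1) set_integrable_mult_right)
    show "set_integrable lebesgue \<Omega>r (\<lambda>x. integral {a..b} (\<lambda>t. (k * \<alpha>' x t * v x t + \<rho> x t * dv x t) * w x t))"
      by (rule Qi(2)[OF F])
    fix x assume x: "x \<in> \<Omega>r"
    have e: "integral {a..b} (\<lambda>t. dv x t * w x t) = (1/2) * (\<sigma> x - (v x a)\<^sup>2)"
    proof -
      have "spoly a b q (sdcoef a b (\<lambda>j. cu j x)) = v x" by (rule ext) (simp add: v_def)
      then show ?thesis
        using slab_derivative_test[OF q ab, of "sdcoef a b (\<lambda>j. cu j x)"]
        by (simp add: dv_def w_def \<sigma>_def)
    qed
    have "\<bar>integral {a..b} (\<lambda>t. (k * \<alpha>' x t * v x t + \<rho> x t * dv x t) * w x t)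
        - \<rho> x a * integral {a..b} (\<lambda>t. dv x t * w x t)\<bar> \<le> 2 * (K * \<sigma> x) * integral {a..b} (\<lambda>t. \<bar>k\<bar> * R t)"
      using x \<Omega>r(3) R(2)
      by (intro variable_coefficient_test ab derivs continuous_intros cont_t R(1) pw)
        (auto simp: abs_mult intro!: mult_left_mono)
    moreover have "\<rho>0 * \<sigma> x \<le> \<rho> x a * \<sigma> x"
      using \<rho>(1)[OF x ab'] \<sigma>(3) by (intro mult_right_mono)
    ultimately show "((1/2) * \<rho>0 * \<sigma> x - (1/2) * (\<rho> x a * (v x a)\<^sup>2)) - 2 * K * \<bar>k\<bar> * r * \<sigma> x
        \<le> integral {a..b} (\<lambda>t. (k * \<alpha>' x t * v x t + \<rho> x t * dv x t) * w x t)"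
      unfolding r_def e by (simp add: algebra_simps)
  qed
  finally show ?thesis unfolding Qi(1)[OF F] .
qed

lemma stiffness_energy: "Qint \<Omega>r a b (\<lambda>x t. Gu x t \<bullet> Gv x t) = (1/2) * (H b - H a)"
proof -
  have F: "bcont (\<Omega>r \<times> {a..b}) (\<lambda>z. Gu (fst z) (snd z) \<bullet> Gv (fst z) (snd z))"
    by (intro bcont_intros bcont_fields)
  have ab': "a \<in> {a..b}" "b \<in> {a..b}" using ab by auto
  have pwi: "integral {a..b} (\<lambda>t. Gu x t \<bullet> Gv x t) = (1/2) * (norm (Gu x b))\<^sup>2 - (1/2) * (norm (Gu x a))\<^sup>2" for x
  proof (rule integral_unique, rule fundamental_theorem_of_calculus)
    show "((\<lambda>t. (1/2) * (norm (Gu x t))\<^sup>2) has_vector_derivative Gu x t \<bullet> Gv x t) (at t within {a..b})" for t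
    proof -
      note [derivative_intros] = bounded_bilinear.has_vector_derivative[OF bounded_bilinear_inner]
      show ?thesis unfolding power2_norm_eq_inner
        by (auto intro!: derivative_eq_intros derivs(2) simp: inner_commute)
    qed
  qed (use ab in simp)
  have "set_integrable lebesgue \<Omega>r (\<lambda>x. (1/2) * (norm (Gu x t))\<^sup>2)" if "t \<in> {a..b}" for t
    using that by (intro Oi bcont_intros bcont_slices)
  from this[OF ab'(1)] this[OF ab'(2)] show ?thesis
    unfolding Qi(1)[OF F] pwi H_def
    by (simp add: Oint_def set_integral_diff)
qed

text \<open>\<open>value_const\<close> at fixed \<open>x\<close>, then integrated. The stiffness
  pairing may be negative; it is bounded below only together with \<open>H a\<close>.\<close>

lemma stiffness_test:
  assumes t: "t \<in> {a..b}"
  shows "H t \<le> K * (Qint \<Omega>r a b (\<lambda>x t. Gu x t \<bullet> Gw x t) + H a)"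
proof -
  have F: "bcont (\<Omega>r \<times> {a..b}) (\<lambda>z. Gu (fst z) (snd z) \<bullet> Gw (fst z) (snd z))"
    by (intro bcont_intros bcont_fields)
  have i: "set_integrable lebesgue \<Omega>r (\<lambda>x. (norm (Gu x t))\<^sup>2)" if "t \<in> {a..b}" for t
    using that by (intro Oi bcont_intros bcont_slices)
  have ia: "set_integrable lebesgue \<Omega>r (\<lambda>x. (norm (Gu x a))\<^sup>2)" using ab by (intro i) simp
  have "H t \<le> Oint \<Omega>r (\<lambda>x. K * (integral {a..b} (\<lambda>t. Gu x t \<bullet> Gw x t) + (norm (Gu x a))\<^sup>2))"
    unfolding H_def
  proof (rule Oint_mono[OF i[OF t]])
    show "set_integrable lebesgue \<Omega>r (\<lambda>x. K * (integral {a..b} (\<lambda>t. Gu x t \<bullet> Gw x t) + (norm (Gu x a))\<^sup>2))"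
      by (intro set_integrable_mult_right set_integral_add(1) Qi(2)[OF F] ia)
    show "(norm (Gu x t))\<^sup>2 \<le> K * (integral {a..b} (\<lambda>t. Gu x t \<bullet> Gw x t) + (norm (Gu x a))\<^sup>2)" for x
      using K(4)[unfolded value_const_def, rule_format, OF ab t, of "\<lambda>j. sgrad (cu j) x"]
      by (simp add: Gu_def Gw_def)
  qed
  also have "\<dots> = K * (Qint \<Omega>r a b (\<lambda>x t. Gu x t \<bullet> Gw x t) + H a)"
    unfolding Qi(1)[OF F] H_def using Qi(2)[OF F] ia by (simp add: Oint_def set_integral_add)
  finally show ?thesis .
qed

lemma D_nonneg: "D \<ge> 0" unfolding D_def by (rule Qint_nonneg) simp

text \<open>At every time the test gradient is bounded by the slab mean of \<open>Gv\<close>;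
  integration over the slab turns the mean back into the integral.\<close>

lemma Gw_bound: "Qint \<Omega>r a b (\<lambda>x t. (norm (Gw x t))\<^sup>2) \<le> K * D"
proof -
  have F: "bcont (\<Omega>r \<times> {a..b}) (\<lambda>z. (norm (Gw (fst z) (snd z)))\<^sup>2)"
    and F': "bcont (\<Omega>r \<times> {a..b}) (\<lambda>z. (norm (Gv (fst z) (snd z)))\<^sup>2)"
    by (intro bcont_intros bcont_fields)+
  have "Oint \<Omega>r (\<lambda>x. integral {a..b} (\<lambda>t. (norm (Gw x t))\<^sup>2)) \<le> Oint \<Omega>r (\<lambda>x. K * integral {a..b} (\<lambda>t. (norm (Gv x t))\<^sup>2))"
  proof (rule Oint_mono)
    fix x assume x: "x \<in> \<Omega>r"
    have e: "spoly a b q (sdcoef a b (\<lambda>j. sgrad (cu j) x)) = Gv x" by (rule ext) (simp add: Gv_def)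
    have "integral {a..b} (\<lambda>t. (norm (Gw x t))\<^sup>2) \<le> integral {a..b} (\<lambda>t. K * meansq a b (Gv x))"
    proof (intro integral_le integrable_continuous_interval continuous_intros cont_t[OF x])
      show "(norm (Gw x t))\<^sup>2 \<le> K * meansq a b (Gv x)" if "t \<in> {a..b}" for t
        using K(3)[unfolded sup_const_def, rule_format, OF ab that, of "sdcoef a b (\<lambda>j. sgrad (cu j) x)", unfolded e]
        by (simp add: Gw_def)
    qed
    also have "\<dots> = K * integral {a..b} (\<lambda>t. (norm (Gv x t))\<^sup>2)" using ab by (simp add: meansq_def)
    finally show "integral {a..b} (\<lambda>t. (norm (Gw x t))\<^sup>2) \<le> K * integral {a..b} (\<lambda>t. (norm (Gv x t))\<^sup>2)" .
  qed (intro Qi(2)[OF F] set_integrable_mult_right Qi(2)[OF F'])+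
  then show ?thesis unfolding D_def Qi(1)[OF F] Qi(1)[OF F'] by (simp add: Oint_def)
qed

end

section \<open>Sources and the two inequalities on a slab\<close>

context slab
begin

definition "src f = (LINT t:{a..b}|lebesgue. sqrt (Oint \<Omega>r (\<lambda>x. (f x t)\<^sup>2)))"

lemma src_nonneg: "src f \<ge> 0"
  unfolding src_def by (intro set_lebesgue_integral_nonneg real_sqrt_ge_zero Oint_nonneg) simp

lemma source_term:
  assumes f: "L1L2 \<Omega>r T f" and T: "0 \<le> a" "b \<le> T" and y: "bcont (\<Omega>r \<times> {a..b}) (\<lambda>z. y (fst z) (snd z))"
    and B: "\<And>t. t \<in> {a..b} \<Longrightarrow> Oint \<Omega>r (\<lambda>x. (y x t)\<^sup>2) \<le> B\<^sup>2" "B \<ge> 0"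
  shows "\<bar>Qint \<Omega>r a b (\<lambda>x t. f x t * y x t)\<bar> \<le> B * src f"
  unfolding src_def
proof (rule source_bound[OF f T _ _ _ B(2) \<Omega>r_sets(2)])
  have S: "\<Omega>r \<times> {a<..<b} \<in> sets lebesgue" using \<Omega>r_sets(2) by (intro sets_Times_lebesgue) auto
  have "set_borel_measurable lebesgue (\<Omega>r \<times> {a..b}) (\<lambda>z. y (fst z) (snd z))"
    using Qi(3)[OF y] unfolding set_integrable_def set_borel_measurable_def by (rule borel_measurable_integrable)
  then show "set_borel_measurable lebesgue (\<Omega>r \<times> {a<..<b}) (\<lambda>z. y (fst z) (snd z))"
    by (rule set_borel_measurable_subset[OF _ S]) auto
  show "set_integrable lebesgue \<Omega>r (\<lambda>x. (y x t)\<^sup>2)" if "t \<in> {a<..<b}" for t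
    using that bcont_slice_x[OF y, of t] by (intro Oi bcont_intros) auto
  show "Oint \<Omega>r (\<lambda>x. (y x t)\<^sup>2) \<le> B\<^sup>2" if "t \<in> {a<..<b}" for t
    using that by (intro B) auto
qed

text \<open>The bounds for \<open>dv\<close> and \<open>dw\<close> carry 1/(b - a), which is moved
  onto the source. For \<xi> this is the origin of the weight 1/\<tau>_n in the final
  estimate.\<close>

lemma source_terms:
  assumes f: "L1L2 \<Omega>r T f" and T: "0 \<le> a" "b \<le> T"
  shows "\<bar>Qint \<Omega>r a b (\<lambda>x t. f x t * v x t)\<bar> \<le> sqrt (K * S) * src f"
    "\<bar>Qint \<Omega>r a b (\<lambda>x t. f x t * w x t)\<bar> \<le> sqrt (K * S) * src f"
    "\<bar>Qint \<Omega>r a b (\<lambda>x t. f x t * dv x t)\<bar> \<le> sqrt (K * S) * (src f / (b - a))"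
    "\<bar>Qint \<Omega>r a b (\<lambda>x t. f x t * dw x t)\<bar> \<le> sqrt (K * S) * (src f / (b - a))"
proof -
  have KS: "K * S \<ge> 0" using K(1) S_nonneg by simp
  show "\<bar>Qint \<Omega>r a b (\<lambda>x t. f x t * v x t)\<bar> \<le> sqrt (K * S) * src f"
    "\<bar>Qint \<Omega>r a b (\<lambda>x t. f x t * w x t)\<bar> \<le> sqrt (K * S) * src f"
    using KS slice_bounds by (auto intro!: source_term[OF assms] bcont_fields)
  have sq: "(sqrt (K * S) / (b - a))\<^sup>2 = K * S / (b - a)\<^sup>2" using KS by (simp add: power_divide)
  have "\<bar>Qint \<Omega>r a b (\<lambda>x t. f x t * dv x t)\<bar> \<le> sqrt (K * S) / (b - a) * src f"
    "\<bar>Qint \<Omega>r a b (\<lambda>x t. f x t * dw x t)\<bar> \<le> sqrt (K * S) / (b - a) * src f"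
    using KS ab by (intro source_term[OF assms] bcont_fields; simp add: sq slice_bounds)+
  then show "\<bar>Qint \<Omega>r a b (\<lambda>x t. f x t * dv x t)\<bar> \<le> sqrt (K * S) * (src f / (b - a))"
    "\<bar>Qint \<Omega>r a b (\<lambda>x t. f x t * dw x t)\<bar> \<le> sqrt (K * S) * (src f / (b - a))" by simp_all
qed

lemma gradient_young:
  assumes G: "set_integrable lebesgue (\<Omega>r \<times> {a<..<b}) (\<lambda>z. (norm (G (fst z) (snd z)))\<^sup>2)"
    and y: "bcont (\<Omega>r \<times> {a..b}) (\<lambda>z. y (fst z) (snd z))"
  shows "\<bar>Qint \<Omega>r a b (\<lambda>x t. G x t \<bullet> y x t)\<bar>
     \<le> (1/2) * (Qint \<Omega>r a b (\<lambda>x t. (norm (G x t))\<^sup>2) + Qint \<Omega>r a b (\<lambda>x t. (norm (y x t))\<^sup>2))"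
proof -
  have S: "\<Omega>r \<times> {a<..<b} \<in> sets lebesgue" using \<Omega>r_sets(2) by (intro sets_Times_lebesgue) auto
  have "set_integrable lebesgue (\<Omega>r \<times> {a..b}) (\<lambda>z. (norm (y (fst z) (snd z)))\<^sup>2)"
    by (intro Qi(3) bcont_intros y)
  then have "set_integrable lebesgue (\<Omega>r \<times> {a<..<b}) (\<lambda>z. (norm (y (fst z) (snd z)))\<^sup>2)"
    by (rule set_integrable_subset[OF _ S]) auto
  from set_integral_young[OF G this zero_less_one] show ?thesis
    unfolding Qint_open_interval by simp
qed

text \<open>\<open>vp\<close> is the trace of the time derivative coming from the preceding slab.
  The hypothesis \<open>zero\<close> covers both kinds of slab: where the initial data
  \<open>g\<close> occur, \<open>vp\<close> vanishes and \<open>v x a\<close> is itself the jump.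
  The first conclusion comes from the test with \<open>v\<close>, the second from the test with
  \<open>w\<close>; its \<open>3 / 8\<close> is \<open>1 / 2\<close> minus two Young remainders of
  \<open>1 / 16\<close>.\<close>

lemma slab_step:
  assumes vp: "bcont \<Omega>r vp" and g: "set_integrable lebesgue \<Omega>r (\<lambda>x. (g x)\<^sup>2)"
    and zero: "(\<forall>x. g x = 0) \<or> (\<forall>x. vp x = 0)"
    and f: "L1L2 \<Omega>r T f" and \<xi>: "L1L2 \<Omega>r T \<xi>" and T: "0 \<le> a" "b \<le> T" and \<delta>: "\<delta> \<ge> 0"
    and G: "set_integrable lebesgue (\<Omega>r \<times> {a<..<b}) (\<lambda>z. (norm (G (fst z) (snd z)))\<^sup>2)"
    and eqv: "Qint \<Omega>r a b (\<lambda>x t. (k * \<alpha>' x t * v x t + \<rho> x t * dv x t) * v x t)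
        + Oint \<Omega>r (\<lambda>x. \<rho> x a * (v x a - vp x) * v x a)
        + c\<^sup>2 * Qint \<Omega>r a b (\<lambda>x t. Gu x t \<bullet> Gv x t) + \<delta> * Qint \<Omega>r a b (\<lambda>x t. Gv x t \<bullet> Gv x t)
      = Qint \<Omega>r a b (\<lambda>x t. f x t * v x t) + Oint \<Omega>r (\<lambda>x. g x * v x a)
        + \<delta> * Qint \<Omega>r a b (\<lambda>x t. G x t \<bullet> Gv x t) + Qint \<Omega>r a b (\<lambda>x t. \<xi> x t * dv x t)"
    and eqw: "Qint \<Omega>r a b (\<lambda>x t. (k * \<alpha>' x t * v x t + \<rho> x t * dv x t) * w x t)
        + Oint \<Omega>r (\<lambda>x. \<rho> x a * (v x a - vp x) * w x a)
        + c\<^sup>2 * Qint \<Omega>r a b (\<lambda>x t. Gu x t \<bullet> Gw x t) + \<delta> * Qint \<Omega>r a b (\<lambda>x t. Gv x t \<bullet> Gw x t)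
      = Qint \<Omega>r a b (\<lambda>x t. f x t * w x t) + Oint \<Omega>r (\<lambda>x. g x * w x a)
        + \<delta> * Qint \<Omega>r a b (\<lambda>x t. G x t \<bullet> Gw x t) + Qint \<Omega>r a b (\<lambda>x t. \<xi> x t * dw x t)"
  defines "Ap \<equiv> Oint \<Omega>r (\<lambda>x. \<rho> x a * (vp x)\<^sup>2)"
    and "Ab \<equiv> Oint \<Omega>r (\<lambda>x. \<rho> x b * (v x b)\<^sup>2)"
    and "J \<equiv> Oint \<Omega>r (\<lambda>x. (v x a - vp x)\<^sup>2)"
    and "\<Gamma> \<equiv> Oint \<Omega>r (\<lambda>x. (g x)\<^sup>2)"
    and "GG \<equiv> Qint \<Omega>r a b (\<lambda>x t. (norm (G x t))\<^sup>2)"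
    and "B \<equiv> Qint \<Omega>r a b (\<lambda>x t. Gu x t \<bullet> Gw x t)"
    and "src2 \<equiv> src f + src \<xi> / (b - a)"
  shows "Ab / 2 + c\<^sup>2 / 2 * H b + \<rho>0 / 4 * J + \<delta> / 2 * D
      \<le> Ap / 2 + c\<^sup>2 / 2 * H a + K * \<bar>k\<bar> * r * S + sqrt (K * S) * src2 + \<Gamma> / \<rho>0 + \<delta> / 2 * GG"
    and "3 / 8 * \<rho>0 * S + c\<^sup>2 * B
      \<le> (4 * K * \<rho>1\<^sup>2 / \<rho>0 + \<rho>1) * J + Ap + 2 * K * \<bar>k\<bar> * r * S + 4 * K / \<rho>0 * \<Gamma>
        + sqrt (K * S) * src2 + 3 / 2 * K * (\<delta> * D) + \<delta> / 2 * GG"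
proof -
  have ab': "a \<in> {a..b}" using ab by auto
  note va = bcont_slices(2)[OF ab'] and wa = bcont_slices(4)[OF ab'] and \<rho>a = bcont_slices(9)[OF ab']
  define j where "j x = v x a - vp x" for x
  have bj: "bcont \<Omega>r j" unfolding j_def[abs_def] by (intro bcont_intros va vp)
  have ij: "set_integrable lebesgue \<Omega>r (\<lambda>x. (j x)\<^sup>2)" by (intro Oi bcont_intros bj)
  have J: "J = Oint \<Omega>r (\<lambda>x. (j x)\<^sup>2)" by (simp add: J_def j_def)
  have J0: "J \<ge> 0" unfolding J by (rule Oint_nonneg) simp
  define Aa where "Aa = Oint \<Omega>r (\<lambda>x. \<rho> x a * (v x a)\<^sup>2)"
  define RJ where "RJ = Oint \<Omega>r (\<lambda>x. \<rho> x a * (j x)\<^sup>2)"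
  have iAa: "set_integrable lebesgue \<Omega>r (\<lambda>x. \<rho> x a * (v x a)\<^sup>2)"
    and iAp: "set_integrable lebesgue \<Omega>r (\<lambda>x. \<rho> x a * (vp x)\<^sup>2)"
    and iRJ: "set_integrable lebesgue \<Omega>r (\<lambda>x. \<rho> x a * (j x)\<^sup>2)"
    by (intro Oi bcont_intros va vp \<rho>a bj)+
  \<comment> \<open>Polarization of \<open>(v - vp) * v\<close>. In the first conclusion
    \<open>Aa\<close> cancels against its occurrence in \<open>momentum_energy\<close>, and
    \<open>Ap\<close> is the energy handed over by the preceding slab.\<close>
  have jump: "Oint \<Omega>r (\<lambda>x. \<rho> x a * (v x a - vp x) * v x a) = Aa / 2 - Ap / 2 + RJ / 2"
  proof -
    have "\<rho> x a * (v x a - vp x) * v x a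
        = (1/2) * (\<rho> x a * (v x a)\<^sup>2) - (1/2) * (\<rho> x a * (vp x)\<^sup>2) + (1/2) * (\<rho> x a * (j x)\<^sup>2)" for x
      by (simp add: j_def power2_eq_square field_simps)
    then show ?thesis
      unfolding Aa_def Ap_def RJ_def using iAa iAp iRJ
      by (simp add: Oint_def set_integral_add set_integral_diff)
  qed
  have RJ1: "\<rho>0 * J \<le> RJ"
  proof -
    have "Oint \<Omega>r (\<lambda>x. \<rho>0 * (j x)\<^sup>2) \<le> RJ" unfolding RJ_def
      using ij iRJ \<rho>(1)[OF _ ab'] by (intro Oint_mono set_integrable_mult_right) (auto intro: mult_right_mono)
    then show ?thesis by (simp add: J Oint_def)
  qed
  have RJ2: "RJ \<le> \<rho>1 * J"
  proof -
    have "RJ \<le> Oint \<Omega>r (\<lambda>x. \<rho>1 * (j x)\<^sup>2)" unfolding RJ_def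
      using ij iRJ \<rho>(2)[OF _ ab'] by (intro Oint_mono set_integrable_mult_right) (auto intro: mult_right_mono)
    then show ?thesis by (simp add: J Oint_def)
  qed
  \<comment> \<open>In the second conclusion \<open>Aa\<close> does not cancel. It is traded for the
    jump and the incoming energy, both controlled by the first conclusion.\<close>
  have Aa: "Aa \<le> 2 * RJ + 2 * Ap"
  proof -
    have "Aa \<le> Oint \<Omega>r (\<lambda>x. 2 * (\<rho> x a * (j x)\<^sup>2) + 2 * (\<rho> x a * (vp x)\<^sup>2))" unfolding Aa_def
    proof (rule Oint_mono[OF iAa])
      show "set_integrable lebesgue \<Omega>r (\<lambda>x. 2 * (\<rho> x a * (j x)\<^sup>2) + 2 * (\<rho> x a * (vp x)\<^sup>2))"
        using iRJ iAp by (intro set_integral_add(1) set_integrable_mult_right)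
      fix x assume x: "x \<in> \<Omega>r"
      have "(v x a)\<^sup>2 \<le> 2 * (j x)\<^sup>2 + 2 * (vp x)\<^sup>2"
        using zero_le_power2[of "v x a - 2 * vp x"] by (simp add: j_def power2_eq_square algebra_simps)
      then have "\<rho> x a * (v x a)\<^sup>2 \<le> \<rho> x a * (2 * (j x)\<^sup>2 + 2 * (vp x)\<^sup>2)"
        using \<rho>(1)[OF x ab'] \<rho>0 by (intro mult_left_mono) auto
      then show "\<rho> x a * (v x a)\<^sup>2 \<le> 2 * (\<rho> x a * (j x)\<^sup>2) + 2 * (\<rho> x a * (vp x)\<^sup>2)"
        by (simp add: algebra_simps)
    qed
    also have "\<dots> = 2 * RJ + 2 * Ap" unfolding RJ_def Ap_def using iRJ iAp
      by (simp add: Oint_def set_integral_add)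
    finally show ?thesis .
  qed
  have src2: "sqrt (K * S) * src2 = sqrt (K * S) * src f + sqrt (K * S) * (src \<xi> / (b - a))"
    by (simp add: src2_def distrib_left)
  have DD: "Qint \<Omega>r a b (\<lambda>x t. Gv x t \<bullet> Gv x t) = D"
    by (simp add: D_def power2_norm_eq_inner)
  have GGv: "\<bar>Qint \<Omega>r a b (\<lambda>x t. G x t \<bullet> Gv x t)\<bar> \<le> (1/2) * (GG + D)"
    using gradient_young[OF G bcont_fields(7)] by (simp add: GG_def D_def)
  have GGw: "\<bar>Qint \<Omega>r a b (\<lambda>x t. G x t \<bullet> Gw x t)\<bar> \<le> (1/2) * (GG + K * D)"
    using gradient_young[OF G bcont_fields(8)] Gw_bound by (simp add: GG_def)
  have Gvi: "set_integrable lebesgue (\<Omega>r \<times> {a<..<b}) (\<lambda>z. (norm (Gv (fst z) (snd z)))\<^sup>2)"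
  proof (rule set_integrable_subset)
    show "set_integrable lebesgue (\<Omega>r \<times> {a..b}) (\<lambda>z. (norm (Gv (fst z) (snd z)))\<^sup>2)"
      by (intro Qi(3) bcont_intros bcont_fields)
    show "\<Omega>r \<times> {a<..<b} \<in> sets lebesgue" using \<Omega>r_sets(2) by (intro sets_Times_lebesgue) auto
  qed auto
  have GvGw: "\<bar>Qint \<Omega>r a b (\<lambda>x t. Gv x t \<bullet> Gw x t)\<bar> \<le> (1/2) * (D + K * D)"
    using gradient_young[OF Gvi bcont_fields(8)] Gw_bound by (simp add: D_def)
  \<comment> \<open>By \<open>zero\<close>, the trace may be replaced by the jump. The weight
    \<open>2 / \<rho>0\<close> spends half of the available \<open>\<rho>0 / 2 * J\<close>.\<close>
  have gv: "\<bar>Oint \<Omega>r (\<lambda>x. g x * v x a)\<bar> \<le> \<Gamma> / \<rho>0 + \<rho>0 / 4 * J"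
  proof -
    have "(\<lambda>x. g x * v x a) = (\<lambda>x. g x \<bullet> j x)" using zero by (auto simp: j_def)
    then have "\<bar>Oint \<Omega>r (\<lambda>x. g x * v x a)\<bar> \<le> (1/2) * (2 / \<rho>0 * \<Gamma> + J / (2 / \<rho>0))"
      using set_integral_young[of lebesgue \<Omega>r g j "2 / \<rho>0"] g ij \<rho>0 by (simp add: Oint_def \<Gamma>_def J)
    also have "(1/2) * (2 / \<rho>0 * \<Gamma> + J / (2 / \<rho>0)) = \<Gamma> / \<rho>0 + \<rho>0 / 4 * J" by simp
    finally show ?thesis .
  qed
  have wS: "Oint \<Omega>r (\<lambda>x. (w x a)\<^sup>2) \<le> K * S" by (rule slice_bounds[OF ab'])
  have iw: "set_integrable lebesgue \<Omega>r (\<lambda>x. (w x a)\<^sup>2)" by (intro Oi bcont_intros wa)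
  \<comment> \<open>With this weight Young's inequality leaves \<open>\<rho>0 / 16 * S\<close>; it
    is used once for the initial data and once for the jump.\<close>
  have l: "8 * K / \<rho>0 > 0" using K(1) \<rho>0 by simp
  have lw: "Oint \<Omega>r (\<lambda>x. (w x a)\<^sup>2) / (8 * K / \<rho>0) \<le> \<rho>0 / 8 * S"
    using divide_right_mono[OF wS, of "8 * K / \<rho>0"] l K(1) \<rho>0 by (simp add: mult.commute)
  have gw: "\<bar>Oint \<Omega>r (\<lambda>x. g x * w x a)\<bar> \<le> 4 * K / \<rho>0 * \<Gamma> + \<rho>0 / 16 * S"
  proof -
    have "\<bar>Oint \<Omega>r (\<lambda>x. g x * w x a)\<bar> \<le> (1/2) * (8 * K / \<rho>0 * \<Gamma> + Oint \<Omega>r (\<lambda>x. (w x a)\<^sup>2) / (8 * K / \<rho>0))"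
      using set_integral_young[of lebesgue \<Omega>r g "\<lambda>x. w x a", OF _ _ l] g iw by (simp add: Oint_def \<Gamma>_def)
    also have "\<dots> \<le> (1/2) * (8 * K / \<rho>0 * \<Gamma> + \<rho>0 / 8 * S)"
      using lw by (intro mult_left_mono add_left_mono) auto
    finally show ?thesis by simp
  qed
  have jw: "\<bar>Oint \<Omega>r (\<lambda>x. \<rho> x a * (v x a - vp x) * w x a)\<bar> \<le> 4 * K * \<rho>1\<^sup>2 / \<rho>0 * J + \<rho>0 / 16 * S"
  proof -
    define y where "y x = \<rho> x a * j x" for x
    have iy: "set_integrable lebesgue \<Omega>r (\<lambda>x. (y x)\<^sup>2)" unfolding y_def by (intro Oi bcont_intros \<rho>a bj)
    have "Oint \<Omega>r (\<lambda>x. (y x)\<^sup>2) \<le> Oint \<Omega>r (\<lambda>x. \<rho>1\<^sup>2 * (j x)\<^sup>2)"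
    proof (rule Oint_mono[OF iy set_integrable_mult_right[OF ij]])
      fix x assume x: "x \<in> \<Omega>r"
      have "(\<rho> x a)\<^sup>2 \<le> \<rho>1\<^sup>2" using \<rho>[OF x ab'] \<rho>0 by (intro power_mono) auto
      then show "(y x)\<^sup>2 \<le> \<rho>1\<^sup>2 * (j x)\<^sup>2" by (simp add: y_def power_mult_distrib mult_right_mono)
    qed
    then have Jy: "Oint \<Omega>r (\<lambda>x. (y x)\<^sup>2) \<le> \<rho>1\<^sup>2 * J" by (simp add: J Oint_def)
    have "\<bar>Oint \<Omega>r (\<lambda>x. y x * w x a)\<bar> \<le> (1/2) * (8 * K / \<rho>0 * Oint \<Omega>r (\<lambda>x. (y x)\<^sup>2) + Oint \<Omega>r (\<lambda>x. (w x a)\<^sup>2) / (8 * K / \<rho>0))"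
      using set_integral_young[of lebesgue \<Omega>r y "\<lambda>x. w x a", OF _ _ l] iy iw by (simp add: Oint_def)
    also have "\<dots> \<le> (1/2) * (8 * K / \<rho>0 * (\<rho>1\<^sup>2 * J) + \<rho>0 / 8 * S)"
      using lw Jy l by (intro mult_left_mono add_mono) auto
    also have "\<dots> = 4 * K * \<rho>1\<^sup>2 / \<rho>0 * J + \<rho>0 / 16 * S" by simp
    finally show ?thesis by (simp add: y_def j_def)
  qed
  note sf = source_terms[OF f T] and s\<xi> = source_terms[OF \<xi> T]
  have dGv: "\<bar>\<delta> * Qint \<Omega>r a b (\<lambda>x t. G x t \<bullet> Gv x t)\<bar> \<le> \<delta> / 2 * GG + \<delta> / 2 * D"
    using mult_left_mono[OF GGv \<delta>] \<delta> by (simp add: abs_mult algebra_simps)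
  have dGw: "\<bar>\<delta> * Qint \<Omega>r a b (\<lambda>x t. G x t \<bullet> Gw x t)\<bar> \<le> \<delta> / 2 * GG + K / 2 * (\<delta> * D)"
    using mult_left_mono[OF GGw \<delta>] \<delta> by (simp add: abs_mult algebra_simps)
  have dvw: "\<bar>\<delta> * Qint \<Omega>r a b (\<lambda>x t. Gv x t \<bullet> Gw x t)\<bar> \<le> K * (\<delta> * D)"
  proof -
    have "D \<le> K * D" using mult_right_mono[OF K(1) D_nonneg] by simp
    then have "\<bar>Qint \<Omega>r a b (\<lambda>x t. Gv x t \<bullet> Gw x t)\<bar> \<le> K * D" using GvGw by simp
    from mult_left_mono[OF this \<delta>] show ?thesis using \<delta> by (simp add: abs_mult mult_ac)
  qed
  \<comment> \<open>The products are replaced by independent real variables, which leaves a linear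
    implication.\<close>
  have lin1: "Ab / 2 + Hb + \<rho>J / 4 + hD \<le> Ap / 2 + Ha + m + s + \<gamma> + hG"
    if "Q + Jt + C + Dd = F + g' + Gt + X" "(1/2) * (Ab - Aa) - m \<le> Q" "Jt = Aa / 2 - Ap / 2 + RJ / 2"
      "\<rho>J \<le> RJ" "C = Hb - Ha" "Dd = hD + hD" "g' \<le> \<gamma> + \<rho>J / 4" "Gt \<le> hG + hD" "F \<le> s1" "X \<le> s2" "s = s1 + s2"
    for Q Jt C Dd F g' Gt X m \<rho>J Hb Ha hD hG \<gamma> s1 s2 s :: real
    using that by argo
  have "c\<^sup>2 * Qint \<Omega>r a b (\<lambda>x t. Gu x t \<bullet> Gv x t) = c\<^sup>2 / 2 * H b - c\<^sup>2 / 2 * H a"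
    unfolding stiffness_energy by (simp add: algebra_simps)
  moreover have "\<delta> * Qint \<Omega>r a b (\<lambda>x t. Gv x t \<bullet> Gv x t) = \<delta> / 2 * D + \<delta> / 2 * D"
    unfolding DD by simp
  moreover have "Oint \<Omega>r (\<lambda>x. g x * v x a) \<le> \<Gamma> / \<rho>0 + \<rho>0 * J / 4" using gv by simp
  ultimately have "Ab / 2 + c\<^sup>2 / 2 * H b + \<rho>0 * J / 4 + \<delta> / 2 * D
      \<le> Ap / 2 + c\<^sup>2 / 2 * H a + K * \<bar>k\<bar> * r * S + sqrt (K * S) * src2 + \<Gamma> / \<rho>0 + \<delta> / 2 * GG"
    by (intro lin1[OF eqv momentum_energy[folded Aa_def Ab_def] jump RJ1 _ _ _ dGv[THEN abs_le_D1]
        sf(1)[THEN abs_le_D1] s\<xi>(3)[THEN abs_le_D1] src2])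
  then show "Ab / 2 + c\<^sup>2 / 2 * H b + \<rho>0 / 4 * J + \<delta> / 2 * D
      \<le> Ap / 2 + c\<^sup>2 / 2 * H a + K * \<bar>k\<bar> * r * S + sqrt (K * S) * src2 + \<Gamma> / \<rho>0 + \<delta> / 2 * GG"
    by simp
  have lin2: "3 / 8 * s0 + B' \<le> (j1 + j2) + Ap + m + g1 + s + 3 / 2 * d + hG"
    if "Q + Jt + B' + Dd = F + g' + Gt + X" "(1/2) * s0 - (1/2) * Aa - m \<le> Q" "- Jt \<le> j1 + s0 / 16"
      "- Dd \<le> d" "g' \<le> g1 + s0 / 16" "Gt \<le> hG + d / 2" "F \<le> s1" "X \<le> s2" "s = s1 + s2"
      "Aa \<le> 2 * RJ + 2 * Ap" "RJ \<le> j2"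
    for Q Jt B' Dd F g' Gt X m s0 d hG g1 s1 s2 s j1 j2 :: real
    using that by argo
  have "(1/2) * (\<rho>0 * S) - (1/2) * Aa - 2 * K * \<bar>k\<bar> * r * S
      \<le> Qint \<Omega>r a b (\<lambda>x t. (k * \<alpha>' x t * v x t + \<rho> x t * dv x t) * w x t)"
    using momentum_test by (simp add: Aa_def mult.assoc)
  moreover have "- Oint \<Omega>r (\<lambda>x. \<rho> x a * (v x a - vp x) * w x a) \<le> 4 * K * \<rho>1\<^sup>2 / \<rho>0 * J + \<rho>0 * S / 16"
    using jw[THEN abs_le_D2] by simp
  moreover have "Oint \<Omega>r (\<lambda>x. g x * w x a) \<le> 4 * K / \<rho>0 * \<Gamma> + \<rho>0 * S / 16"
    using gw[THEN abs_le_D1] by simp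
  moreover have "\<delta> * Qint \<Omega>r a b (\<lambda>x t. G x t \<bullet> Gw x t) \<le> \<delta> / 2 * GG + K * (\<delta> * D) / 2"
    using dGw[THEN abs_le_D1] by simp
  ultimately have "3 / 8 * (\<rho>0 * S) + c\<^sup>2 * B
      \<le> (4 * K * \<rho>1\<^sup>2 / \<rho>0 * J + \<rho>1 * J) + Ap + 2 * K * \<bar>k\<bar> * r * S + 4 * K / \<rho>0 * \<Gamma>
        + sqrt (K * S) * src2 + 3 / 2 * (K * (\<delta> * D)) + \<delta> / 2 * GG"
    by (intro lin2[OF eqw[folded B_def] _ _ dvw[THEN abs_le_D2] _ _ sf(2)[THEN abs_le_D1]
        s\<xi>(4)[THEN abs_le_D1] src2 Aa RJ2])
  then show "3 / 8 * \<rho>0 * S + c\<^sup>2 * B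
      \<le> (4 * K * \<rho>1\<^sup>2 / \<rho>0 + \<rho>1) * J + Ap + 2 * K * \<bar>k\<bar> * r * S + 4 * K / \<rho>0 * \<Gamma>
        + sqrt (K * S) * src2 + 3 / 2 * K * (\<delta> * D) + \<delta> / 2 * GG"
    by (simp add: distrib_right)
qed

end

section \<open>Recursion over the slabs\<close>

text \<open>A scalar system. In the application \<open>h\<close> and \<open>B\<close> include the
  factor c^2, \<open>D\<close> and \<open>G\<close> the factor \<delta>, \<open>s\<close> collects
  both sources, and \<open>\<kappa>\<close> is the modulus of \<open>k\<close>. The constants stand
  outside the quantifiers over \<open>N\<close> and all sequences, which is the uniformity in mesh,
  partition and \<delta>. Only \<open>B m + h m\<close> is assumed nonnegative, since the stiffness
  pairing has no sign.\<close>

definition recursion_consts :: "real \<Rightarrow> real \<Rightarrow> real \<Rightarrow> real \<Rightarrow> real \<Rightarrow> bool" where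
  "recursion_consts K \<rho>0 C1 C\<alpha> C \<longleftrightarrow> (\<forall>N S D J B r s G A h \<Gamma> \<gamma> FF GG (\<kappa>::real).
    (\<forall>m<N. 0 \<le> S m \<and> 0 \<le> D m \<and> 0 \<le> J m \<and> 0 \<le> r m \<and> 0 \<le> s m \<and> 0 \<le> G m \<and> 0 \<le> B m + h m) \<longrightarrow>
    (\<forall>m\<le>N. 0 \<le> A m \<and> 0 \<le> h m) \<longrightarrow> A 0 = 0 \<longrightarrow> 0 \<le> \<Gamma> \<longrightarrow> 0 \<le> \<kappa> \<longrightarrow>
    (\<forall>m<N. A (Suc m) / 2 + h (Suc m) / 2 + \<rho>0 / 4 * J m + D m / 2
      \<le> A m / 2 + h m / 2 + K * \<kappa> * r m * S m + sqrt (K * S m) * s m + (if m = 0 then \<Gamma> / \<rho>0 else 0) + G m / 2) \<longrightarrow>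
    (\<forall>m<N. 3 / 8 * \<rho>0 * S m + B m
      \<le> C1 * J m + A m + 2 * K * \<kappa> * r m * S m + (if m = 0 then 4 * K / \<rho>0 * \<Gamma> else 0)
        + sqrt (K * S m) * s m + 3 / 2 * K * D m + G m / 2) \<longrightarrow>
    h 0 \<le> \<gamma> \<longrightarrow> (\<Sum>m<N. s m) \<le> FF \<longrightarrow> (\<Sum>m<N. G m) \<le> GG \<longrightarrow> \<kappa> * (\<Sum>m<N. r m) \<le> C\<alpha> \<longrightarrow> 1 \<le> N \<longrightarrow>
    (\<forall>m<N. S m \<le> C * (FF\<^sup>2 + \<Gamma> + \<gamma> + GG) \<and> B m + h m \<le> C * (FF\<^sup>2 + \<Gamma> + \<gamma> + GG)) \<and>
    (\<forall>m\<le>N. h m \<le> C * (FF\<^sup>2 + \<Gamma> + \<gamma> + GG)) \<and>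
    (\<Sum>m<N. J m) \<le> C * (FF\<^sup>2 + \<Gamma> + \<gamma> + GG) \<and> (\<Sum>m<N. D m) \<le> C * (FF\<^sup>2 + \<Gamma> + \<gamma> + GG))"

text \<open>Let \<open>X\<close> be the largest slab mean. Telescoping the first family bounds the
  nodal quantities and the sums by \<open>Q\<close>, which contains \<open>X\<close> linearly with a
  small factor and through its square root. The second family, on a slab attaining \<open>X\<close>,
  bounds \<open>X\<close> by a multiple of \<open>Q\<close>; both occurrences are absorbed.\<close>

lemma slab_recursion_bound:
  fixes K \<rho>0 C1 :: real
  assumes K: "K \<ge> 1" and \<rho>0: "\<rho>0 > 0" and C1: "C1 \<ge> 0"
  shows "\<exists>C\<alpha>>0. \<exists>C>0. recursion_consts K \<rho>0 C1 C\<alpha> C"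
proof -
  \<comment> \<open>The multiple of \<open>Q\<close> bounding the second family plus
    \<open>h m\<close>: \<open>8\<close> from the nodal, coefficient, source and \<open>G\<close>
    terms, \<open>4 * C1 / \<rho>0\<close> from the jump, \<open>4 * K\<close> from the initial data
    and \<open>3 * K\<close> from the damping.\<close>
  define C3 where "C3 = 8 + 4 * C1 / \<rho>0 + 7 * K"
  have C3: "C3 \<ge> 8" using K C1 \<rho>0 by (simp add: C3_def)
  \<comment> \<open>Makes \<open>C3 * K * C\<alpha>\<close> equal to \<open>\<rho>0 / 16\<close>,
    one sixth of the available \<open>3 / 8 * \<rho>0\<close>.\<close>
  define C\<alpha> where "C\<alpha> = \<rho>0 / (16 * C3 * K)"
  have C\<alpha>: "C\<alpha> > 0" using C3 K \<rho>0 by (simp add: C\<alpha>_def)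
  define C4 where "C4 = C3 * (1 + 1 / \<rho>0) + 4 * C3\<^sup>2 * K / \<rho>0"
  have C4: "C4 > 0" unfolding C4_def using C3 K \<rho>0 by (intro add_pos_nonneg mult_pos_pos) (auto simp: add_pos_pos)
  define C5 where "C5 = 4 * C4 / \<rho>0"
  have C5: "C5 > 0" using C4 \<rho>0 by (simp add: C5_def)
  define C6 where "C6 = (1 + 1 / \<rho>0) + K * C\<alpha> * C5 + (K * C5 + 1)"
  have C6: "C6 > 0" unfolding C6_def using K C5 C\<alpha> \<rho>0 by (intro add_pos_pos) auto
  define C where "C = C5 + C3 * C6 + 2 * C6 + 4 / \<rho>0 * C6"
  have C: "C > 0" unfolding C_def using C3 C5 C6 \<rho>0 by (intro add_pos_pos mult_pos_pos) auto
  show ?thesis unfolding recursion_consts_def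
  proof (rule exI[of _ C\<alpha>], rule conjI[OF C\<alpha>], rule exI[of _ C], rule conjI[OF C], intro allI impI, goal_cases)
    case (1 N S D J B r s G A h \<Gamma> \<gamma> FF GG \<kappa>)
    have nn: "\<And>m. m < N \<Longrightarrow> 0 \<le> S m" "\<And>m. m < N \<Longrightarrow> 0 \<le> D m" "\<And>m. m < N \<Longrightarrow> 0 \<le> J m"
      "\<And>m. m < N \<Longrightarrow> 0 \<le> r m" "\<And>m. m < N \<Longrightarrow> 0 \<le> s m" "\<And>m. m < N \<Longrightarrow> 0 \<le> G m" "\<And>m. m < N \<Longrightarrow> 0 \<le> B m + h m"
      using 1(1) by auto
    have nn2: "\<And>m. m \<le> N \<Longrightarrow> 0 \<le> A m" "\<And>m. m \<le> N \<Longrightarrow> 0 \<le> h m" using 1(2) by auto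
    have A0: "A 0 = 0" and \<Gamma>0: "0 \<le> \<Gamma>" and \<kappa>: "0 \<le> \<kappa>" by fact+
    have I: "A (Suc m) / 2 + h (Suc m) / 2 + \<rho>0 / 4 * J m + D m / 2
      \<le> A m / 2 + h m / 2 + K * \<kappa> * r m * S m + sqrt (K * S m) * s m + (if m = 0 then \<Gamma> / \<rho>0 else 0) + G m / 2"
      if "m < N" for m using 1(6) that by blast
    have II: "3 / 8 * \<rho>0 * S m + B m
      \<le> C1 * J m + A m + 2 * K * \<kappa> * r m * S m + (if m = 0 then 4 * K / \<rho>0 * \<Gamma> else 0)
        + sqrt (K * S m) * s m + 3 / 2 * K * D m + G m / 2" if "m < N" for m using 1(7) that by blast
    have h0: "h 0 \<le> \<gamma>" and sF: "(\<Sum>m<N. s m) \<le> FF" and sG: "(\<Sum>m<N. G m) \<le> GG"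
      and sr: "\<kappa> * (\<Sum>m<N. r m) \<le> C\<alpha>" and N: "1 \<le> N" by fact+
    define X where "X = Max (S ` {..<N})"
    have SX: "S m \<le> X" if "m < N" for m unfolding X_def using that by (intro Max_ge) auto
    have "X \<in> S ` {..<N}" unfolding X_def using N by (intro Max_in) (auto simp: lessThan_empty_iff)
    then obtain mx where mx: "mx < N" "X = S mx" by auto
    have X0: "X \<ge> 0" using mx nn by simp
    have \<gamma>0: "0 \<le> \<gamma>" using h0 nn2(2)[of 0] by simp
    have GG0: "0 \<le> GG" using sG sum_nonneg[of "{..<N}" G] nn(6) by fastforce
    have FF0: "0 \<le> FF" using sF sum_nonneg[of "{..<N}" s] nn(5) by fastforce
    have part: "sum y {..<n} \<le> sum y {..<N}" if "n \<le> N" "\<And>m. m < N \<Longrightarrow> 0 \<le> y m" for y :: "nat \<Rightarrow> real" and n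
      using that by (intro sum_mono2) auto
    have single: "y m \<le> sum y {..<N}" if "m < N" "\<And>m. m < N \<Longrightarrow> 0 \<le> y m" for y :: "nat \<Rightarrow> real" and m
      using that by (intro member_le_sum) auto
    \<comment> \<open>The telescoped right-hand side with every slab mean replaced by
      \<open>X\<close> and every sum of data by its bound.\<close>
    define Q where "Q = \<gamma> / 2 + K * C\<alpha> * X + sqrt (K * X) * FF + \<Gamma> / \<rho>0 + GG / 2"
    have KX: "K * X \<ge> 0" using K X0 by simp
    have Qparts: "0 \<le> \<gamma> / 2" "0 \<le> K * C\<alpha> * X" "0 \<le> sqrt (K * X) * FF" "0 \<le> \<Gamma> / \<rho>0" "0 \<le> GG / 2"
      using \<gamma>0 K C\<alpha> X0 FF0 \<Gamma>0 \<rho>0 GG0 by auto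
    have Q0: "Q \<ge> 0" using Qparts by (simp add: Q_def)
    have tele: "A n / 2 + h n / 2 + \<rho>0 / 4 * (\<Sum>m<n. J m) + (\<Sum>m<n. D m) / 2
       \<le> h 0 / 2 + K * X * (\<kappa> * (\<Sum>m<n. r m)) + sqrt (K * X) * (\<Sum>m<n. s m) + \<Gamma> / \<rho>0 + (\<Sum>m<n. G m) / 2" if "n \<le> N" for n
    proof -
      have "A n / 2 + h n / 2 + \<rho>0 / 4 * (\<Sum>m<n. J m) + (\<Sum>m<n. D m) / 2
         \<le> h 0 / 2 + K * X * (\<kappa> * (\<Sum>m<n. r m)) + sqrt (K * X) * (\<Sum>m<n. s m) + (if n = 0 then 0 else \<Gamma> / \<rho>0) + (\<Sum>m<n. G m) / 2"
        using that
      proof (induction n)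
        case 0
        then show ?case by (simp add: A0)
      next
        case (Suc n)
        then have n: "n < N" by simp
        have "K * \<kappa> * r n * S n \<le> K * \<kappa> * r n * X"
          using SX[OF n] K \<kappa> nn(4)[OF n] by (intro mult_left_mono) auto
        moreover have "sqrt (K * S n) * s n \<le> sqrt (K * X) * s n"
          using SX[OF n] K nn(5)[OF n] by (intro mult_right_mono) auto
        moreover have "K * X * (\<kappa> * (\<Sum>m<Suc n. r m)) = K * X * (\<kappa> * (\<Sum>m<n. r m)) + K * \<kappa> * r n * X"
          "sqrt (K * X) * (\<Sum>m<Suc n. s m) = sqrt (K * X) * (\<Sum>m<n. s m) + sqrt (K * X) * s n"
          "\<rho>0 / 4 * (\<Sum>m<Suc n. J m) = \<rho>0 / 4 * (\<Sum>m<n. J m) + \<rho>0 / 4 * J n"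
          "(\<Sum>m<Suc n. D m) / 2 = (\<Sum>m<n. D m) / 2 + D n / 2"
          "(\<Sum>m<Suc n. G m) / 2 = (\<Sum>m<n. G m) / 2 + G n / 2"
          by (simp_all add: algebra_simps add_divide_distrib)
        moreover have "(if n = 0 then 0 else \<Gamma> / \<rho>0) + (if n = 0 then \<Gamma> / \<rho>0 else 0) = (if Suc n = 0 then 0 else \<Gamma> / \<rho>0)"
          by simp
        ultimately show ?case using I[OF n] Suc.IH n by linarith
      qed
      also have "(if n = 0 then 0 else \<Gamma> / \<rho>0) \<le> \<Gamma> / \<rho>0" using \<Gamma>0 \<rho>0 by simp
      finally show ?thesis by simp
    qed
    have Qn: "A n / 2 + h n / 2 + \<rho>0 / 4 * (\<Sum>m<n. J m) + (\<Sum>m<n. D m) / 2 \<le> Q" if n: "n \<le> N" for n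
    proof -
      have "\<kappa> * (\<Sum>m<n. r m) \<le> C\<alpha>" using sr mult_left_mono[OF part[where y=r, OF n nn(4)] \<kappa>] by simp
      then have "K * X * (\<kappa> * (\<Sum>m<n. r m)) \<le> K * X * C\<alpha>" using KX by (intro mult_left_mono)
      moreover have "sqrt (K * X) * (\<Sum>m<n. s m) \<le> sqrt (K * X) * FF"
        using part[where y=s, OF n nn(5)] sF KX by (intro mult_left_mono) auto
      moreover have "(\<Sum>m<n. G m) \<le> GG" using part[where y=G, OF n nn(6)] sG by simp
      moreover have "K * X * C\<alpha> = K * C\<alpha> * X" by simp
      ultimately show ?thesis using tele[OF n] h0 unfolding Q_def by linarith
    qed
    have sumJ0: "0 \<le> \<rho>0 / 4 * (\<Sum>m<n. J m)" "0 \<le> (\<Sum>m<n. D m)" if "n \<le> N" for n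
      using that nn \<rho>0 by (auto intro!: mult_nonneg_nonneg sum_nonneg)
    have hQ: "h n \<le> 2 * Q" "A n \<le> 2 * Q" if "n \<le> N" for n
      using Qn[OF that] sumJ0[OF that] nn2[OF that] by linarith+
    have JQ: "(\<Sum>m<N. J m) \<le> 4 / \<rho>0 * Q" and DQ: "(\<Sum>m<N. D m) \<le> 2 * Q"
    proof -
      have "\<rho>0 / 4 * (\<Sum>m<N. J m) \<le> Q" using Qn[of N] sumJ0[of N] nn2[of N] by linarith
      then show "(\<Sum>m<N. J m) \<le> 4 / \<rho>0 * Q" using \<rho>0 by (simp add: field_simps)
      show "(\<Sum>m<N. D m) \<le> 2 * Q" using Qn[of N] sumJ0[of N] nn2[of N] by linarith
    qed
    have SB: "3 / 8 * \<rho>0 * S m + (B m + h m) \<le> C3 * Q" if m: "m < N" for m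
    proof -
      have "C1 * J m \<le> C1 * (4 / \<rho>0 * Q)" using single[where y=J, OF m nn(3)] JQ C1 by (intro mult_left_mono) auto
      moreover have "2 * K * \<kappa> * r m * S m \<le> 2 * Q"
      proof -
        have "\<kappa> * r m \<le> C\<alpha>" using sr mult_left_mono[OF single[where y=r, OF m nn(4)] \<kappa>] by simp
        then have "K * (\<kappa> * r m) * S m \<le> K * C\<alpha> * X"
          using SX[OF m] K \<kappa> nn(1,4)[OF m] C\<alpha> by (intro mult_mono) auto
        then show ?thesis using Qparts by (simp add: Q_def mult.assoc)
      qed
      moreover have "(if m = 0 then 4 * K / \<rho>0 * \<Gamma> else 0) \<le> 4 * K * Q"
      proof -
        have "\<Gamma> / \<rho>0 \<le> Q" using Qparts by (simp add: Q_def)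
        then have "4 * K * (\<Gamma> / \<rho>0) \<le> 4 * K * Q" using K by (intro mult_left_mono) auto
        then show ?thesis using K Q0 by simp
      qed
      moreover have "sqrt (K * S m) * s m \<le> Q"
      proof -
        have "sqrt (K * S m) * s m \<le> sqrt (K * X) * FF"
          using SX[OF m] single[where y=s, OF m nn(5)] sF K nn(5)[OF m] KX by (intro mult_mono) auto
        then show ?thesis using Qparts by (simp add: Q_def)
      qed
      moreover have "3 / 2 * K * D m \<le> 3 * K * Q"
      proof -
        have "D m \<le> 2 * Q" using single[where y=D, OF m nn(2)] DQ by simp
        then have "3 / 2 * K * D m \<le> 3 / 2 * K * (2 * Q)" using K by (intro mult_left_mono) auto
        then show ?thesis by simp
      qed
      moreover have "G m / 2 \<le> Q"
        using single[where y=G, OF m nn(6)] sG Qparts unfolding Q_def by linarith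
      moreover have "h m \<le> 2 * Q" "A m \<le> 2 * Q" using hQ m by auto
      moreover have "C3 * Q = 8 * Q + C1 * (4 / \<rho>0 * Q) + 3 * K * Q + 4 * K * Q"
        by (simp add: C3_def algebra_simps)
      ultimately show ?thesis using II[OF m] by linarith
    qed
    define RR where "RR = FF\<^sup>2 + \<Gamma> + \<gamma> + GG"
    have RR0: "0 \<le> RR" "FF\<^sup>2 \<le> RR" "\<Gamma> \<le> RR" "\<gamma> / 2 + GG / 2 \<le> RR" 
      unfolding RR_def using \<Gamma>0 \<gamma>0 GG0 zero_le_power2[of FF] by linarith+
    have base: "\<gamma> / 2 + \<Gamma> / \<rho>0 + GG / 2 \<le> (1 + 1 / \<rho>0) * RR"
    proof -
      have "\<Gamma> / \<rho>0 \<le> RR / \<rho>0" using RR0 \<rho>0 by (intro divide_right_mono) auto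
      then show ?thesis using RR0(4) by (simp add: distrib_right)
    qed
    have young: "sqrt (K * X) * FF \<le> (1/2) * (l * (K * X) + FF\<^sup>2 / l)" if "l > 0" for l
      using young_inner[OF that, of "sqrt (K * X)" FF] KX FF0 by (simp add: abs_mult)
    have XR: "X \<le> C5 * RR"
    proof -
      have "3 / 8 * \<rho>0 * X \<le> C3 * Q" using SB[OF mx(1)] nn(7)[OF mx(1)] mx(2) by simp
      also have "C3 * Q = C3 * (\<gamma> / 2 + \<Gamma> / \<rho>0 + GG / 2) + C3 * (K * C\<alpha> * X) + C3 * (sqrt (K * X) * FF)"
        by (simp add: Q_def algebra_simps)
      also have "\<dots> \<le> C3 * ((1 + 1 / \<rho>0) * RR) + \<rho>0 / 16 * X + (\<rho>0 / 16 * X + 4 * C3\<^sup>2 * K / \<rho>0 * RR)"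
      proof (intro add_mono)
        show "C3 * (\<gamma> / 2 + \<Gamma> / \<rho>0 + GG / 2) \<le> C3 * ((1 + 1 / \<rho>0) * RR)"
          using base C3 by (intro mult_left_mono) auto
        show "C3 * (K * C\<alpha> * X) \<le> \<rho>0 / 16 * X" using C3 K by (simp add: C\<alpha>_def)
        \<comment> \<open>The weight is chosen so that the part with \<open>X\<close> is again
          \<open>\<rho>0 / 16 * X\<close>; after both absorptions
          \<open>1 / 4 * (\<rho>0 * X)\<close> remains on the left.\<close>
        have "C3 * (sqrt (K * X) * FF) \<le> C3 * ((1/2) * (\<rho>0 / (8 * C3 * K) * (K * X) + FF\<^sup>2 / (\<rho>0 / (8 * C3 * K))))"
          using C3 K \<rho>0 by (intro mult_left_mono young) auto
        also have "\<dots> = \<rho>0 / 16 * X + 4 * C3\<^sup>2 * K / \<rho>0 * FF\<^sup>2"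
          using C3 K \<rho>0 by (simp add: field_simps power2_eq_square)
        also have "\<dots> \<le> \<rho>0 / 16 * X + 4 * C3\<^sup>2 * K / \<rho>0 * RR"
          using RR0(2) K \<rho>0 by (intro add_left_mono mult_left_mono) auto
        finally show "C3 * (sqrt (K * X) * FF) \<le> \<rho>0 / 16 * X + 4 * C3\<^sup>2 * K / \<rho>0 * RR" .
      qed
      finally have "3 / 8 * \<rho>0 * X \<le> C3 * ((1 + 1 / \<rho>0) * RR) + \<rho>0 / 16 * X + (\<rho>0 / 16 * X + 4 * C3\<^sup>2 * K / \<rho>0 * RR)" .
      moreover have "C4 * RR = C3 * ((1 + 1 / \<rho>0) * RR) + 4 * C3\<^sup>2 * K / \<rho>0 * RR"
        by (simp add: C4_def distrib_right mult.assoc)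
      moreover have "3 / 8 * \<rho>0 * X = 1 / 4 * (\<rho>0 * X) + \<rho>0 / 16 * X + \<rho>0 / 16 * X" by simp
      ultimately have "1 / 4 * (\<rho>0 * X) \<le> C4 * RR" by linarith
      then show ?thesis using \<rho>0 by (simp add: C5_def field_simps)
    qed
    have QR: "Q \<le> C6 * RR"
    proof -
      have "K * C\<alpha> * X \<le> K * C\<alpha> * (C5 * RR)" using XR K C\<alpha> by (intro mult_left_mono) auto
      moreover have "sqrt (K * X) * FF \<le> (K * C5 + 1) * RR"
      proof -
        have "sqrt (K * X) * FF \<le> (1/2) * (K * X + FF\<^sup>2)" using young[of 1] by simp
        also have "\<dots> \<le> K * X + FF\<^sup>2" using KX by simp
        also have "\<dots> \<le> K * (C5 * RR) + RR" using XR K RR0 by (intro add_mono mult_left_mono) auto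
        finally show ?thesis by (simp add: algebra_simps)
      qed
      ultimately show ?thesis using base unfolding Q_def C6_def by (simp add: algebra_simps)
    qed
    have coef: "C5 * RR \<le> C * RR" "C3 * (C6 * RR) \<le> C * RR" "2 * (C6 * RR) \<le> C * RR" "4 / \<rho>0 * (C6 * RR) \<le> C * RR"
    proof -
      have p: "0 \<le> C5 * RR" "0 \<le> C3 * (C6 * RR)" "0 \<le> 2 * (C6 * RR)" "0 \<le> 4 / \<rho>0 * (C6 * RR)"
        using C3 C5 C6 RR0 \<rho>0 by auto
      have "C * RR = C5 * RR + C3 * (C6 * RR) + 2 * (C6 * RR) + 4 / \<rho>0 * (C6 * RR)"
        by (simp add: C_def algebra_simps)
      then show "C5 * RR \<le> C * RR" "C3 * (C6 * RR) \<le> C * RR" "2 * (C6 * RR) \<le> C * RR" "4 / \<rho>0 * (C6 * RR) \<le> C * RR"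
        using p by linarith+
    qed
    have Bh: "B m + h m \<le> C * RR" if m: "m < N" for m
    proof -
      have "0 \<le> 3 / 8 * \<rho>0 * S m" using \<rho>0 nn(1)[OF m] by simp
      then have "B m + h m \<le> C3 * Q" using SB[OF m] by linarith
      also have "\<dots> \<le> C3 * (C6 * RR)" using QR C3 by (intro mult_left_mono) auto
      finally show ?thesis using coef by simp
    qed
    have Jc: "4 / \<rho>0 * Q \<le> 4 / \<rho>0 * (C6 * RR)" using QR \<rho>0 by (intro mult_left_mono) auto
    show ?case unfolding RR_def[symmetric]
    proof (intro conjI allI impI)
      show "S m \<le> C * RR" if "m < N" for m using SX[OF that] XR coef by linarith
      show "B m + h m \<le> C * RR" if "m < N" for m by (rule Bh[OF that])
      show "h m \<le> C * RR" if "m \<le> N" for m using hQ[OF that] QR coef by linarith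
      show "(\<Sum>m<N. J m) \<le> C * RR" using JQ Jc coef by linarith
      show "(\<Sum>m<N. D m) \<le> C * RR" using DQ QR coef by linarith
    qed
  qed
qed

section \<open>Localization of the scheme\<close>

context slab
begin

lemma dtp_fields: "dtp u = v" "dtp v = dv" "dtp w = dw"
proof -
  show "dtp u = v"
    using dtp_spoly[OF ab, of q cu] by (intro ext) (simp add: u_def[abs_def] v_def)
  show "dtp v = dv"
    using dtp_spoly[OF ab, of "q - 1" "\<lambda>j x. sdcoef a b (\<lambda>i. cu i x) j"] q
    by (intro ext) (simp add: v_def[abs_def] dv_def)
  show "dtp w = dw"
    using dtp_spoly[OF ab, of "q - 1" "\<lambda>j x. tcoef q (sdcoef a b (\<lambda>i. cu i x)) j"] q
    by (intro ext) (simp add: w_def[abs_def] dw_def)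
qed

lemma dtp_momentum: "dtp (\<lambda>y s. \<rho> y s * v y s) x t = k * \<alpha>' x t * v x t + \<rho> x t * dv x t"
  using DERIV_mult[OF derivs(3)[of x t UNIV, folded has_real_derivative_iff_has_vector_derivative]
      derivs(1)[of x t UNIV, folded has_real_derivative_iff_has_vector_derivative]]
  unfolding dtp_def by (intro DERIV_imp_deriv) (simp add: mult.commute)

lemma dtp_coefficient: "dtp (\<lambda>x t. spoly a b (Suc q) (\<lambda>j. ca j x) t) = \<alpha>'"
  using dtp_spoly[OF ab, of q ca] by (intro ext) (simp add: \<alpha>'_def)

lemma Vh_coeffs:
  "j < q \<Longrightarrow> Vh M \<Omega> p (\<lambda>x. sdcoef a b (\<lambda>i. cu i x) j)"
  "j < q \<Longrightarrow> Vh M \<Omega> p (\<lambda>x. tcoef q (sdcoef a b (\<lambda>i. cu i x)) j)"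
proof -
  show *: "Vh M \<Omega> p (\<lambda>x. sdcoef a b (\<lambda>i. cu i x) j)" if "j < q" for j
    using that by (intro Vh_sdcoef cu) auto
  show "Vh M \<Omega> p (\<lambda>x. tcoef q (sdcoef a b (\<lambda>i. cu i x)) j)" if "j < q"
    using Vh_tcoef[where d = "\<lambda>i x. sdcoef a b (\<lambda>i. cu i x) i", OF * that] by simp
qed

lemma Ppiece_tests: "Ppiece M \<Omega> p (q - 1) v" "Ppiece M \<Omega> p (q - 1) w"
proof -
  show "Ppiece M \<Omega> p (q - 1) v"
    using Ppiece_spoly[OF ab, of "q - 1" M \<Omega> p "\<lambda>j x. sdcoef a b (\<lambda>i. cu i x) j"] Vh_coeffs q
    by (simp add: v_def[abs_def])
  show "Ppiece M \<Omega> p (q - 1) w"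
    using Ppiece_spoly[OF ab, of "q - 1" M \<Omega> p "\<lambda>j x. tcoef q (sdcoef a b (\<lambda>i. cu i x)) j"] Vh_coeffs q
    by (simp add: w_def[abs_def])
qed

lemma gradx_fields:
  assumes x: "x \<in> \<Omega>r"
  shows "gradx u x t = Gu x t" "gradx v x t = Gv x t" "gradx w x t = Gw x t"
proof -
  have diff: "y differentiable (at x)" if "Vh M \<Omega> p y" for y
    using Vh_differentiable[OF that] x by (simp add: \<Omega>r_def)
  show "gradx u x t = Gu x t"
    using gradx_spoly[of "Suc q" cu x a b t] diff cu by (simp add: u_def[abs_def] Gu_def)
  have s: "sgrad (\<lambda>y. sdcoef a b (\<lambda>i. cu i y) j) x = sdcoef a b (\<lambda>i. sgrad (cu i) x) j" if "j < q" for j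
    using that by (intro sgrad_sdcoef diff cu) auto
  have ws: "sgrad (\<lambda>y. tcoef q (sdcoef a b (\<lambda>i. cu i y)) j) x = tcoef q (sdcoef a b (\<lambda>i. sgrad (cu i) x)) j" if j: "j < q" for j
  proof -
    have "sgrad (\<lambda>y. tcoef q (\<lambda>i. sdcoef a b (\<lambda>i. cu i y) i) j) x = tcoef q (\<lambda>i. sgrad (\<lambda>y. sdcoef a b (\<lambda>i. cu i y) i) x) j"
      using sgrad_tcoef[where d = "\<lambda>i y. sdcoef a b (\<lambda>i. cu i y) i" and x = x, OF diff[OF Vh_coeffs(1)] j] .
    also have "\<dots> = tcoef q (sdcoef a b (\<lambda>i. sgrad (cu i) x)) j"
      using j by (simp add: tcoef_def s)
    finally show ?thesis by simp
  qed
  have "gradx (\<lambda>y t. spoly a b q (\<lambda>j. sdcoef a b (\<lambda>i. cu i y) j) t) x t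
      = spoly a b q (\<lambda>j. sgrad (\<lambda>y. sdcoef a b (\<lambda>i. cu i y) j) x) t"
    by (rule gradx_spoly) (rule diff[OF Vh_coeffs(1)])
  also have "\<dots> = spoly a b q (sdcoef a b (\<lambda>i. sgrad (cu i) x)) t"
    unfolding spoly_def tpoly_def by (simp add: s)
  finally show "gradx v x t = Gv x t" by (simp add: v_def[abs_def] Gv_def)
  have "gradx (\<lambda>y t. spoly a b q (\<lambda>j. tcoef q (sdcoef a b (\<lambda>i. cu i y)) j) t) x t
      = spoly a b q (\<lambda>j. sgrad (\<lambda>y. tcoef q (sdcoef a b (\<lambda>i. cu i y)) j) x) t"
    by (rule gradx_spoly) (rule diff[OF Vh_coeffs(2)])
  also have "\<dots> = spoly a b q (tcoef q (sdcoef a b (\<lambda>i. sgrad (cu i) x))) t"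
    unfolding spoly_def tpoly_def by (simp add: ws)
  finally show "gradx w x t = Gw x t" by (simp add: w_def[abs_def] Gw_def)
qed

lemma Oint_reg: "Oint \<Omega> F = Oint \<Omega>r F"
  by (rule Oint_null_diff[OF \<Omega>r(3,4)])

lemma Qint_reg: "Qint \<Omega> s t F = Qint \<Omega>r s t F"
  by (rule Qint_null_diff[OF \<Omega>r(3,4)])

lemma r_lebesgue: "(LINT t:{a..b}|lebesgue. R t) = r"
  unfolding r_def
  by (intro set_lebesgue_integral_eq_integral(2) absolutely_integrable_continuous_real R(1))

end

section \<open>Testing on a single slab\<close>

lemma Oint_cong: "(\<And>x. x \<in> S \<Longrightarrow> F x = G x) \<Longrightarrow> Oint S F = Oint S G"
  unfolding Oint_def set_lebesgue_integral_def
  by (intro Bochner_Integration.integral_cong) (auto simp: indicator_def)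

lemma Qint_cong: "(\<And>x t. x \<in> S \<Longrightarrow> F x t = G x t) \<Longrightarrow> Qint S a b F = Qint S a b G"
  unfolding Qint_def set_lebesgue_integral_def
  by (intro Bochner_Integration.integral_cong) (auto simp: indicator_def)

lemma Oint_zero [simp]: "Oint S (\<lambda>x. 0) = 0"
  by (simp add: Oint_def)

lemma Qint_zero [simp]: "Qint S a b (\<lambda>x t. 0) = 0"
  by (simp add: Qint_def)

lemma gradx_zero [simp]: "gradx (\<lambda>x t. 0) y s = 0"
  by (simp add: gradx_def)

lemma dtp_zero [simp]: "dtp (\<lambda>x t. 0) y s = 0"
  by (simp add: dtp_def)

lemma sum_single:
  assumes "finite I" "n \<in> I" "\<And>m. m \<in> I \<Longrightarrow> m \<noteq> n \<Longrightarrow> F m = 0"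
  shows "sum F I = F n"
proof -
  have "sum F I = sum F {n}" using assms by (intro sum.mono_neutral_right) auto
  then show ?thesis by simp
qed

text \<open>Test functions may be discontinuous in time, so extension by zero from one slab stays in
  the test space.\<close>

definition single_piece :: "nat \<Rightarrow> ('a \<Rightarrow> real \<Rightarrow> real) \<Rightarrow> nat \<Rightarrow> 'a \<Rightarrow> real \<Rightarrow> real" where
  "single_piece n y = (\<lambda>m. if m = n then y else (\<lambda>_ _. 0))"

text \<open>Jumps are tested with the value from the right, so only the jump at the left end of the
  slab survives. Absorbing its sign gives new trace minus old trace, and the initial term has the
  same form with old trace 0. Continuity of the coefficient at the node allows its value to be taken
  from the slab itself.\<close>

lemma Bform_single_piece:
  assumes n: "n \<in> {1..N}" and tt0: "tt 0 = 0"
    and A: "\<forall>m\<in>{1..<N}. \<forall>x. A m x (tt m) = A (Suc m) x (tt m)"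
  shows "Bform \<Omega> k c \<delta> N tt A U (single_piece n y) (\<lambda>_. 0) =
     Qint \<Omega> (tt (n - 1)) (tt n) (\<lambda>x t. dtp (\<lambda>y s. (1 + k * A n y s) * dtp (U n) y s) x t * y x t)
   + Oint \<Omega> (\<lambda>x. (1 + k * A n x (tt (n - 1))) *
        (dtp (U n) x (tt (n - 1)) - (if n = 1 then 0 else dtp (U (n - 1)) x (tt (n - 1)))) * y x (tt (n - 1)))
   + c\<^sup>2 * Qint \<Omega> (tt (n - 1)) (tt n) (\<lambda>x t. gradx (U n) x t \<bullet> gradx y x t)
   + \<delta> * Qint \<Omega> (tt (n - 1)) (tt n) (\<lambda>x t. gradx (dtp (U n)) x t \<bullet> gradx y x t)"
proof -
  note sp = single_piece_def
  have s1: "(\<Sum>m=1..N. Qint \<Omega> (tt (m - 1)) (tt m)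
          (\<lambda>x t. dtp (\<lambda>y s. (1 + k * A m y s) * dtp (U m) y s) x t * single_piece n y m x t))
     = Qint \<Omega> (tt (n - 1)) (tt n) (\<lambda>x t. dtp (\<lambda>y s. (1 + k * A n y s) * dtp (U n) y s) x t * y x t)"
    using n by (subst sum_single[of _ n]) (auto simp: sp)
  have s2: "(\<Sum>m=1..N. Qint \<Omega> (tt (m - 1)) (tt m) (\<lambda>x t. gradx (U m) x t \<bullet> gradx (single_piece n y m) x t))
     = Qint \<Omega> (tt (n - 1)) (tt n) (\<lambda>x t. gradx (U n) x t \<bullet> gradx y x t)"
    using n by (subst sum_single[of _ n]) (auto simp: sp)
  have s3: "(\<Sum>m=1..N. Qint \<Omega> (tt (m - 1)) (tt m) (\<lambda>x t. gradx (dtp (U m)) x t \<bullet> gradx (single_piece n y m) x t))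
     = Qint \<Omega> (tt (n - 1)) (tt n) (\<lambda>x t. gradx (dtp (U n)) x t \<bullet> gradx y x t)"
    using n by (subst sum_single[of _ n]) (auto simp: sp)
  have s4: "- (\<Sum>m\<in>{1..<N}. Oint \<Omega> (\<lambda>x. (1 + k * A m x (tt m)) *
          (dtp (U m) x (tt m) - dtp (U (Suc m)) x (tt m)) * single_piece n y (Suc m) x (tt m)))
      + Oint \<Omega> (\<lambda>x. (1 + k * A 1 x 0) * dtp (U 1) x 0 * single_piece n y 1 x 0)
     = Oint \<Omega> (\<lambda>x. (1 + k * A n x (tt (n - 1))) *
        (dtp (U n) x (tt (n - 1)) - (if n = 1 then 0 else dtp (U (n - 1)) x (tt (n - 1)))) * y x (tt (n - 1)))"
  proof (cases "n = 1")
    case True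
    have "(\<Sum>m\<in>{1..<N}. Oint \<Omega> (\<lambda>x. (1 + k * A m x (tt m)) *
          (dtp (U m) x (tt m) - dtp (U (Suc m)) x (tt m)) * single_piece n y (Suc m) x (tt m))) = 0"
      using True by (intro sum.neutral) (auto simp: sp)
    then show ?thesis using True tt0 by (simp add: sp)
  next
    case False
    then obtain m where m: "n = Suc m" "m \<in> {1..<N}" using n by (cases n) auto
    have "(\<Sum>m\<in>{1..<N}. Oint \<Omega> (\<lambda>x. (1 + k * A m x (tt m)) *
          (dtp (U m) x (tt m) - dtp (U (Suc m)) x (tt m)) * single_piece n y (Suc m) x (tt m)))
       = Oint \<Omega> (\<lambda>x. (1 + k * A m x (tt m)) * (dtp (U m) x (tt m) - dtp (U (Suc m)) x (tt m)) * y x (tt m))"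
      using m by (subst sum_single[of _ m]) (auto simp: sp)
    moreover have "- Oint \<Omega> F = Oint \<Omega> (\<lambda>x. - F x)" for F
      by (simp add: Oint_def set_lebesgue_integral_def)
    moreover have "- ((1 + k * A m x (tt m)) * (dtp (U m) x (tt m) - dtp (U (Suc m)) x (tt m)) * y x (tt m))
       = (1 + k * A n x (tt m)) * (dtp (U n) x (tt m) - dtp (U m) x (tt m)) * y x (tt m)" for x
      using A m(2) by (simp add: m(1) algebra_simps)
    ultimately show ?thesis using m by (simp add: sp)
  qed
  show ?thesis
    unfolding Bform_def s1 s2 s3 using s4 by simp
qed

lemma Lform_single_piece:
  assumes n: "n \<in> {1..N}" and tt0: "tt 0 = 0"
  shows "Lform \<Omega> \<delta> N tt f g G \<xi> G0 (single_piece n y) (\<lambda>_. 0) =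
     Qint \<Omega> (tt (n - 1)) (tt n) (\<lambda>x t. f x t * y x t)
   + Oint \<Omega> (\<lambda>x. (if n = 1 then g x else 0) * y x (tt (n - 1)))
   + \<delta> * Qint \<Omega> (tt (n - 1)) (tt n) (\<lambda>x t. G x t \<bullet> gradx y x t)
   + Qint \<Omega> (tt (n - 1)) (tt n) (\<lambda>x t. \<xi> x t * dtp y x t)"
proof -
  note sp = single_piece_def
  have s1: "(\<Sum>m=1..N. Qint \<Omega> (tt (m - 1)) (tt m) (\<lambda>x t. f x t * single_piece n y m x t))
     = Qint \<Omega> (tt (n - 1)) (tt n) (\<lambda>x t. f x t * y x t)"
    using n by (subst sum_single[of _ n]) (auto simp: sp)
  have s2: "(\<Sum>m=1..N. Qint \<Omega> (tt (m - 1)) (tt m) (\<lambda>x t. G x t \<bullet> gradx (single_piece n y m) x t))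
     = Qint \<Omega> (tt (n - 1)) (tt n) (\<lambda>x t. G x t \<bullet> gradx y x t)"
    using n by (subst sum_single[of _ n]) (auto simp: sp)
  have s3: "(\<Sum>m=1..N. Qint \<Omega> (tt (m - 1)) (tt m) (\<lambda>x t. \<xi> x t * dtp (single_piece n y m) x t))
     = Qint \<Omega> (tt (n - 1)) (tt n) (\<lambda>x t. \<xi> x t * dtp y x t)"
    using n by (subst sum_single[of _ n]) (auto simp: sp)
  have s4: "Oint \<Omega> (\<lambda>x. g x * single_piece n y 1 x 0)
     = Oint \<Omega> (\<lambda>x. (if n = 1 then g x else 0) * y x (tt (n - 1)))"
    using tt0 by (auto simp: sp)
  show ?thesis unfolding Lform_def s1 s2 s3 s4 by simp
qed

lemma Bform_initial: "Bform \<Omega> k c \<delta> N tt A U (\<lambda>_ _ _. 0) z = Oint \<Omega> (\<lambda>x. sgrad (\<lambda>y. U 1 y 0) x \<bullet> sgrad z x)"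
  by (simp add: Bform_def)

lemma Lform_initial: "Lform \<Omega> \<delta> N tt f g G \<xi> G0 (\<lambda>_ _ _. 0) z = Oint \<Omega> (\<lambda>x. G0 x \<bullet> sgrad z x)"
  by (simp add: Lform_def)

lemma Ppiece_zero: "Ppiece M \<Omega> p q (\<lambda>_ _. 0)"
  unfolding Ppiece_def by (intro exI[of _ "\<lambda>_ _. 0"]) (auto simp: Vh_zero)

lemma Ppiece_slice:
  assumes "Ppiece M \<Omega> p q U"
  shows "Vh M \<Omega> p (\<lambda>x. U x t)"
proof -
  obtain cf where cf: "\<forall>j\<le>q. Vh M \<Omega> p (cf j)" "\<And>x t. U x t = (\<Sum>j\<le>q. t ^ j * cf j x)"
    using assms unfolding Ppiece_def by blast
  have "Vh M \<Omega> p (\<lambda>x. \<Sum>j\<le>q. t ^ j * cf j x)"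
    using cf(1) by (intro Vh_sum Vh_cmult) auto
  then show ?thesis by (simp add: cf(2))
qed

section \<open>The time partition and the global quantities\<close>

lemma sum_set_integral_disjoint_le:
  fixes g :: "'c \<Rightarrow> real"
  assumes g: "set_integrable M A g" "\<And>x. x \<in> A \<Longrightarrow> 0 \<le> g x"
    and I: "finite I" "\<And>i. i \<in> I \<Longrightarrow> B i \<in> sets M" "\<And>i. i \<in> I \<Longrightarrow> B i \<subseteq> A" "disjoint_family_on B I"
  shows "(\<Sum>i\<in>I. LINT x:B i|M. g x) \<le> (LINT x:A|M. g x)"
proof -
  have gi: "set_integrable M (B i) g" if "i \<in> I" for i
    using g(1) I(2,3)[OF that] by (rule set_integrable_subset)
  have "(\<Sum>i\<in>I. LINT x:B i|M. g x) = (LINT x:(\<Union>i\<in>I. B i)|M. g x)"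
    using set_integral_finite_Union[OF I(1) I(4) gi I(2)] by simp
  also have "\<dots> \<le> (LINT x:A|M. g x)"
    unfolding set_lebesgue_integral_def
  proof (rule integral_mono)
    show "integrable M (\<lambda>x. indicator (\<Union>i\<in>I. B i) x *\<^sub>R g x)"
    proof -
      have "(\<Union>i\<in>I. B i) \<in> sets M" "(\<Union>i\<in>I. B i) \<subseteq> A" using I(1,2,3) by auto
      from set_integrable_subset[OF g(1) this] show ?thesis by (simp only: set_integrable_def)
    qed
    show "integrable M (\<lambda>x. indicator A x *\<^sub>R g x)" using g(1) by (simp add: set_integrable_def)
    show "indicator (\<Union>i\<in>I. B i) x *\<^sub>R g x \<le> indicator A x *\<^sub>R g x" for x
      using g(2) I(3) by (auto simp: indicator_def)
  qed
  finally show ?thesis .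
qed

lemma time_partition_mono:
  assumes "time_partition T N tt" "i \<le> j" "j \<le> N"
  shows "tt i \<le> tt j"
  using assms(2,3)
proof (induction j rule: dec_induct)
  case (step j)
  then have "tt j < tt (Suc j)" using assms(1) by (simp add: time_partition_def)
  then show ?case using step by simp
qed simp

lemma time_partition_disjoint:
  assumes "time_partition T N tt"
  shows "disjoint_family_on (\<lambda>m. {tt m<..<tt (Suc m)}) {..<N}"
  unfolding disjoint_family_on_def
proof (intro ballI impI)
  fix m n assume mn: "m \<in> {..<N}" "n \<in> {..<N}" "m \<noteq> n"
  then consider "Suc m \<le> n" | "Suc n \<le> m" by linarith
  then show "{tt m<..<tt (Suc m)} \<inter> {tt n<..<tt (Suc n)} = {}"
  proof cases
    case 1
    then show ?thesis using time_partition_mono[OF assms 1] mn by auto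
  next
    case 2
    then show ?thesis using time_partition_mono[OF assms 2] mn by auto
  qed
qed

lemma Ppiece_dtp:
  assumes "Ppiece M \<Omega> p q U" "q \<ge> 1"
  shows "Ppiece M \<Omega> p (q - 1) (dtp U)"
proof -
  obtain c where c: "\<And>j. j \<le> q \<Longrightarrow> Vh M \<Omega> p (c j)" "U = (\<lambda>x t. spoly 0 1 (Suc q) (\<lambda>j. c j x) t)"
    using Ppiece_obtain_spoly[OF zero_less_one assms(1)] by blast
  have "dtp U = (\<lambda>x t. spoly 0 1 (Suc (q - 1)) (\<lambda>j. sdcoef 0 1 (\<lambda>i. c i x) j) t)"
    unfolding c(2) using assms(2) by (intro ext) (simp add: dtp_spoly)
  moreover have "Vh M \<Omega> p (\<lambda>x. sdcoef 0 1 (\<lambda>i. c i x) j)" if "j \<le> q - 1" for j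
    using that assms(2) by (intro Vh_sdcoef c(1)) auto
  ultimately show ?thesis
    using Ppiece_spoly[OF zero_less_one, of "q - 1" M \<Omega> p "\<lambda>j x. sdcoef 0 1 (\<lambda>i. c i x) j"] by simp
qed

text \<open>Slabs are numbered from 0: slab \<open>m\<close> is \<open>(t\<^sub>m, t\<^sub>m\<^sub>+\<^sub>1)\<close> and carries the pieces with index \<open>Suc m\<close>.
  The trace \<open>vp 0\<close> before the initial time is 0, which turns the initial term of the scheme into a jump.\<close>
locale scheme =
  fixes M :: "'a::euclidean_space set set" and \<Omega> :: "'a set" and T k c \<delta> :: real and p q N :: nat
    and tt :: "nat \<Rightarrow> real" and A U :: "nat \<Rightarrow> 'a \<Rightarrow> real \<Rightarrow> real" and f :: "'a \<Rightarrow> real \<Rightarrow> real"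
    and g :: "'a \<Rightarrow> real" and G :: "'a \<Rightarrow> real \<Rightarrow> 'a" and \<xi> :: "'a \<Rightarrow> real \<Rightarrow> real" and G0 :: "'a \<Rightarrow> 'a"
    and K \<rho>0 \<rho>1 :: real
  assumes q: "q \<ge> 1" and dom: "open \<Omega>" "bounded \<Omega>" "\<Omega> \<noteq> {}" and mesh: "conforming_mesh M \<Omega>"
    and tt: "time_partition T N tt" and \<delta>: "0 \<le> \<delta>"
    and U: "Vht M \<Omega> p q N tt U" and A: "Vht M \<Omega> p q N tt A"
    and coef: "\<And>n x t. n \<in> {1..N} \<Longrightarrow> x \<in> \<Omega> \<Longrightarrow> t \<in> {tt (n - 1)..tt n} \<Longrightarrow> 0 < t \<Longrightarrow> t < T \<Longrightarrow>
        \<rho>0 \<le> 1 + k * A n x t \<and> 1 + k * A n x t \<le> \<rho>1"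
    and \<rho>0: "\<rho>0 > 0"
    and K: "K \<ge> 1" "sup_const q K TYPE(real)" "sup_const q K TYPE('a)" "value_const q K TYPE('a)"
    and f: "L1L2 \<Omega> T f" and g: "set_integrable lebesgue \<Omega> (\<lambda>x. (g x)\<^sup>2)"
    and G: "set_integrable lebesgue (\<Omega> \<times> {0<..<T}) (\<lambda>z. (norm (G (fst z) (snd z)))\<^sup>2)"
    and \<xi>: "L1L2 \<Omega> T \<xi>" and G0: "set_integrable lebesgue \<Omega> (\<lambda>x. (norm (G0 x))\<^sup>2)"
    and solution: "\<And>W z. Wht M \<Omega> p (q - 1) N W \<Longrightarrow> Vh M \<Omega> p z \<Longrightarrow>
        Bform \<Omega> k c \<delta> N tt A U W z = Lform \<Omega> \<delta> N tt f g G \<xi> G0 W z"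
begin

definition "S m = (1 / (tt (Suc m) - tt m)) * Qint \<Omega> (tt m) (tt (Suc m)) (\<lambda>x t. (dtp (U (Suc m)) x t)\<^sup>2)"
definition "D m = Qint \<Omega> (tt m) (tt (Suc m)) (\<lambda>x t. (norm (gradx (dtp (U (Suc m))) x t))\<^sup>2)"
definition "vp m x = (if m = 0 then 0 else dtp (U m) x (tt m))"
definition "J m = Oint \<Omega> (\<lambda>x. (dtp (U (Suc m)) x (tt m) - vp m x)\<^sup>2)"
definition "Am m = (if m = 0 then 0 else Oint \<Omega> (\<lambda>x. (1 + k * A m x (tt m)) * (dtp (U m) x (tt m))\<^sup>2))"
text \<open>By continuity in time the piece on either side of a node gives the same value; the left
  one is taken, except at the initial time, where only piece 1 exists.\<close>

definition "h m = Oint \<Omega> (\<lambda>x. (norm (gradx (U (if m = 0 then 1 else m)) x (tt m)))\<^sup>2)"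
definition "r m = (LINT t:{tt m..tt (Suc m)}|lebesgue. (SUP x\<in>\<Omega>. \<bar>dtp (A (Suc m)) x t\<bar>))"
definition "L1 y m = (LINT t:{tt m..tt (Suc m)}|lebesgue. sqrt (Oint \<Omega> (\<lambda>x. (y x t)\<^sup>2)))"
definition "src2 m = L1 f m + L1 \<xi> m / (tt (Suc m) - tt m)"
definition "GG m = Qint \<Omega> (tt m) (tt (Suc m)) (\<lambda>x t. (norm (G x t))\<^sup>2)"
definition "\<Gamma> = Oint \<Omega> (\<lambda>x. (g x)\<^sup>2)"

lemma tt_basic: "1 \<le> N" "tt 0 = 0" "tt N = T" "m < N \<Longrightarrow> tt m < tt (Suc m)" "m \<le> N \<Longrightarrow> 0 \<le> tt m" "m \<le> N \<Longrightarrow> tt m \<le> T"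
  using tt time_partition_mono[OF tt, of 0 m] time_partition_mono[OF tt, of m N]
  by (auto simp: time_partition_def)

text \<open>Nondegeneracy is assumed for times strictly between 0 and \<open>T\<close>. Each piece
  is a polynomial in time, so the bounds pass to the closed slab by continuity.\<close>

lemma coef_closed:
  assumes m: "m < N" and x: "x \<in> \<Omega>" and t: "t \<in> {tt m..tt (Suc m)}"
  shows "\<rho>0 \<le> 1 + k * A (Suc m) x t \<and> 1 + k * A (Suc m) x t \<le> \<rho>1"
proof -
  have ab: "tt m < tt (Suc m)" by (rule tt_basic(4)[OF m])
  have "Ppiece M \<Omega> p q (A (Suc m))" using A m by (simp add: Vht_def)
  then obtain cf where "\<And>x t. A (Suc m) x t = (\<Sum>j\<le>q. t ^ j * cf j x)" unfolding Ppiece_def by blast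
  then have cont: "continuous_on {tt m..tt (Suc m)} (\<lambda>t. 1 + k * A (Suc m) x t)"
    by (auto intro!: continuous_intros)
  have bnd: "\<rho>0 \<le> 1 + k * A (Suc m) x s \<and> 1 + k * A (Suc m) x s \<le> \<rho>1" if "s \<in> {tt m<..<tt (Suc m)}" for s
    using that m x tt_basic(5)[of m] tt_basic(6)[of "Suc m"] by (intro coef) auto
  show ?thesis
    using continuous_ge_on_Ioo[OF cont _ ab t, of \<rho>0]
      continuous_ge_on_Ioo[OF continuous_on_minus[OF cont] _ ab t, of "- \<rho>1"] bnd
    by (metis neg_le_iff_le)
qed

text \<open>Instantiates the slab estimates on slab \<open>m\<close> and expresses them in global
  quantities. The existential \<open>B\<close> stands for the stiffness pairing, of which the
  recursion has to know only these two inequalities.\<close>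

lemma slab_facts:
  assumes m: "m < N"
  shows "0 \<le> S m" "0 \<le> D m" "0 \<le> J m" "0 \<le> r m" "0 \<le> src2 m"
    and "\<And>t. t \<in> {tt m..tt (Suc m)} \<Longrightarrow> Oint \<Omega> (\<lambda>x. (dtp (U (Suc m)) x t)\<^sup>2) \<le> K * S m"
    and "Am (Suc m) / 2 + c\<^sup>2 / 2 * h (Suc m) + \<rho>0 / 4 * J m + \<delta> / 2 * D m
      \<le> Am m / 2 + c\<^sup>2 / 2 * h m + K * \<bar>k\<bar> * r m * S m + sqrt (K * S m) * src2 m
        + (if m = 0 then \<Gamma> / \<rho>0 else 0) + \<delta> / 2 * GG m"
    and "\<exists>B. (\<forall>t\<in>{tt m..tt (Suc m)}. Oint \<Omega> (\<lambda>x. (norm (gradx (U (Suc m)) x t))\<^sup>2) \<le> K * (B + h m)) \<and>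
      3 / 8 * \<rho>0 * S m + c\<^sup>2 * B
      \<le> (4 * K * \<rho>1\<^sup>2 / \<rho>0 + \<rho>1) * J m + Am m + 2 * K * \<bar>k\<bar> * r m * S m + (if m = 0 then 4 * K / \<rho>0 * \<Gamma> else 0)
        + sqrt (K * S m) * src2 m + 3 / 2 * K * (\<delta> * D m) + \<delta> / 2 * GG m"
    and "0 \<le> Am (Suc m)"
proof -
  define a where "a = tt m"
  define b where "b = tt (Suc m)"
  have ab: "a < b" using tt_basic(4)[OF m] by (simp add: a_def b_def)
  have "Ppiece M \<Omega> p q (U (Suc m))" using U m by (simp add: Vht_def)
  then obtain cu where cu: "\<And>j. j \<le> q \<Longrightarrow> Vh M \<Omega> p (cu j)"
    and Ueq: "U (Suc m) = (\<lambda>x t. spoly a b (Suc q) (\<lambda>j. cu j x) t)"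
    by (rule Ppiece_obtain_spoly[OF ab]) blast
  have "Ppiece M \<Omega> p q (A (Suc m))" using A m by (simp add: Vht_def)
  then obtain ca where ca: "\<And>j. j \<le> q \<Longrightarrow> Vh M \<Omega> p (ca j)"
    and Aeq: "A (Suc m) = (\<lambda>x t. spoly a b (Suc q) (\<lambda>j. ca j x) t)"
    by (rule Ppiece_obtain_spoly[OF ab]) blast
  interpret sl: slab M \<Omega> p q K a b cu ca k \<rho>0 \<rho>1
    using q ab dom mesh cu ca K \<rho>0 coef_closed[OF m, folded a_def b_def, unfolded Aeq]
    by unfold_locales auto
  have Uu: "U (Suc m) = sl.u" unfolding Ueq by (intro ext) (simp add: sl.u_def)
  have dU: "dtp (U (Suc m)) = sl.v" by (simp add: Uu sl.dtp_fields)
  have A\<rho>: "1 + k * A (Suc m) x t = sl.\<rho> x t" for x t by (simp add: Aeq sl.\<rho>_def)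
  have dA: "dtp (A (Suc m)) = sl.\<alpha>'" unfolding Aeq by (rule sl.dtp_coefficient)
  have ab': "a \<in> {a..b}" "b \<in> {a..b}" using ab by auto
  \<comment> \<open>Agreement at the node makes the incoming energy of this slab the outgoing energy
    of the preceding one, so that the inequalities telescope.\<close>
  have contA: "A m x a = A (Suc m) x a" and contU: "U m x a = U (Suc m) x a" if "m \<noteq> 0" for x
  proof -
    have "m \<in> {1..<N}" using m that by simp
    then show "A m x a = A (Suc m) x a" "U m x a = U (Suc m) x a"
      using A U unfolding Vht_def a_def by blast+
  qed
  note dom_reg = sl.Oint_reg sl.Qint_reg
  have bvp: "bcont sl.\<Omega>r (vp m)"
  proof (cases "m = 0")
    case False
    then have "Ppiece M \<Omega> p q (U m)" using U m by (simp add: Vht_def)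
    then have "Vh M \<Omega> p (\<lambda>x. dtp (U m) x (tt m))" by (rule Ppiece_slice[OF Ppiece_dtp[OF _ q]])
    from bcont_subset[OF Vh_bcont[OF this dom(2)] sl.\<Omega>r(3)] show ?thesis using False by (simp add: vp_def[abs_def])
  qed (simp add: vp_def[abs_def] bcont_const)
  define gm where "gm x = (if m = 0 then g x else 0)" for x
  have gi: "set_integrable lebesgue sl.\<Omega>r (\<lambda>x. (gm x)\<^sup>2)"
  proof (cases "m = 0")
    case True
    have "set_integrable lebesgue sl.\<Omega>r (\<lambda>x. (g x)\<^sup>2)"
      using sl.\<Omega>r_sets sl.\<Omega>r(3) by (intro set_integrable_subset[OF g]) auto
    then show ?thesis using True by (simp add: gm_def)
  qed (simp add: gm_def set_integrable_def)
  \<comment> \<open>The discrete equation localized to this slab, for an arbitrary admissible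
    \<open>y\<close>; it is applied with the time derivative of \<open>u\<close> and with the
    projected test function.\<close>
  have local_eq: "Qint sl.\<Omega>r a b (\<lambda>x t. (k * sl.\<alpha>' x t * sl.v x t + sl.\<rho> x t * sl.dv x t) * y x t)
        + Oint sl.\<Omega>r (\<lambda>x. sl.\<rho> x a * (sl.v x a - vp m x) * y x a)
        + c\<^sup>2 * Qint sl.\<Omega>r a b (\<lambda>x t. sl.Gu x t \<bullet> Gy x t) + \<delta> * Qint sl.\<Omega>r a b (\<lambda>x t. sl.Gv x t \<bullet> Gy x t)
      = Qint sl.\<Omega>r a b (\<lambda>x t. f x t * y x t) + Oint sl.\<Omega>r (\<lambda>x. gm x * y x a)
        + \<delta> * Qint sl.\<Omega>r a b (\<lambda>x t. G x t \<bullet> Gy x t) + Qint sl.\<Omega>r a b (\<lambda>x t. \<xi> x t * dy x t)"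
    if y: "Ppiece M \<Omega> p (q - 1) y" "\<And>x t. x \<in> sl.\<Omega>r \<Longrightarrow> gradx y x t = Gy x t" "dtp y = dy" for y Gy dy
  proof -
    have n: "Suc m \<in> {1..N}" using m by simp
    have W: "Wht M \<Omega> p (q - 1) N (single_piece (Suc m) y)"
      using y(1) by (auto simp: Wht_def single_piece_def Ppiece_zero)
    have Ac: "\<forall>i\<in>{1..<N}. \<forall>x. A i x (tt i) = A (Suc i) x (tt i)"
      using A by (simp add: Vht_def)
    have "Bform \<Omega> k c \<delta> N tt A U (single_piece (Suc m) y) (\<lambda>_. 0)
        = Lform \<Omega> \<delta> N tt f g G \<xi> G0 (single_piece (Suc m) y) (\<lambda>_. 0)"
      by (rule solution[OF W Vh_zero])
    from this[unfolded Bform_single_piece[where tt=tt and A=A, OF n tt_basic(2) Ac] Lform_single_piece[where tt=tt, OF n tt_basic(2)]]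
    have main: "Qint \<Omega> a b (\<lambda>x t. dtp (\<lambda>y s. (1 + k * A (Suc m) y s) * dtp (U (Suc m)) y s) x t * y x t)
       + Oint \<Omega> (\<lambda>x. (1 + k * A (Suc m) x a) * (dtp (U (Suc m)) x a - vp m x) * y x a)
       + c\<^sup>2 * Qint \<Omega> a b (\<lambda>x t. gradx (U (Suc m)) x t \<bullet> gradx y x t)
       + \<delta> * Qint \<Omega> a b (\<lambda>x t. gradx (dtp (U (Suc m))) x t \<bullet> gradx y x t)
       = Qint \<Omega> a b (\<lambda>x t. f x t * y x t) + Oint \<Omega> (\<lambda>x. gm x * y x a)
       + \<delta> * Qint \<Omega> a b (\<lambda>x t. G x t \<bullet> gradx y x t) + Qint \<Omega> a b (\<lambda>x t. \<xi> x t * dtp y x t)"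
      by (simp add: a_def b_def vp_def gm_def cong: if_cong)
    have e: "Qint sl.\<Omega>r a b (\<lambda>x t. gradx sl.u x t \<bullet> gradx y x t) = Qint sl.\<Omega>r a b (\<lambda>x t. sl.Gu x t \<bullet> Gy x t)"
      "Qint sl.\<Omega>r a b (\<lambda>x t. gradx sl.v x t \<bullet> gradx y x t) = Qint sl.\<Omega>r a b (\<lambda>x t. sl.Gv x t \<bullet> Gy x t)"
      "Qint sl.\<Omega>r a b (\<lambda>x t. G x t \<bullet> gradx y x t) = Qint sl.\<Omega>r a b (\<lambda>x t. G x t \<bullet> Gy x t)"
      by (rule Qint_cong, simp add: sl.gradx_fields y(2))+
    show ?thesis
      using main unfolding A\<rho> dU unfolding Uu sl.dtp_momentum dom_reg y(3) e .
  qed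
  have Se: "S m = sl.S" 
    by (simp add: S_def sl.S_def dU dom_reg a_def[symmetric] b_def[symmetric])
  have De: "D m = sl.D" unfolding D_def sl.D_def dU dom_reg a_def[symmetric] b_def[symmetric]
    by (rule Qint_cong) (simp add: sl.gradx_fields)
  have Je: "J m = Oint sl.\<Omega>r (\<lambda>x. (sl.v x a - vp m x)\<^sup>2)" 
    by (simp add: J_def dU dom_reg a_def[symmetric])
  have Aa: "Am m = Oint sl.\<Omega>r (\<lambda>x. sl.\<rho> x a * (vp m x)\<^sup>2)"
    by (auto simp: Am_def vp_def contA[folded a_def] A\<rho> dom_reg a_def[symmetric])
  have Ab: "Am (Suc m) = Oint sl.\<Omega>r (\<lambda>x. sl.\<rho> x b * (sl.v x b)\<^sup>2)"
    by (simp add: Am_def A\<rho> dU dom_reg b_def[symmetric])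
  have Ht: "Oint \<Omega> (\<lambda>x. (norm (gradx (U (Suc m)) x t))\<^sup>2) = sl.H t" for t
    unfolding sl.H_def dom_reg Uu by (rule Oint_cong) (simp add: sl.gradx_fields)
  have hb: "h (Suc m) = sl.H b" using Ht[of b] by (simp add: h_def b_def[symmetric])
  have ha: "h m = sl.H a"
  proof (cases "m = 0")
    case True
    then have "a = tt 0" by (simp add: a_def)
    then show ?thesis using Ht[of a] True by (simp add: h_def)
  next
    case False
    then have "(\<lambda>y. U m y a) = (\<lambda>y. U (Suc m) y a)" using contU by auto
    then have "gradx (U m) x a = gradx (U (Suc m)) x a" for x by (simp add: gradx_def)
    then show ?thesis using Ht[of a] False by (simp add: h_def a_def[symmetric])
  qed
  have re: "r m = sl.r" 
    using sl.r_lebesgue by (simp add: r_def sl.R_def dA a_def[symmetric] b_def[symmetric])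
  have L1e: "L1 y m = sl.src y" for y 
    by (simp add: L1_def sl.src_def dom_reg a_def[symmetric] b_def[symmetric])
  have s2: "src2 m = sl.src f + sl.src \<xi> / (b - a)" by (simp add: src2_def L1e a_def[symmetric] b_def[symmetric])
  have GGe: "GG m = Qint sl.\<Omega>r a b (\<lambda>x t. (norm (G x t))\<^sup>2)" 
    by (simp add: GG_def dom_reg a_def[symmetric] b_def[symmetric])
  have \<Gamma>e: "Oint sl.\<Omega>r (\<lambda>x. (gm x)\<^sup>2) = (if m = 0 then \<Gamma> else 0)"
    by (simp add: gm_def \<Gamma>_def dom_reg)
  have zero: "(\<forall>x. gm x = 0) \<or> (\<forall>x. vp m x = 0)" by (simp add: gm_def vp_def)
  have T: "0 \<le> a" "b \<le> T" using tt_basic(5)[of m] tt_basic(6)[of "Suc m"] m by (auto simp: a_def b_def)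
  have Gr: "set_integrable lebesgue (sl.\<Omega>r \<times> {a<..<b}) (\<lambda>z. (norm (G (fst z) (snd z)))\<^sup>2)"
  proof (rule set_integrable_subset[OF G])
    show "sl.\<Omega>r \<times> {a<..<b} \<in> sets lebesgue" using sl.\<Omega>r_sets(2) by (intro sets_Times_lebesgue) auto
    show "sl.\<Omega>r \<times> {a<..<b} \<subseteq> \<Omega> \<times> {0<..<T}" using sl.\<Omega>r(3) T by auto
  qed
  note fr = L1L2_subset[OF f sl.\<Omega>r(3,4) sl.\<Omega>r_sets(2)] and \<xi>r = L1L2_subset[OF \<xi> sl.\<Omega>r(3,4) sl.\<Omega>r_sets(2)]
  note step = sl.slab_step[OF bvp gi zero fr \<xi>r T \<delta> Gr
      local_eq[OF sl.Ppiece_tests(1) sl.gradx_fields(2) sl.dtp_fields(2)]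
      local_eq[OF sl.Ppiece_tests(2) sl.gradx_fields(3) sl.dtp_fields(3)],
      folded Aa Ab Je GGe s2, unfolded \<Gamma>e, folded Se De hb ha re]
  show "0 \<le> S m" "0 \<le> D m" "0 \<le> J m" "0 \<le> r m" "0 \<le> src2 m"
    using sl.S_nonneg sl.D_nonneg sl.r_nonneg sl.src_nonneg ab unfolding Se De re s2
    by (auto simp: J_def intro: Oint_nonneg)
  show "Oint \<Omega> (\<lambda>x. (dtp (U (Suc m)) x t)\<^sup>2) \<le> K * S m" if "t \<in> {tt m..tt (Suc m)}" for t
    using sl.slice_bounds(1)[of t] that by (simp add: Se dU dom_reg a_def[symmetric] b_def[symmetric])
  show "Am (Suc m) / 2 + c\<^sup>2 / 2 * h (Suc m) + \<rho>0 / 4 * J m + \<delta> / 2 * D m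
      \<le> Am m / 2 + c\<^sup>2 / 2 * h m + K * \<bar>k\<bar> * r m * S m + sqrt (K * S m) * src2 m
        + (if m = 0 then \<Gamma> / \<rho>0 else 0) + \<delta> / 2 * GG m"
    using step(1) by (cases "m = 0") simp_all
  show "\<exists>B. (\<forall>t\<in>{tt m..tt (Suc m)}. Oint \<Omega> (\<lambda>x. (norm (gradx (U (Suc m)) x t))\<^sup>2) \<le> K * (B + h m)) \<and>
      3 / 8 * \<rho>0 * S m + c\<^sup>2 * B
      \<le> (4 * K * \<rho>1\<^sup>2 / \<rho>0 + \<rho>1) * J m + Am m + 2 * K * \<bar>k\<bar> * r m * S m + (if m = 0 then 4 * K / \<rho>0 * \<Gamma> else 0)
        + sqrt (K * S m) * src2 m + 3 / 2 * K * (\<delta> * D m) + \<delta> / 2 * GG m"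
  proof (intro exI conjI ballI)
    show "Oint \<Omega> (\<lambda>x. (norm (gradx (U (Suc m)) x t))\<^sup>2) \<le> K * (Qint sl.\<Omega>r a b (\<lambda>x t. sl.Gu x t \<bullet> sl.Gw x t) + h m)"
      if "t \<in> {tt m..tt (Suc m)}" for t
      using sl.stiffness_test[of t] that by (simp add: Ht ha a_def[symmetric] b_def[symmetric])
  qed (use step(2) in \<open>cases "m = 0", simp_all\<close>)
  show "0 \<le> Am (Suc m)" unfolding Ab
    using sl.\<rho>(1)[OF _ ab'(2)] \<rho>0 by (intro Oint_nonneg) (auto intro!: mult_nonneg_nonneg intro: order_trans less_imp_le)
qed

text \<open>Testing with \<open>w = 0\<close> and \<open>z\<close> the initial value shows that the
  discrete initial gradient is an orthogonal projection of \<open>G0\<close>. Young's inequality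
  with weight 1 then absorbs half of it.\<close>

lemma initial_bound: "h 0 \<le> Oint \<Omega> (\<lambda>x. (norm (G0 x))\<^sup>2)"
proof -
  define z where "z y = U 1 y 0" for y
  have "Ppiece M \<Omega> p q (U 1)" using U tt_basic(1) by (simp add: Vht_def)
  then have z: "Vh M \<Omega> p z" unfolding z_def[abs_def] by (rule Ppiece_slice)
  define O' where "O' = reg M \<Omega>"
  have O': "open O'" "bounded O'" "O' \<subseteq> \<Omega>" "\<Omega> - O' \<in> null_sets lebesgue" "O' \<in> sets borel"
    using dom open_reg[of \<Omega> M] reg_subset[of M \<Omega>] null_sets_reg[OF mesh] bounded_subset[of \<Omega> "reg M \<Omega>"]
    by (auto simp: O'_def)
  note r = Oint_null_diff[OF O'(3,4)]
  have "Wht M \<Omega> p (q - 1) N (\<lambda>_ _ _. 0)" by (simp add: Wht_def Ppiece_zero)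
  from solution[OF this z, unfolded Bform_initial Lform_initial]
  have eq: "Oint O' (\<lambda>x. (norm (sgrad z x))\<^sup>2) = Oint O' (\<lambda>x. G0 x \<bullet> sgrad z x)"
    by (simp add: z_def[abs_def] power2_norm_eq_inner r)
  have zi: "set_integrable lebesgue O' (\<lambda>x. (norm (sgrad z x))\<^sup>2)"
    using bcont_sgrad[OF mesh z] O' unfolding O'_def
    by (intro bcont_set_integrable_lebesgue(1) bcont_intros) auto
  have Gi: "set_integrable lebesgue O' (\<lambda>x. (norm (G0 x))\<^sup>2)"
    using O' by (intro set_integrable_subset[OF G0]) auto
  have "\<bar>Oint O' (\<lambda>x. G0 x \<bullet> sgrad z x)\<bar> \<le> (1/2) * (Oint O' (\<lambda>x. (norm (G0 x))\<^sup>2) + Oint O' (\<lambda>x. (norm (sgrad z x))\<^sup>2))"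
    using set_integral_young[OF Gi zi zero_less_one] by (simp add: Oint_def)
  then have "Oint O' (\<lambda>x. (norm (sgrad z x))\<^sup>2) \<le> Oint O' (\<lambda>x. (norm (G0 x))\<^sup>2)"
    using eq by simp
  then show ?thesis by (simp add: h_def tt_basic(2) gradx_def z_def[abs_def] r)
qed

text \<open>The closed slabs share end points. Passing to open intervals leaves the integrals
  unchanged and makes the family disjoint.\<close>

lemma sum_L1:
  assumes "L1L2 \<Omega> T y"
  shows "(\<Sum>m<N. L1 y m) \<le> L1L2_norm \<Omega> T y"
  unfolding L1_def L1L2_norm_def LINT_open_interval
proof (rule sum_set_integral_disjoint_le)
  show "set_integrable lebesgue {0<..<T} (\<lambda>t. sqrt (Oint \<Omega> (\<lambda>x. (y x t)\<^sup>2)))"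
    using assms by (simp add: L1L2_def)
  show "{tt i<..<tt (Suc i)} \<subseteq> {0<..<T}" if "i \<in> {..<N}" for i
    using that tt_basic(5)[of i] tt_basic(6)[of "Suc i"] by auto
qed (auto intro: time_partition_disjoint[OF tt] Oint_nonneg)

lemma sum_GG: "(\<Sum>m<N. GG m) \<le> Qint \<Omega> 0 T (\<lambda>x t. (norm (G x t))\<^sup>2)"
  unfolding GG_def Qint_open_interval
proof (rule sum_set_integral_disjoint_le[OF G])
  show "\<Omega> \<times> {tt i<..<tt (Suc i)} \<in> sets lebesgue" for i
  proof -
    show ?thesis using dom by (intro sets_Times_lebesgue) auto
  qed
  show "\<Omega> \<times> {tt i<..<tt (Suc i)} \<subseteq> \<Omega> \<times> {0<..<T}" if "i \<in> {..<N}" for i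
    using that tt_basic(5)[of i] tt_basic(6)[of "Suc i"] by auto
  show "disjoint_family_on (\<lambda>i. \<Omega> \<times> {tt i<..<tt (Suc i)}) {..<N}"
    using time_partition_disjoint[OF tt] unfolding disjoint_family_on_def by blast
qed auto

end

section \<open>Stability\<close>

lemma sum_from_1_eq: "(\<Sum>n=1..N. F n) = (\<Sum>m<N. F (Suc m) :: real)"
  by (simp add: sum.atLeast1_atMost_eq)

theorem mainTheorem1:
  fixes \<Omega> :: "'a::euclidean_space set"
    and T k c \<delta>bar alo ahi \<sigma> :: real
    and p q :: nat
  assumes dim: "DIM('a) \<le> 3"
    and dom: "polytopic_domain \<Omega>"
    and T: "T > 0" and c: "c > 0" and dbar: "\<delta>bar > 0"
    and pq: "p \<ge> 1" "q \<ge> 1"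
    and alo: "alo > 0" and ahi: "ahi > 0"
  shows "\<exists>C\<alpha>>0. \<exists>C>0. \<forall>M N tt \<delta> A U f u0 G0 u1 \<mu> Mx Mt G \<xi>.
     conforming_mesh M \<Omega> \<and> shape_regular \<sigma> M \<and> time_partition T N tt \<and>
     0 \<le> \<delta> \<and> \<delta> \<le> \<delta>bar \<and>
     Vht M \<Omega> p q N tt A \<and> assumption_N \<Omega> T k alo ahi N tt A \<and>
     \<bar>k\<bar> * L1Linf_dt \<Omega> N tt A \<le> C\<alpha> \<and>
     L1L2 \<Omega> T f \<and> H10 \<Omega> u0 G0 \<and>
     set_borel_measurable lebesgue \<Omega> (\<lambda>x. (1 + k * u0 x) * u1 x) \<and>
     set_integrable lebesgue \<Omega> (\<lambda>x. ((1 + k * u0 x) * u1 x)\<^sup>2) \<and>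
     H1H10 \<Omega> T \<mu> Mx Mt G \<and>
     set_borel_measurable lebesgue (\<Omega> \<times> {0<..<T}) (\<lambda>z. \<xi> (fst z) (snd z)) \<and>
     set_integrable lebesgue (\<Omega> \<times> {0<..<T}) (\<lambda>z. (\<xi> (fst z) (snd z))\<^sup>2) \<and>
     Vht M \<Omega> p q N tt U \<and>
     (\<forall>W z. Wht M \<Omega> p (q - 1) N W \<and> Vh M \<Omega> p z \<longrightarrow>
        Bform \<Omega> k c \<delta> N tt A U W z =
        Lform \<Omega> \<delta> N tt f (\<lambda>x. (1 + k * u0 x) * u1 x) G \<xi> G0 W z)
     \<longrightarrow> energy_sq \<Omega> c \<delta> N tt U \<le>
         C * ((L1L2_norm \<Omega> T f)\<^sup>2
              + Oint \<Omega> (\<lambda>x. ((1 + k * u0 x) * u1 x)\<^sup>2)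
              + c\<^sup>2 * Oint \<Omega> (\<lambda>x. (norm (G0 x))\<^sup>2)
              + \<delta>bar * Qint \<Omega> 0 T (\<lambda>x t. (norm (G x t))\<^sup>2)
              + (\<Sum>n=1..N. LINT t:{tt (n - 1)..tt n}|lebesgue.
                   sqrt (Oint \<Omega> (\<lambda>x. (\<xi> x t / (tt n - tt (n - 1)))\<^sup>2)))\<^sup>2)"
proof -
  have dom': "open \<Omega>" "bounded \<Omega>" "\<Omega> \<noteq> {}" using dom by (auto simp: polytopic_domain_def)
  \<comment> \<open>Fixed by \<open>q\<close> and the value spaces, before mesh, partition, data and
    \<delta> are introduced.\<close>
  obtain K where K: "K \<ge> 1" "sup_const q K TYPE(real)" "sup_const q K TYPE('a)" "value_const q K TYPE('a)"
    using ex_slab_const[OF pq(2)] by blast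
  define \<rho>0 where "\<rho>0 = 1 - \<bar>k\<bar> * alo"
  define \<rho>1 where "\<rho>1 = 1 + \<bar>k\<bar> * ahi"
  show ?thesis
  proof (cases "\<rho>0 > 0")
    \<comment> \<open>Without a positive lower bound no coefficient satisfies the nondegeneracy
      assumption, and the claim is vacuous.\<close>
    case False
    then have "\<not> assumption_N \<Omega> T k alo ahi N tt A" for N tt A
      by (simp add: assumption_N_def \<rho>0_def)
    then show ?thesis by (intro exI[of _ 1] conjI) auto
  next
    case \<rho>0: True
    have "\<rho>1 \<ge> 0" using ahi by (simp add: \<rho>1_def)
    then have C1: "4 * K * \<rho>1\<^sup>2 / \<rho>0 + \<rho>1 \<ge> 0" using K(1) \<rho>0 by simp
    obtain C\<alpha> C where C\<alpha>: "C\<alpha> > 0" and C: "C > 0" and rec: "recursion_consts K \<rho>0 (4 * K * \<rho>1\<^sup>2 / \<rho>0 + \<rho>1) C\<alpha> C"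
      using slab_recursion_bound[OF K(1) \<rho>0 C1] by blast
    \<comment> \<open>The two suprema contribute \<open>2 * K\<close>, half the terminal norm
      \<open>K / 2\<close>, and the jumps, the two nodal gradients and the damping together
      \<open>4\<close>. The outer factor 2 separates the squares of the two source norms.\<close>
    define C' where "C' = 2 * ((2 * K + K / 2 + 4) * C)"
    have C': "C' > 0" using C K(1) by (simp add: C'_def)
    show ?thesis
    proof (rule exI[of _ C\<alpha>], rule conjI[OF C\<alpha>], rule exI[of _ C'], rule conjI[OF C'], intro allI impI, elim conjE, goal_cases)
      case (1 M N tt \<delta> A U f u0 G0 u1 \<mu> Mx Mt G \<xi>)
      define g where "g x = (1 + k * u0 x) * u1 x" for x
      have G: "set_integrable lebesgue (\<Omega> \<times> {0<..<T}) (\<lambda>z. (norm (G (fst z) (snd z)))\<^sup>2)"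
        using \<open>H1H10 \<Omega> T \<mu> Mx Mt G\<close> by (simp add: H1H10_def Let_def)
      have \<xi>: "L1L2 \<Omega> T \<xi>" using 1 by (intro L1L2_of_square_integrable)
      have N': "\<rho>0 \<le> 1 + k * A n x t \<and> 1 + k * A n x t \<le> \<rho>1"
        if "n \<in> {1..N}" "x \<in> \<Omega>" "t \<in> {tt (n - 1)..tt n}" "0 < t" "t < T" for n x t
        using \<open>assumption_N \<Omega> T k alo ahi N tt A\<close> that unfolding assumption_N_def \<rho>0_def \<rho>1_def by blast
      have G0: "set_integrable lebesgue \<Omega> (\<lambda>x. (norm (G0 x))\<^sup>2)"
        using \<open>H10 \<Omega> u0 G0\<close> by (simp add: H10_def)
      have gi: "set_integrable lebesgue \<Omega> (\<lambda>x. (g x)\<^sup>2)" using 1 by (simp add: g_def)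
      have sol: "Bform \<Omega> k c \<delta> N tt A U W z = Lform \<Omega> \<delta> N tt f g G \<xi> G0 W z"
        if "Wht M \<Omega> p (q - 1) N W" "Vh M \<Omega> p z" for W z
        using 1 that unfolding g_def[abs_def] by blast
      interpret sc: scheme M \<Omega> T k c \<delta> p q N tt A U f g G \<xi> G0 K \<rho>0 \<rho>1
        by unfold_locales (fact pq(2) dom' 1 N' \<rho>0 K gi G \<xi> G0 sol)+
      define X where "X = (\<Sum>n=1..N. LINT t:{tt (n - 1)..tt n}|lebesgue.
                   sqrt (Oint \<Omega> (\<lambda>x. (\<xi> x t / (tt n - tt (n - 1)))\<^sup>2)))"
      have Xe: "X = (\<Sum>m<N. sc.L1 \<xi> m / (tt (Suc m) - tt m))"
        unfolding X_def sum_from_1_eq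
      proof (rule sum.cong)
        fix m assume "m \<in> {..<N}"
        then have "tt m < tt (Suc m)" by (intro sc.tt_basic) simp
        then have "sqrt (Oint \<Omega> (\<lambda>x. (\<xi> x t / (tt (Suc m) - tt m))\<^sup>2)) = sqrt (Oint \<Omega> (\<lambda>x. (\<xi> x t)\<^sup>2)) / (tt (Suc m) - tt m)" for t
          by (simp add: power_divide Oint_def real_sqrt_divide)
        then show "(LINT t:{tt (Suc m - 1)..tt (Suc m)}|lebesgue. sqrt (Oint \<Omega> (\<lambda>x. (\<xi> x t / (tt (Suc m) - tt (Suc m - 1)))\<^sup>2)))
            = sc.L1 \<xi> m / (tt (Suc m) - tt m)"
          by (simp add: sc.L1_def)
      qed simp
      define F where "F = L1L2_norm \<Omega> T f"
      define \<gamma> where "\<gamma> = c\<^sup>2 * Oint \<Omega> (\<lambda>x. (norm (G0 x))\<^sup>2)"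
      define GT where "GT = Qint \<Omega> 0 T (\<lambda>x t. (norm (G x t))\<^sup>2)"
      have GT0: "GT \<ge> 0" unfolding GT_def by (rule Qint_nonneg) simp
      have "\<forall>m. \<exists>B. m < N \<longrightarrow> (\<forall>t\<in>{tt m..tt (Suc m)}. Oint \<Omega> (\<lambda>x. (norm (gradx (U (Suc m)) x t))\<^sup>2) \<le> K * (B + sc.h m)) \<and>
        3 / 8 * \<rho>0 * sc.S m + c\<^sup>2 * B
        \<le> (4 * K * \<rho>1\<^sup>2 / \<rho>0 + \<rho>1) * sc.J m + sc.Am m + 2 * K * \<bar>k\<bar> * sc.r m * sc.S m + (if m = 0 then 4 * K / \<rho>0 * sc.\<Gamma> else 0)
          + sqrt (K * sc.S m) * sc.src2 m + 3 / 2 * K * (\<delta> * sc.D m) + \<delta> / 2 * sc.GG m"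
        using sc.slab_facts(8) by blast
      then obtain B where B1: "\<And>m t. m < N \<Longrightarrow> t \<in> {tt m..tt (Suc m)} \<Longrightarrow>
          Oint \<Omega> (\<lambda>x. (norm (gradx (U (Suc m)) x t))\<^sup>2) \<le> K * (B m + sc.h m)"
        and B2: "\<And>m. m < N \<Longrightarrow> 3 / 8 * \<rho>0 * sc.S m + c\<^sup>2 * B m
        \<le> (4 * K * \<rho>1\<^sup>2 / \<rho>0 + \<rho>1) * sc.J m + sc.Am m + 2 * K * \<bar>k\<bar> * sc.r m * sc.S m + (if m = 0 then 4 * K / \<rho>0 * sc.\<Gamma> else 0)
          + sqrt (K * sc.S m) * sc.src2 m + 3 / 2 * K * (\<delta> * sc.D m) + \<delta> / 2 * sc.GG m"
        by metis
      have Bh: "0 \<le> B m + sc.h m" if m: "m < N" for m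
      proof -
        have "0 \<le> Oint \<Omega> (\<lambda>x. (norm (gradx (U (Suc m)) x (tt m)))\<^sup>2)" by (rule Oint_nonneg) simp
        also have "\<dots> \<le> K * (B m + sc.h m)" using sc.tt_basic(4)[OF m] by (intro B1[OF m]) auto
        finally show ?thesis using K(1) by (simp add: zero_le_mult_iff)
      qed
      have GGm: "0 \<le> sc.GG m" for m unfolding sc.GG_def by (rule Qint_nonneg) simp
      have h0: "0 \<le> sc.h m" for m unfolding sc.h_def by (rule Oint_nonneg) simp
      have \<Gamma>0: "0 \<le> sc.\<Gamma>" unfolding sc.\<Gamma>_def by (rule Oint_nonneg) simp
      \<comment> \<open>The recursion sees \<open>f\<close> and the weighted \<xi> as one source,
        hence the square of the sum.\<close>
      define R where "R = (F + X)\<^sup>2 + sc.\<Gamma> + \<gamma> + \<delta>bar * GT"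
      have "(\<forall>m<N. sc.S m \<le> C * R \<and> c\<^sup>2 * B m + c\<^sup>2 * sc.h m \<le> C * R) \<and> (\<forall>m\<le>N. c\<^sup>2 * sc.h m \<le> C * R) \<and>
        (\<Sum>m<N. sc.J m) \<le> C * R \<and> (\<Sum>m<N. \<delta> * sc.D m) \<le> C * R"
        unfolding R_def
      \<comment> \<open>The factors c^2 and \<delta> are absorbed into the sequences, so the
        constants of the recursion do not involve them.\<close>
      proof (rule rec[unfolded recursion_consts_def, rule_format, where \<kappa> = "\<bar>k\<bar>" and r = sc.r and s = sc.src2 and A = sc.Am
            and G = "\<lambda>m. \<delta> * sc.GG m"])
        show "0 \<le> sc.S m \<and> 0 \<le> \<delta> * sc.D m \<and> 0 \<le> sc.J m \<and> 0 \<le> sc.r m \<and> 0 \<le> sc.src2 m \<and> 0 \<le> \<delta> * sc.GG m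
           \<and> 0 \<le> c\<^sup>2 * B m + c\<^sup>2 * sc.h m" if "m < N" for m
          using sc.slab_facts(1-5)[OF that] mult_nonneg_nonneg[OF zero_le_power2 Bh[OF that], of c] GGm sc.\<delta>
          by (simp add: distrib_left)
        show "0 \<le> sc.Am m \<and> 0 \<le> c\<^sup>2 * sc.h m" if "m \<le> N" for m
          using sc.slab_facts(9)[of "m - 1"] that h0 by (cases m) (auto simp: sc.Am_def)
        show "sc.Am 0 = 0" by (simp add: sc.Am_def)
        show "sc.Am (Suc m) / 2 + c\<^sup>2 * sc.h (Suc m) / 2 + \<rho>0 / 4 * sc.J m + \<delta> * sc.D m / 2
          \<le> sc.Am m / 2 + c\<^sup>2 * sc.h m / 2 + K * \<bar>k\<bar> * sc.r m * sc.S m + sqrt (K * sc.S m) * sc.src2 m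
            + (if m = 0 then sc.\<Gamma> / \<rho>0 else 0) + \<delta> * sc.GG m / 2" if "m < N" for m
          using sc.slab_facts(7)[OF that] by simp
        show "3 / 8 * \<rho>0 * sc.S m + c\<^sup>2 * B m
          \<le> (4 * K * \<rho>1\<^sup>2 / \<rho>0 + \<rho>1) * sc.J m + sc.Am m + 2 * K * \<bar>k\<bar> * sc.r m * sc.S m + (if m = 0 then 4 * K / \<rho>0 * sc.\<Gamma> else 0)
          + sqrt (K * sc.S m) * sc.src2 m + 3 / 2 * K * (\<delta> * sc.D m) + \<delta> * sc.GG m / 2" if "m < N" for m
          using B2[OF that] by simp
        show "c\<^sup>2 * sc.h 0 \<le> \<gamma>" unfolding \<gamma>_def using sc.initial_bound by (intro mult_left_mono) auto
        show "(\<Sum>m<N. sc.src2 m) \<le> F + X"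
          unfolding sc.src2_def sum.distrib Xe F_def using sc.sum_L1[OF sc.f] by simp
        show "(\<Sum>m<N. \<delta> * sc.GG m) \<le> \<delta>bar * GT"
        proof -
          \<comment> \<open>Here \<delta> is replaced by its upper bound, which is why the data term
            carries \<open>\<delta>bar\<close>.\<close>
          have "\<delta> * (\<Sum>m<N. sc.GG m) \<le> \<delta>bar * GT"
            using \<open>\<delta> \<le> \<delta>bar\<close> sc.sum_GG[folded GT_def] dbar GGm by (intro mult_mono sum_nonneg) auto
          then show ?thesis by (simp add: sum_distrib_left)
        qed
        have "L1Linf_dt \<Omega> N tt A = (\<Sum>m<N. sc.r m)"
          
          unfolding L1Linf_dt_def sc.r_def sum_from_1_eq by simp
        then show "\<bar>k\<bar> * (\<Sum>m<N. sc.r m) \<le> C\<alpha>" using 1 by simp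
      qed (use \<Gamma>0 sc.tt_basic in auto)
      then have SR: "\<And>m. m < N \<Longrightarrow> sc.S m \<le> C * R" and BR: "\<And>m. m < N \<Longrightarrow> c\<^sup>2 * B m + c\<^sup>2 * sc.h m \<le> C * R"
        and hR: "\<And>m. m \<le> N \<Longrightarrow> c\<^sup>2 * sc.h m \<le> C * R"
        and JR: "(\<Sum>m<N. sc.J m) \<le> C * R" and DR: "(\<Sum>m<N. \<delta> * sc.D m) \<le> C * R" by auto
      have N1: "1 \<le> N" by (rule sc.tt_basic)
      have vR: "Oint \<Omega> (\<lambda>x. (dtp (U n) x t)\<^sup>2) \<le> K * (C * R)" if n: "n \<in> {1..N}" and t: "t \<in> {tt (n - 1)..tt n}" for n t
      proof -
        obtain m where m: "n = Suc m" "m < N" using n by (cases n) auto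
        then have "K * sc.S m \<le> K * (C * R)" using SR K(1) by (intro mult_left_mono) auto
        then show ?thesis using sc.slab_facts(6)[OF m(2), of t] t m(1) by simp
      qed
      have gR: "c\<^sup>2 * Oint \<Omega> (\<lambda>x. (norm (gradx (U n) x t))\<^sup>2) \<le> K * (C * R)" if n: "n \<in> {1..N}" and t: "t \<in> {tt (n - 1)..tt n}" for n t
      proof -
        obtain m where m: "n = Suc m" "m < N" using n by (cases n) auto
        have "c\<^sup>2 * Oint \<Omega> (\<lambda>x. (norm (gradx (U n) x t))\<^sup>2) \<le> c\<^sup>2 * (K * (B m + sc.h m))"
          using B1[OF m(2), of t] t m by (intro mult_left_mono) auto
        also have "\<dots> = K * (c\<^sup>2 * B m + c\<^sup>2 * sc.h m)" by (simp add: algebra_simps)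
        also have "\<dots> \<le> K * (C * R)" using BR[OF m(2)] K(1) by (intro mult_left_mono) auto
        finally show ?thesis .
      qed
      have ne: "(SIGMA n:{1..N}. {tt (n - 1)..tt n}) \<noteq> {}"
      proof -
        have "(1, tt 0) \<in> (SIGMA n:{1..N}. {tt (n - 1)..tt n})" using N1 sc.tt_basic(4)[of 0] by auto
        then show ?thesis by blast
      qed
      have e1: "(SUP (n, t)\<in>(SIGMA n:{1..N}. {tt (n - 1)..tt n}). Oint \<Omega> (\<lambda>x. (dtp (U n) x t)\<^sup>2)) \<le> K * (C * R)"
        by (rule cSUP_least[OF ne]) (use vR in auto)
      have e2: "c\<^sup>2 * (SUP (n, t)\<in>(SIGMA n:{1..N}. {tt (n - 1)..tt n}). Oint \<Omega> (\<lambda>x. (norm (gradx (U n) x t))\<^sup>2)) \<le> K * (C * R)"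
      proof -
        have c2: "c\<^sup>2 > 0" using c by simp
        have "(SUP (n, t)\<in>(SIGMA n:{1..N}. {tt (n - 1)..tt n}). Oint \<Omega> (\<lambda>x. (norm (gradx (U n) x t))\<^sup>2)) \<le> K * (C * R) / c\<^sup>2"
          by (rule cSUP_least[OF ne]) (use gR c2 in \<open>auto simp: pos_le_divide_eq mult.commute\<close>)
        then show ?thesis using c2 by (simp add: pos_le_divide_eq mult.commute)
      qed
      have e3: "Oint \<Omega> (\<lambda>x. (dtp (U N) x (tt N))\<^sup>2) \<le> K * (C * R)"
        using N1 sc.tt_basic(4)[of "N - 1"] by (intro vR) auto
      \<comment> \<open>Since \<open>vp 0\<close> is 0, \<open>sc.J 0\<close> is the squared initial
        trace; the sum of all \<open>sc.J\<close> thus contains the interior jumps and the initial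
        part of the jump seminorm.\<close>
      have e4: "(\<Sum>n\<in>{1..<N}. Oint \<Omega> (\<lambda>x. (dtp (U n) x (tt n) - dtp (U (Suc n)) x (tt n))\<^sup>2)) + Oint \<Omega> (\<lambda>x. (dtp (U 1) x 0)\<^sup>2) \<le> C * R"
      proof -
        have "(\<Sum>m<N. sc.J m) = sc.J 0 + (\<Sum>m\<in>{1..<N}. sc.J m)"
          using N1 by (simp add: lessThan_atLeast0 sum.atLeast_Suc_lessThan)
        moreover have "sc.J 0 = Oint \<Omega> (\<lambda>x. (dtp (U 1) x 0)\<^sup>2)"
          by (simp add: sc.J_def sc.vp_def sc.tt_basic(2))
        moreover have "(\<Sum>m\<in>{1..<N}. sc.J m) = (\<Sum>n\<in>{1..<N}. Oint \<Omega> (\<lambda>x. (dtp (U n) x (tt n) - dtp (U (Suc n)) x (tt n))\<^sup>2))"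
          by (rule sum.cong) (auto simp: sc.J_def sc.vp_def power2_commute)
        ultimately show ?thesis using JR by simp
      qed
      have e5: "c\<^sup>2 * Oint \<Omega> (\<lambda>x. (norm (gradx (U N) x (tt N)))\<^sup>2) \<le> C * R"
        using hR[of N] N1 by (simp add: sc.h_def)
      have e6: "c\<^sup>2 * Oint \<Omega> (\<lambda>x. (norm (gradx (U 1) x 0))\<^sup>2) \<le> C * R"
        using hR[of 0] by (simp add: sc.h_def sc.tt_basic(2))
      have e7: "\<delta> * (\<Sum>n=1..N. Qint \<Omega> (tt (n - 1)) (tt n) (\<lambda>x t. (norm (gradx (dtp (U n)) x t))\<^sup>2)) \<le> C * R"
        using DR unfolding sc.D_def sum_from_1_eq by (simp add: sum_distrib_left)
      have CR0: "0 \<le> C * R"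
        by (rule order_trans[OF mult_nonneg_nonneg[OF zero_le_power2 h0] hR[of 0]]) simp
      have energy: "energy_sq \<Omega> c \<delta> N tt U \<le> (2 * K + K / 2 + 4) * (C * R)"
      proof -
        have lin: "x1 + x2 + (1 / 2) * (x3 + x4 + x5) + x6 + x7 + x8 \<le> Z"
          if "Z = y + y + y / 2 + 4 * y'" "x1 \<le> y" "x2 \<le> y" "x3 \<le> y" "x4 + x5 \<le> y'"
            "x6 \<le> y'" "x7 \<le> y'" "x8 \<le> y'" "0 \<le> y'"
          for Z y y' x1 x2 x3 x4 x5 x6 x7 x8 :: real
          using that by argo
        have "(2 * K + K / 2 + 4) * (C * R) = K * (C * R) + K * (C * R) + K * (C * R) / 2 + 4 * (C * R)"
          by (simp add: algebra_simps)
        then show ?thesis unfolding energy_sq_def by (rule lin[OF _ e1 e2 e3 e4 e5 e6 e7 CR0])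
      qed
      define data where "data = F\<^sup>2 + sc.\<Gamma> + \<gamma> + \<delta>bar * GT + X\<^sup>2"
      have "R \<le> 2 * data"
      proof -
        have "(F + X)\<^sup>2 \<le> 2 * F\<^sup>2 + 2 * X\<^sup>2"
          using zero_le_power2[of "F - X"] by (simp add: power2_eq_square algebra_simps)
        moreover have "0 \<le> \<gamma>" unfolding \<gamma>_def by (intro mult_nonneg_nonneg Oint_nonneg) auto
        moreover have "0 \<le> \<delta>bar * GT" using dbar GT0 by simp
        ultimately show ?thesis using \<Gamma>0 unfolding R_def data_def by argo
      qed
      then have "(2 * K + K / 2 + 4) * (C * R) \<le> (2 * K + K / 2 + 4) * (C * (2 * data))"
        using C K(1) by (intro mult_left_mono) auto
      also have "\<dots> = C' * data" by (simp add: C'_def)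
      finally have "energy_sq \<Omega> c \<delta> N tt U \<le> C' * data" using energy by linarith
      then show ?case
        unfolding data_def F_def \<gamma>_def GT_def X_def sc.\<Gamma>_def g_def .
    qed
  qed
qed

end
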